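(* Let $\mathcal X$ be a Banach space with norm $\|\cdot\|$, let $p\in[1,\infty)$, and let $\mu$ be a probability measure on $\mathcal X$ satisfying a log Sobolev inequality with constant $C$. Let $\hat\mu$ be the empirical measure of $n$ independent samples from $\mu$. Then for all $t>0$, $$\mathbb P\left[W_p(\hat\mu,\mu)-\mathbb E\,W_p(\hat\mu,\mu)\ge t\right]\le\exp\left(-\frac{n^{\frac{2}{2\vee p}}\,t^2}{2C}\right).$$
   Context: $a\vee b=\max(a,b)$. A probability measure $\mu$ on $\mathcal X$ satisfies a log Sobolev inequality with constant $C$ if $$\mathbb E_\mu\left[f(X)^2\log f(X)^2\right]-\mathbb E_\mu\left[f(X)^2\right]\log\mathbb E_\mu\left[f(X)^2\right]\le 2C\,\mathbb E_\mu\|\nabla f(X)\|^2$$ for all smooth functions $f:\mathcal X\to\mathbb R$ such that the expectations are finite, where $\|\nabla f(x)\|=\sup_{y}\lim_{t\downarrow0}\frac{|f(x+ty)-f(x)|}{t\|y\|}$. For probability measures $\mu,\nu$ on $\mathcal X$, $W_p(\mu,\nu)=\inf_{\xi\in\mathcal C(\mu,\nu)}\left[\mathbb E_{(X,Y)\sim\xi}\|X-Y\|^p\right]^{1/p}$, where $\mathcal C(\mu,\nu)$ is the set of all distributions on $\mathcal X^2$ with marginals $\mu$ and $\nu$. The empirical measure $\hat\mu$ puts mass $1/n$ at each of the $n$ samples.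
   Formalization: The measure μ is assumed Borel and carried by a separable closed subset of the Banach space (automatic if the space is separable); otherwise the norm of X−Y, and so W_p of the samples, need not be measurable. *)

theory Defs
  imports "HOL-Probability.Probability"
begin

subsection \<open>Smooth functions on a normed space\<close>

text \<open>
  A continuous \<open>k\<close>-linear form is represented as a function on lists, of which only the values
  at lists of length \<open>k\<close> matter. For \<open>k = 0\<close> this is just a number (the value at the empty list).
\<close>

definition bounded_multilinear_form :: "nat \<Rightarrow> ('a::real_normed_vector list \<Rightarrow> real) \<Rightarrow> bool" where
  "bounded_multilinear_form k L \<longleftrightarrow>
     (\<forall>us ws v w c. length us + length ws + 1 = k \<longrightarrow>
        L (us @ (v + w) # ws) = L (us @ v # ws) + L (us @ w # ws) \<and>
        L (us @ (c *\<^sub>R v) # ws) = c * L (us @ v # ws)) \<and>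
     (\<exists>K. \<forall>vs. length vs = k \<longrightarrow> \<bar>L vs\<bar> \<le> K * prod_list (map norm vs))"

text \<open>
  \<open>f\<close> is smooth if it is infinitely often Frechet differentiable: \<open>D k x\<close> is the \<open>k\<close>-th derivative
  at \<open>x\<close>, and the last conjunct says that \<open>h \<mapsto> D (k + 1) x (h, \<dots>)\<close> is the Frechet derivative of
  \<open>D k\<close> at \<open>x\<close> with respect to the operator norm on continuous \<open>k\<close>-linear forms. The type of the
  iterated Frechet derivative depends on \<open>k\<close>, which is why forms on lists are used.
\<close>

definition smooth :: "('a::real_normed_vector \<Rightarrow> real) \<Rightarrow> bool" where
  "smooth f \<longleftrightarrow>
     (\<exists>D :: nat \<Rightarrow> 'a \<Rightarrow> 'a list \<Rightarrow> real.
        (\<forall>x. D 0 x [] = f x) \<and>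
        (\<forall>k x. bounded_multilinear_form k (D k x)) \<and>
        (\<forall>k x. \<forall>e>0. \<exists>d>0. \<forall>h vs. norm h < d \<longrightarrow> length vs = k \<longrightarrow>
           \<bar>D k (x + h) vs - D k x vs - D (Suc k) x (h # vs)\<bar>
             \<le> e * norm h * prod_list (map norm vs)))"

subsection \<open>Log Sobolev inequality\<close>

text \<open>
  The direction \<open>y = 0\<close> contributes the value \<open>0\<close> because of \<open>x / 0 = 0\<close>. For smooth \<open>f\<close> the
  limits exist and the supremum is over a bounded set, so no default values are involved.
\<close>

definition grad_norm :: "('a::real_normed_vector \<Rightarrow> real) \<Rightarrow> 'a \<Rightarrow> real" where
  "grad_norm f x =
     (SUP y. Lim (at_right 0) (\<lambda>t::real. \<bar>f (x + t *\<^sub>R y) - f x\<bar> / (t * norm y)))"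

text \<open>The convention \<open>0 log 0 = 0\<close> is built into \<open>ln 0 = 0\<close>.\<close>

definition log_sobolev :: "'a::real_normed_vector measure \<Rightarrow> real \<Rightarrow> bool" where
  "log_sobolev \<mu> C \<longleftrightarrow>
     (\<forall>f. smooth f \<longrightarrow>
        integrable \<mu> (\<lambda>x. (f x)\<^sup>2) \<longrightarrow>
        integrable \<mu> (\<lambda>x. (f x)\<^sup>2 * ln ((f x)\<^sup>2)) \<longrightarrow>
        integrable \<mu> (\<lambda>x. (grad_norm f x)\<^sup>2) \<longrightarrow>
        (\<integral>x. (f x)\<^sup>2 * ln ((f x)\<^sup>2) \<partial>\<mu>) - (\<integral>x. (f x)\<^sup>2 \<partial>\<mu>) * ln (\<integral>x. (f x)\<^sup>2 \<partial>\<mu>)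
          \<le> 2 * C * (\<integral>x. (grad_norm f x)\<^sup>2 \<partial>\<mu>))"

subsection \<open>Wasserstein distance\<close>

text \<open>
  Couplings live on the Borel sigma-algebra of the product space, on which the distance is
  always measurable; in the separable case it is the product sigma-algebra.
\<close>

definition couplings ::
    "'a::real_normed_vector measure \<Rightarrow> 'a measure \<Rightarrow> ('a \<times> 'a) measure set" where
  "couplings \<mu> \<nu> =
     {\<xi>. prob_space \<xi> \<and> sets \<xi> = sets borel \<and> distr \<xi> borel fst = \<mu> \<and> distr \<xi> borel snd = \<nu>}"

text \<open>\<open>a\<close>-th power of an extended nonnegative number, for an exponent \<open>a > 0\<close>.\<close>

definition ennpowr :: "ennreal \<Rightarrow> real \<Rightarrow> ennreal" where
  "ennpowr x a = (if x = \<top> then \<top> else ennreal (enn2real x powr a))"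

definition wasserstein :: "real \<Rightarrow> 'a::real_normed_vector measure \<Rightarrow> 'a measure \<Rightarrow> ennreal" where
  "wasserstein p \<mu> \<nu> =
     (INF \<xi>\<in>couplings \<mu> \<nu>. ennpowr (\<integral>\<^sup>+ (x, y). ennreal (norm (x - y) powr p) \<partial>\<xi>) (1 / p))"

subsection \<open>Samples and empirical measure\<close>

text \<open>The law of \<open>x i\<close> for an index \<open>i\<close> drawn uniformly from \<open>{..<n}\<close>.\<close>

definition empirical_measure :: "nat \<Rightarrow> (nat \<Rightarrow> 'a::topological_space) \<Rightarrow> 'a measure" where
  "empirical_measure n x = distr (uniform_count_measure {..<n}) borel x"

lemma emeasure_empirical_measure:
  assumes "A \<in> sets borel"
  shows "emeasure (empirical_measure n x) A = ennreal (card {i. i < n \<and> x i \<in> A} / n)"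
proof -
  have "x -` A \<inter> {..<n} = {i. i < n \<and> x i \<in> A}"
    by auto
  then show ?thesis
    using assms
    by (subst empirical_measure_def, subst emeasure_distr)
      (auto simp: measurable_def sets_uniform_count_measure space_uniform_count_measure
        intro!: emeasure_uniform_count_measure[THEN trans])
qed

text \<open>
  The usual regularity convention for a probability measure on a Banach space that need not be
  separable: it is carried by a separable closed subset (equivalently, it is Radon). On a separable
  space it holds for every measure.
\<close>

definition separably_supported :: "'a::topological_space measure \<Rightarrow> bool" where
  "separably_supported \<mu> \<longleftrightarrow> (\<exists>D. countable D \<and> (AE x in \<mu>. x \<in> closure D))"

lemma separably_supported_second_countable:
  fixes \<mu> :: "'a::second_countable_topology measure"
  shows "separably_supported \<mu>"
proof -
  obtain D :: "'a set" where D: "countable D" "\<And>U. open U \<Longrightarrow> U \<noteq> {} \<Longrightarrow> \<exists>d\<in>D. d \<in> U"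
    by (rule countable_dense_setE) blast
  have "x \<in> closure D" for x
    using D(2)[of "- closure D"] closure_subset[of D] by auto
  with D(1) show ?thesis
    by (auto simp: separably_supported_def)
qed

end

theory Submission
  imports Defs
begin

text \<open>For \<open>C \<le> 0\<close> the bound is at least \<open>1\<close>. For \<open>C > 0\<close>, the map
  \<open>x \<mapsto> W\<^sub>p(\<mu>\<^sub>x, \<mu>)\<close>, with \<open>\<mu>\<^sub>x\<close> the empirical measure of \<open>x\<close>, is Lipschitz for the \<open>\<ell>\<^sub>2\<close> product
  norm with constant \<open>n powr (- 1 / max 2 p)\<close>: a coupling for \<open>y\<close> is turned into one for \<open>x\<close> by moving the
  atoms. Concentration follows from the log Sobolev inequality by tensorization of entropy and Herbst's
  argument. A Banach space may have few smooth functions, so a Lipschitz function is first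
  approximated by soft minima of soft maxima of functionals that norm the differences of points of
  a dense sequence; these depend on finitely many functionals and are smooth. The same
  argument applied to the norm gives \<open>\<mu>\<close> exponential moments, hence the distance is finite.\<close>

subsection \<open>Norming functionals\<close>

text \<open>The constant has to survive every step. A log Sobolev inequality may be tested on smooth
  functions only, and without Lebesgue measure convolution is no way to smooth a Lipschitz function.
  The gradient of a soft extremum is a convex combination of gradients, so a bound \<open>L\<close>
  on the \<open>l2\<close> norm of the partial gradients is kept exactly, and the limit is taken
  only in the resulting Laplace bound. Tensorization uses the inequality in one coordinate at a
  time, with test function \<open>exp (l * g / 2)\<close>. This gives the Gaussian exponent
  \<open>C * L\<^sup>2 * l\<^sup>2 / 2\<close>, and optimizing over \<open>l\<close> gives
  \<open>t\<^sup>2 / (2 * C * L\<^sup>2)\<close>. The power of \<open>n\<close> in the claim is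
  \<open>1 / L\<^sup>2\<close> for \<open>L = n powr (- 1 / max 2 p)\<close>. A second obstacle is
  measurability, which is not automatic for the distance as a function on the product. Concentration
  is therefore proved for a measurable Lipschitz function that agrees with the distance almost
  everywhere.\<close>

definition sublinear :: "('a::real_vector \<Rightarrow> real) \<Rightarrow> bool" where
  "sublinear q \<longleftrightarrow> q 0 = 0 \<and> (\<forall>x y. q (x + y) \<le> q x + q y) \<and> (\<forall>c x. c > 0 \<longrightarrow> q (c *\<^sub>R x) \<le> c * q x)"

text \<open>Homogeneity is demanded as an inequality for positive \<open>c\<close>, a form easily
  checked for infima; the inequality for \<open>1 / c\<close> at \<open>c *\<^sub>R x\<close>
  supplies the converse.\<close>

lemma sublinear_scaleR:
  assumes "sublinear q" "c \<ge> 0"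
  shows "q (c *\<^sub>R x) = c * q x"
proof (cases "c = 0")
  case True
  then show ?thesis using assms by (simp add: sublinear_def)
next
  case False
  with assms have c: "c > 0" by simp
  have "q ((1 / c) *\<^sub>R c *\<^sub>R x) \<le> (1 / c) * q (c *\<^sub>R x)"
    using assms(1) c unfolding sublinear_def by (metis zero_less_divide_1_iff)
  then have "c * q x \<le> q (c *\<^sub>R x)"
    using c by (simp add: field_simps)
  moreover have "q (c *\<^sub>R x) \<le> c * q x"
    using assms(1) c unfolding sublinear_def by blast
  ultimately show ?thesis by simp
qed

lemma sublinear_minus_ge:
  assumes "sublinear q"
  shows "- q (- x) \<le> q x"
proof -
  have "q (x + - x) \<le> q x + q (- x)"
    using assms unfolding sublinear_def by blast
  then show ?thesis using assms by (simp add: sublinear_def)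
qed

text \<open>The modification behind the Hahn-Banach theorem: \<open>t = 0\<close> puts it below
  \<open>q\<close>, and \<open>t = 1\<close> makes it at most \<open>- q a\<close> at
  \<open>- a\<close>. A minimal \<open>q\<close> must equal it, hence be additive along
  \<open>a\<close>.\<close>

definition sublinear_red :: "('a::real_vector \<Rightarrow> real) \<Rightarrow> 'a \<Rightarrow> 'a \<Rightarrow> real" where
  "sublinear_red q a x = (INF t\<in>{0..}. q (x + t *\<^sub>R a) - t * q a)"

lemma sublinear_red:
  assumes q: "sublinear q"
  shows sublinear_red_le: "\<And>t. t \<ge> 0 \<Longrightarrow> sublinear_red q a x \<le> q (x + t *\<^sub>R a) - t * q a"
    and sublinear_sublinear_red: "sublinear (sublinear_red q a)"
proof -
  have sub: "q (x + y) \<le> q x + q y" for x y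
    using q by (simp add: sublinear_def)
  \<comment> \<open>Here \<open>t * q a = q (t *\<^sub>R a)\<close> is at most
    \<open>q (x + t *\<^sub>R a) + q (- x)\<close>, so the infimum is finite.\<close>
  have "- q (- x) \<le> q (x + t *\<^sub>R a) - t * q a" if "t \<ge> 0" for t x
    using sub[of "x + t *\<^sub>R a" "- x"] sublinear_scaleR[OF q that, of a] by simp
  then have bdd: "bdd_below ((\<lambda>t. q (x + t *\<^sub>R a) - t * q a) ` {0..})" for x
    by (intro bdd_belowI[of _ "- q (- x)"]) auto
  show le: "sublinear_red q a x \<le> q (x + t *\<^sub>R a) - t * q a" if "t \<ge> 0" for x t
    unfolding sublinear_red_def using bdd that by (intro cINF_lower) auto
  have ge: "m \<le> sublinear_red q a x" if "\<And>t. t \<ge> 0 \<Longrightarrow> m \<le> q (x + t *\<^sub>R a) - t * q a" for m x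
    unfolding sublinear_red_def using that by (intro cINF_greatest) auto
  show "sublinear (sublinear_red q a)"
    unfolding sublinear_def
  proof (intro conjI allI impI)
    show "sublinear_red q a 0 = 0"
      using le[of 0 0] sublinear_scaleR[OF q] q
      by (intro antisym ge) (auto simp: sublinear_def)
    fix x y
    show "sublinear_red q a (x + y) \<le> sublinear_red q a x + sublinear_red q a y"
    proof -
      \<comment> \<open>Parameters \<open>t\<close> and \<open>s\<close> for the two summands are
        matched by \<open>t + s\<close> for the sum.\<close>
      have *: "sublinear_red q a (x + y) \<le> (q (x + t *\<^sub>R a) - t * q a) + (q (y + s *\<^sub>R a) - s * q a)"
        if "t \<ge> 0" "s \<ge> 0" for s t
        using le[of "t + s" "x + y"] sub[of "x + t *\<^sub>R a" "y + s *\<^sub>R a"] that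
        by (simp add: algebra_simps)
      have "sublinear_red q a (x + y) - (q (x + t *\<^sub>R a) - t * q a) \<le> sublinear_red q a y"
        if "t \<ge> 0" for t
        using *[OF that] by (intro ge) (simp add: algebra_simps)
      then have "sublinear_red q a (x + y) - sublinear_red q a y \<le> sublinear_red q a x"
        by (intro ge) (simp add: algebra_simps)
      then show ?thesis by simp
    qed
  next
    fix c :: real and x
    assume c: "c > 0"
    have "sublinear_red q a (c *\<^sub>R x) / c \<le> sublinear_red q a x"
    proof (rule ge)
      fix t :: real assume t: "t \<ge> 0"
      have "sublinear_red q a (c *\<^sub>R x) \<le> q (c *\<^sub>R x + (c * t) *\<^sub>R a) - (c * t) * q a"
        using c t by (intro le) auto
      also have "c *\<^sub>R x + (c * t) *\<^sub>R a = c *\<^sub>R (x + t *\<^sub>R a)"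
        by (simp add: algebra_simps)
      also have "q \<dots> = c * q (x + t *\<^sub>R a)"
        using c by (intro sublinear_scaleR[OF q]) auto
      finally show "sublinear_red q a (c *\<^sub>R x) / c \<le> q (x + t *\<^sub>R a) - t * q a"
        using c by (simp add: field_simps)
    qed
    then show "sublinear_red q a (c *\<^sub>R x) \<le> c * sublinear_red q a x"
      using c by (simp add: field_simps)
  qed
qed

text \<open>Zorn's lemma for the reversed order. A chain has its pointwise infimum as lower bound,
  finite because every member lies above \<open>- p (- x)\<close>.\<close>

lemma minimal_sublinear:
  assumes p: "sublinear p"
  obtains q where "sublinear q" "q \<le> p" "\<And>r. sublinear r \<Longrightarrow> r \<le> q \<Longrightarrow> r = q"
proof -
  define A where "A = {q. sublinear q \<and> q \<le> p}"
  have "\<exists>m\<in>A. \<forall>a\<in>A. a \<le> m \<longrightarrow> a = m"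
  proof (rule predicate_Zorn)
    show "partial_order_on A (relation_of (\<lambda>a b. b \<le> a) A)"
      by (rule partial_order_on_relation_ofI) auto
    fix C assume C: "C \<in> Chains (relation_of (\<lambda>a b. b \<le> a) A)"
    then have CA: "C \<subseteq> A" and tot: "\<And>a b. a \<in> C \<Longrightarrow> b \<in> C \<Longrightarrow> a \<le> b \<or> b \<le> a"
      by (auto simp: Chains_def relation_of_def)
    show "\<exists>u\<in>A. \<forall>a\<in>C. u \<le> a"
    proof (cases "C = {}")
      case True
      then show ?thesis using p by (auto simp: A_def)
    next
      case ne: False
      have slC: "sublinear q" "q \<le> p" if "q \<in> C" for q
        using that CA by (auto simp: A_def)
      have "- p (- x) \<le> q x" if "q \<in> C" for q x
        using slC(2)[OF that] sublinear_minus_ge[OF slC(1)[OF that], of x]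
        by (auto simp: le_fun_def) (meson le_minus_iff minus_le_iff order_trans)
      then have bdd: "bdd_below ((\<lambda>q. q x) ` C)" for x
        by (intro bdd_belowI[of _ "- p (- x)"]) auto
      define u where "u x = (INF q\<in>C. q x)" for x
      have le: "u x \<le> q x" if "q \<in> C" for q x
        unfolding u_def using bdd that by (intro cINF_lower) auto
      have ge: "m \<le> u x" if "\<And>q. q \<in> C \<Longrightarrow> m \<le> q x" for m x
        unfolding u_def using that ne by (intro cINF_greatest) auto
      have "sublinear u"
        unfolding sublinear_def
      proof (intro conjI allI impI)
        show "u 0 = 0"
        proof -
          have "(\<lambda>q. q 0) ` C = {0}"
            using slC(1) ne unfolding sublinear_def by force
          then show ?thesis by (simp add: u_def)
        qed
        fix x y
        \<comment> \<open>An infimum of sublinear functionals need not be subadditive; in a chain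
          the smaller of \<open>q1\<close> and \<open>q2\<close> serves both summands.\<close>
        have *: "u (x + y) \<le> q1 x + q2 y" if "q1 \<in> C" "q2 \<in> C" for q1 q2
        proof -
          define q where "q = (if q1 \<le> q2 then q1 else q2)"
          have q: "q \<in> C" "q \<le> q1" "q \<le> q2"
            using that tot[OF that] by (auto simp: q_def)
          have "u (x + y) \<le> q (x + y)" using q by (intro le)
          also have "\<dots> \<le> q x + q y" using slC(1)[OF q(1)] by (simp add: sublinear_def)
          also have "\<dots> \<le> q1 x + q2 y" using q by (intro add_mono) (auto simp: le_fun_def)
          finally show ?thesis .
        qed
        have "u (x + y) - q1 x \<le> u y" if "q1 \<in> C" for q1
          using *[OF that] by (intro ge) (simp add: algebra_simps)
        then have "u (x + y) - u y \<le> u x"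
          by (intro ge) (simp add: algebra_simps)
        then show "u (x + y) \<le> u x + u y" by simp
      next
        fix c :: real and x assume c: "c > 0"
        have "u (c *\<^sub>R x) / c \<le> u x"
          using le[of _ "c *\<^sub>R x"] sublinear_scaleR[OF slC(1), of _ c x] c
          by (intro ge) (simp add: field_simps)
        then show "u (c *\<^sub>R x) \<le> c * u x"
          using c by (simp add: field_simps)
      qed
      moreover have "u \<le> p"
        using ne le slC(2) by (fastforce simp: le_fun_def intro: order_trans)
      ultimately show ?thesis
        using le by (intro bexI[of _ u]) (auto simp: A_def le_fun_def)
    qed
  qed
  then obtain q where "q \<in> A" "\<forall>a\<in>A. a \<le> q \<longrightarrow> a = q" by blast
  then show ?thesis
    by (intro that[of q]) (auto simp: A_def intro: order_trans)
qed

text \<open>By minimality the reduction in any direction \<open>a\<close> changes nothing, and its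
  instance \<open>t = 1\<close> reads \<open>q x \<le> q (x + a) - q a\<close>, the missing half of
  additivity.\<close>

lemma linear_minimal_sublinear:
  assumes q: "sublinear q" and min: "\<And>r. sublinear r \<Longrightarrow> r \<le> q \<Longrightarrow> r = q"
  shows "linear q"
proof -
  have red: "sublinear_red q a = q" for a
    using sublinear_red_le[OF q, of 0] by (intro min sublinear_sublinear_red q) (auto simp: le_fun_def)
  have add: "q (x + a) = q x + q a" for x a
    using sublinear_red_le[OF q, of 1 a x] red[of a] q by (simp add: sublinear_def order_antisym)
  have neg: "q (- x) = - q x" for x
    using add[of x "- x"] q by (simp add: sublinear_def)
  show ?thesis
  proof (rule linearI)
    fix c :: real and x
    show "q (c *\<^sub>R x) = c *\<^sub>R q x"
      using sublinear_scaleR[OF q, of c x] sublinear_scaleR[OF q, of "- c" x] neg[of "c *\<^sub>R x"]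
      by (cases "c \<ge> 0") auto
  qed (rule add)
qed

text \<open>The minimal functional is sought below the norm reduced in the direction
  \<open>v\<close>, not below the norm itself. This forces \<open>q (- v) \<le> - norm v\<close>,
  and linearity turns it into \<open>norm v \<le> q v\<close>.\<close>

theorem norming_functional:
  fixes v :: "'a::real_normed_vector"
  obtains \<phi> :: "'a \<Rightarrow> real" where "bounded_linear \<phi>" "\<And>x. \<bar>\<phi> x\<bar> \<le> norm x" "\<phi> v = norm v"
proof -
  have norm: "sublinear (norm :: 'a \<Rightarrow> real)"
    by (simp add: sublinear_def norm_triangle_ineq)
  obtain q where q: "sublinear q" "q \<le> sublinear_red norm v"
    and min: "\<And>r. sublinear r \<Longrightarrow> r \<le> q \<Longrightarrow> r = q"
    by (rule minimal_sublinear[OF sublinear_sublinear_red[OF norm, of v]]) (rule that)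
  interpret linear q
    by (rule linear_minimal_sublinear[OF q(1) min])
  have le: "q x \<le> norm x" for x
    using q(2) sublinear_red_le[OF norm, of 0 v x] by (auto simp: le_fun_def intro: order_trans)
  have abs: "\<bar>q x\<bar> \<le> norm x" for x
    using le[of x] le[of "- x"] by (simp add: neg)
  have "q (- v) \<le> - norm v"
    using q(2) sublinear_red_le[OF norm, of 1 v "- v"] by (auto simp: le_fun_def intro: order_trans)
  then have "q v = norm v"
    using le[of v] by (simp add: neg)
  moreover have "bounded_linear q"
    by (rule bounded_linear_intro[of _ 1]) (use abs in \<open>auto simp: add scale\<close>)
  ultimately show ?thesis using abs that by blast
qed

subsection \<open>Elementary functions are smooth\<close>

text \<open>A class closed under differentiation, so that first derivatives of its members suffice
  for smoothness. Soft maxima call for \<open>exp\<close> and \<open>ln\<close>, and differentiating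
  \<open>ln\<close> calls for \<open>inverse\<close>.\<close>

inductive elementary :: "('a::real_normed_vector \<Rightarrow> real) \<Rightarrow> bool" where
  linear: "bounded_linear f \<Longrightarrow> elementary f"
| const: "elementary (\<lambda>_. c)"
| add: "elementary f \<Longrightarrow> elementary g \<Longrightarrow> elementary (\<lambda>x. f x + g x)"
| mult: "elementary f \<Longrightarrow> elementary g \<Longrightarrow> elementary (\<lambda>x. f x * g x)"
| exp: "elementary f \<Longrightarrow> elementary (\<lambda>x. exp (f x))"
| ln: "elementary f \<Longrightarrow> (\<And>x. f x > 0) \<Longrightarrow> elementary (\<lambda>x. ln (f x))"
| inverse: "elementary f \<Longrightarrow> (\<And>x. f x > 0) \<Longrightarrow> elementary (\<lambda>x. inverse (f x))"

lemma elementary_sum: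
  "finite I \<Longrightarrow> (\<And>i. i \<in> I \<Longrightarrow> elementary (f i)) \<Longrightarrow> elementary (\<lambda>x. \<Sum>i\<in>I. f i x)"
  by (induction rule: finite_induct) (auto intro: elementary.intros)

text \<open>The dependence on the point sits in scalar coefficients of the same class, multiplied by
  fixed functionals. Repeated differentiation thus stays among real-valued functions at every
  order.\<close>

definition has_partials ::
    "('a::real_normed_vector \<Rightarrow> real) \<Rightarrow> (('a \<Rightarrow> real) \<times> ('a \<Rightarrow> real)) list \<Rightarrow> bool" where
  "has_partials f ps \<longleftrightarrow> (\<forall>(b, l)\<in>set ps. elementary b \<and> bounded_linear l) \<and>
     (\<forall>x. (f has_derivative (\<lambda>h. \<Sum>(b, l)\<leftarrow>ps. b x * l h)) (at x))"

lemma has_partials_scale: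
  assumes "has_partials f ps" "elementary c"
    and "\<And>x. (g has_derivative (\<lambda>h. c x * (\<Sum>(b, l)\<leftarrow>ps. b x * l h))) (at x)"
  shows "has_partials g (map (\<lambda>(b, l). (\<lambda>x. c x * b x, l)) ps)"
proof -
  have "(\<Sum>(b, l)\<leftarrow>map (\<lambda>(b, l). (\<lambda>x. c x * b x, l)) ps. b x * l h) = c x * (\<Sum>(b, l)\<leftarrow>ps. b x * l h)" for x h
    by (induction ps) (auto simp: algebra_simps)
  then show ?thesis
    using assms by (auto simp: has_partials_def intro: elementary.mult)
qed

lemma elementary_has_partials: "elementary f \<Longrightarrow> \<exists>ps. has_partials f ps"
proof (induction rule: elementary.induct)
  case (linear f)
  then show ?case
    by (intro exI[of _ "[(\<lambda>_. 1, f)]"])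
      (auto simp: has_partials_def intro: elementary.const bounded_linear_imp_has_derivative)
next
  case (const c)
  show ?case
    by (intro exI[of _ "[]"]) (auto simp: has_partials_def)
next
  case (add f g)
  then obtain ps qs where "has_partials f ps" "has_partials g qs" by blast
  then have "has_partials (\<lambda>x. f x + g x) (ps @ qs)"
    by (auto simp: has_partials_def intro!: has_derivative_add)
  then show ?case ..
next
  case (mult f g)
  then obtain ps qs where p: "has_partials f ps" "has_partials g qs" by blast
  define s where "s f ps = map (\<lambda>(b, l). (\<lambda>x. f x * b x, l)) ps"
    for f :: "'a \<Rightarrow> real" and ps :: "(('a \<Rightarrow> real) \<times> ('a \<Rightarrow> real)) list"
  have s: "(\<Sum>(b, l)\<leftarrow>s f ps. b x * l h) = f x * (\<Sum>(b, l)\<leftarrow>ps. b x * l h)" for f ps x h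
    unfolding s_def by (induction ps) (auto simp: algebra_simps)
  have "((\<lambda>x. f x * g x) has_derivative
      (\<lambda>h. f x * (\<Sum>(b, l)\<leftarrow>qs. b x * l h) + (\<Sum>(b, l)\<leftarrow>ps. b x * l h) * g x)) (at x)" for x
    using p unfolding has_partials_def by (intro has_derivative_mult) auto
  then have "has_partials (\<lambda>x. f x * g x) (s f qs @ s g ps)"
    unfolding has_partials_def
    using p mult(1,2) by (auto simp: s mult.commute) (auto simp: s_def has_partials_def intro: elementary.mult)
  then show ?case ..
next
  case (exp f)
  then obtain ps where p: "has_partials f ps" by blast
  have "((\<lambda>x. exp (f x)) has_derivative (\<lambda>h. exp (f x) * (\<Sum>(b, l)\<leftarrow>ps. b x * l h))) (at x)" for x
    by (rule has_derivative_eq_rhs[OF has_derivative_exp])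
      (use p in \<open>auto simp: has_partials_def mult.commute\<close>)
  from has_partials_scale[OF p elementary.exp[OF exp(1)] this] show ?case by (rule exI)
next
  case (ln f)
  then obtain ps where p: "has_partials f ps" by blast
  have *: "((\<lambda>x. ln (f x)) has_derivative (\<lambda>h. (\<Sum>(b, l)\<leftarrow>ps. b x * l h) * inverse (f x))) (at x)" for x
    using p ln(2)[of x] by (intro has_derivative_ln) (simp_all add: has_partials_def)
  have "((\<lambda>x. ln (f x)) has_derivative (\<lambda>h. inverse (f x) * (\<Sum>(b, l)\<leftarrow>ps. b x * l h))) (at x)" for x
    by (rule has_derivative_eq_rhs[OF *]) (rule ext, rule mult.commute)
  from has_partials_scale[OF p elementary.inverse[OF ln(1,2)] this] show ?case by (rule exI)
next
  case (inverse f)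
  then obtain ps where p: "has_partials f ps" by blast
  have *: "((\<lambda>x. inverse (f x)) has_derivative
      (\<lambda>h. - (inverse (f x) * (\<Sum>(b, l)\<leftarrow>ps. b x * l h) * inverse (f x)))) (at x)" for x
    using p inverse(2)[of x] by (intro Deriv.has_derivative_inverse) (simp_all add: has_partials_def)
  have D: "((\<lambda>x. inverse (f x)) has_derivative
      (\<lambda>h. ((- 1) * (inverse (f x) * inverse (f x))) * (\<Sum>(b, l)\<leftarrow>ps. b x * l h))) (at x)" for x
    by (rule has_derivative_eq_rhs[OF *]) (rule ext, simp)
  have "elementary (\<lambda>x. (- 1) * (inverse (f x) * inverse (f x)))"
    by (intro elementary.mult elementary.const elementary.inverse inverse(1,2))
  from has_partials_scale[OF p this D] show ?case by (rule exI)
qed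

definition partials :: "('a::real_normed_vector \<Rightarrow> real) \<Rightarrow> (('a \<Rightarrow> real) \<times> ('a \<Rightarrow> real)) list" where
  "partials f = (SOME ps. has_partials f ps)"

lemma partials:
  assumes "elementary f"
  shows "has_partials f (partials f)"
  unfolding partials_def using elementary_has_partials[OF assms] by (rule someI_ex)

lemma partialsD:
  assumes "elementary f" "p \<in> set (partials f)"
  shows "elementary (fst p)" "bounded_linear (snd p)"
  using partials[OF assms(1)] assms(2) by (cases p; force simp: has_partials_def)+

text \<open>The direction of the last differentiation is the last element of the list, so that
  differentiating once more amounts to appending a direction and no symmetry of the higher
  derivatives is needed.\<close>

primrec iter_deriv :: "'a::real_normed_vector list \<Rightarrow> ('a \<Rightarrow> real) \<Rightarrow> 'a \<Rightarrow> real" where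
  "iter_deriv [] f x = f x"
| "iter_deriv (v # vs) f x = (\<Sum>p\<leftarrow>partials f. snd p v * iter_deriv vs (fst p) x)"

lemma iter_deriv_add:
  "elementary f \<Longrightarrow> iter_deriv (us @ (v + w) # ws) f x = iter_deriv (us @ v # ws) f x + iter_deriv (us @ w # ws) f x"
proof (induction us arbitrary: f)
  case Nil
  then have "snd p (v + w) = snd p v + snd p w" if "p \<in> set (partials f)" for p
    using partialsD[OF Nil that] by (simp add: linear_simps)
  then show ?case
    by (simp add: distrib_right sum_list_addf cong: map_cong)
next
  case (Cons u us)
  then show ?case
    by (simp add: partialsD(1) distrib_left sum_list_addf cong: map_cong)
qed

lemma iter_deriv_scaleR:
  "elementary f \<Longrightarrow> iter_deriv (us @ (c *\<^sub>R v) # ws) f x = c * iter_deriv (us @ v # ws) f x"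
proof (induction us arbitrary: f)
  case Nil
  then have "snd p (c *\<^sub>R v) = c * snd p v" if "p \<in> set (partials f)" for p
    using partialsD[OF Nil that] by (simp add: linear_simps)
  then show ?case
    by (simp add: mult.assoc sum_list_const_mult cong: map_cong)
next
  case (Cons u us)
  then show ?case
    by (simp add: partialsD(1) mult.left_commute[of _ c] sum_list_const_mult cong: map_cong)
qed

lemma prod_list_norm_nonneg: "0 \<le> prod_list (map norm vs)"
  by (induction vs) auto

lemma sum_list_abs_le:
  fixes g :: "'b \<Rightarrow> real"
  assumes "\<And>p. p \<in> set ps \<Longrightarrow> \<bar>g p\<bar> \<le> c p * m"
  shows "\<bar>\<Sum>p\<leftarrow>ps. g p\<bar> \<le> (\<Sum>p\<leftarrow>ps. c p) * m"
  using assms by (induction ps) (auto simp: algebra_simps intro: order_trans[OF abs_triangle_ineq] add_mono)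

lemma iter_deriv_bound:
  "elementary f \<Longrightarrow> \<exists>K. \<forall>vs. length vs = k \<longrightarrow> \<bar>iter_deriv vs f x\<bar> \<le> K * prod_list (map norm vs)"
proof (induction k arbitrary: f)
  case 0
  then show ?case by auto
next
  case (Suc k)
  have "\<forall>p\<in>set (partials f). \<exists>K. \<forall>vs. length vs = k \<longrightarrow> \<bar>iter_deriv vs (fst p) x\<bar> \<le> K * prod_list (map norm vs)"
    using Suc partialsD by blast
  then obtain K where K: "\<And>p vs. p \<in> set (partials f) \<Longrightarrow> length vs = k \<Longrightarrow>
      \<bar>iter_deriv vs (fst p) x\<bar> \<le> K p * prod_list (map norm vs)"
    by (metis bchoice)
  have "\<bar>iter_deriv vs f x\<bar> \<le> (\<Sum>p\<leftarrow>partials f. onorm (snd p) * K p) * prod_list (map norm vs)"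
    if "length vs = Suc k" for vs
  proof -
    from that obtain w ws where vs: "vs = w # ws" "length ws = k"
      by (cases vs) auto
    have "\<bar>snd p w * iter_deriv ws (fst p) x\<bar> \<le> (onorm (snd p) * K p) * (norm w * prod_list (map norm ws))"
      if p: "p \<in> set (partials f)" for p
    proof -
      have "\<bar>snd p w\<bar> \<le> onorm (snd p) * norm w"
        using onorm[OF partialsD(2)[OF Suc(2) p], of w] by simp
      then have "\<bar>snd p w\<bar> * \<bar>iter_deriv ws (fst p) x\<bar> \<le> (onorm (snd p) * norm w) * (K p * prod_list (map norm ws))"
        by (intro mult_mono K[OF p vs(2)]) (auto simp: onorm_pos_le[OF partialsD(2)[OF Suc(2) p]])
      then show ?thesis by (simp add: abs_mult algebra_simps)
    qed
    then show ?thesis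
      by (simp add: vs sum_list_abs_le)
  qed
  then show ?case by blast
qed

text \<open>The quantifier over \<open>vs\<close> stands inside the eventuality: the
  differentiability is with respect to the operator norm on forms.\<close>

lemma iter_deriv_has_derivative:
  "elementary f \<Longrightarrow> e > 0 \<Longrightarrow> \<forall>\<^sub>F h in nhds 0. \<forall>vs. length vs = k \<longrightarrow>
     \<bar>iter_deriv vs f (x + h) - iter_deriv vs f x - iter_deriv (vs @ [h]) f x\<bar>
       \<le> e * norm h * prod_list (map norm vs)"
proof (induction k arbitrary: f e)
  case 0
  have "(f has_derivative (\<lambda>h. \<Sum>(b, l)\<leftarrow>partials f. b x * l h)) (at x)"
    using partials[OF 0(1)] by (simp add: has_partials_def)
  then obtain d where d: "d > 0" "\<And>y. norm (y - x) < d \<Longrightarrow>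
      norm (f y - f x - (\<Sum>(b, l)\<leftarrow>partials f. b x * l (y - x))) \<le> e * norm (y - x)"
    using \<open>e > 0\<close> unfolding has_derivative_at_alt by blast
  show ?case
    unfolding eventually_nhds_metric
  proof (intro exI[of _ d] conjI allI impI d(1))
    fix h :: 'a and vs :: "'a list"
    assume "dist h 0 < d" "length vs = 0"
    then show "\<bar>iter_deriv vs f (x + h) - iter_deriv vs f x - iter_deriv (vs @ [h]) f x\<bar>
       \<le> e * norm h * prod_list (map norm vs)"
      using d(2)[of "x + h"] by (simp add: case_prod_unfold mult.commute)
  qed
next
  case (Suc k)
  \<comment> \<open>The remainder at order \<open>Suc k\<close> is a sum of remainders at order
    \<open>k\<close> weighted by operator norms; the summand 1 keeps the denominator
    positive.\<close>
  define e' where "e' = e / (1 + (\<Sum>p\<leftarrow>partials f. onorm (snd p)))"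
  have nn: "0 \<le> onorm (snd p)" if "p \<in> set (partials f)" for p
    by (rule onorm_pos_le[OF partialsD(2)[OF Suc(2) that]])
  then have S: "0 \<le> (\<Sum>p\<leftarrow>partials f. onorm (snd p))"
    by (intro sum_list_nonneg) auto
  then have e': "e' > 0" using Suc(3) by (simp add: e'_def)
  have "\<forall>\<^sub>F h in nhds 0. \<forall>p\<in>set (partials f). \<forall>vs. length vs = k \<longrightarrow>
     \<bar>iter_deriv vs (fst p) (x + h) - iter_deriv vs (fst p) x - iter_deriv (vs @ [h]) (fst p) x\<bar>
       \<le> e' * norm h * prod_list (map norm vs)"
    using Suc.IH[OF partialsD(1)[OF Suc(2)] e'] by (intro eventually_ball_finite) auto
  then show ?case
  proof eventually_elim
    case (elim h)
    show ?case
    proof (intro allI impI)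
      fix vs :: "'a list" assume "length vs = Suc k"
      then obtain w ws where vs: "vs = w # ws" "length ws = k"
        by (cases vs) auto
      let ?R = "\<lambda>p. iter_deriv ws (fst p) (x + h) - iter_deriv ws (fst p) x - iter_deriv (ws @ [h]) (fst p) x"
      have "\<bar>snd p w * ?R p\<bar> \<le> onorm (snd p) * (norm w * (e' * norm h * prod_list (map norm ws)))"
        if p: "p \<in> set (partials f)" for p
      proof -
        have "\<bar>snd p w\<bar> \<le> onorm (snd p) * norm w"
          using onorm[OF partialsD(2)[OF Suc(2) p], of w] by simp
        then have "\<bar>snd p w\<bar> * \<bar>?R p\<bar> \<le> (onorm (snd p) * norm w) * (e' * norm h * prod_list (map norm ws))"
          using elim p vs(2) by (intro mult_mono) (auto simp: nn)
        then show ?thesis by (simp only: abs_mult mult.assoc)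
      qed
      then have "\<bar>\<Sum>p\<leftarrow>partials f. snd p w * ?R p\<bar>
          \<le> (\<Sum>p\<leftarrow>partials f. onorm (snd p)) * (norm w * (e' * norm h * prod_list (map norm ws)))"
        by (rule sum_list_abs_le)
      also have "\<dots> \<le> (1 + (\<Sum>p\<leftarrow>partials f. onorm (snd p))) * (norm w * (e' * norm h * prod_list (map norm ws)))"
        using e' by (intro mult_right_mono) (auto intro!: mult_nonneg_nonneg simp: prod_list_norm_nonneg)
      also have "\<dots> = e * norm h * prod_list (map norm vs)"
        using S by (simp add: e'_def vs field_simps)
      finally show "\<bar>iter_deriv vs f (x + h) - iter_deriv vs f x - iter_deriv (vs @ [h]) f x\<bar>
          \<le> e * norm h * prod_list (map norm vs)"
        by (simp add: vs algebra_simps flip: sum_list_subtractf)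
    qed
  qed
qed

theorem elementary_smooth:
  assumes f: "elementary f"
  shows "smooth f"
  unfolding smooth_def
\<comment> \<open>In \<open>smooth\<close> the newest direction is the head of the list, in
  \<open>iter_deriv\<close> it is the last element; reversal reconciles the two.\<close>
proof (intro exI[of _ "\<lambda>k x vs. iter_deriv (rev vs) f x"] conjI allI impI)
  fix k and x :: 'a
  have pl: "prod_list (map norm (rev vs)) = prod_list (map norm vs)" for vs :: "'a list"
    by (simp flip: rev_map)
  obtain K where K: "\<And>vs. length vs = k \<Longrightarrow> \<bar>iter_deriv vs f x\<bar> \<le> K * prod_list (map norm vs)"
    using iter_deriv_bound[OF f] by blast
  have "\<bar>iter_deriv (rev vs) f x\<bar> \<le> K * prod_list (map norm vs)" if "length vs = k" for vs
    using K[of "rev vs"] that by (simp only: pl length_rev)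
  then show "bounded_multilinear_form k (\<lambda>vs. iter_deriv (rev vs) f x)"
    unfolding bounded_multilinear_form_def
    by (intro conjI allI impI exI[of _ K]) (simp_all add: iter_deriv_add[OF f] iter_deriv_scaleR[OF f])
  fix e :: real assume e: "e > 0"
  from iter_deriv_has_derivative[OF f e, where k = k and x = x] obtain d where d: "d > 0"
    "\<And>h vs. norm h < d \<Longrightarrow> length vs = k \<Longrightarrow>
       \<bar>iter_deriv vs f (x + h) - iter_deriv vs f x - iter_deriv (vs @ [h]) f x\<bar>
         \<le> e * norm h * prod_list (map norm vs)"
    unfolding eventually_nhds_metric dist_norm diff_zero by blast
  show "\<exists>d>0. \<forall>h vs. norm h < d \<longrightarrow> length vs = k \<longrightarrow>
        \<bar>iter_deriv (rev vs) f (x + h) - iter_deriv (rev vs) f x - iter_deriv (rev (h # vs)) f x\<bar>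
             \<le> e * norm h * prod_list (map norm vs)"
  proof (intro exI[of _ d] conjI allI impI)
    fix h :: 'a and vs :: "'a list" assume "norm h < d" "length vs = k"
    then show "\<bar>iter_deriv (rev vs) f (x + h) - iter_deriv (rev vs) f x - iter_deriv (rev (h # vs)) f x\<bar>
             \<le> e * norm h * prod_list (map norm vs)"
      using d(2)[of h "rev vs"] by (simp only: pl length_rev rev.simps)
  qed (rule d(1))
qed simp

section \<open>The gradient norm of a smooth function and its continuity\<close>

lemma grad_norm_quotient_tendsto:
  fixes f :: "'a::real_normed_vector \<Rightarrow> real"
  assumes "(f has_derivative f') (at x)"
  shows "((\<lambda>t. \<bar>f (x + t *\<^sub>R y) - f x\<bar> / (t * norm y)) \<longlongrightarrow> \<bar>f' y\<bar> / norm y) (at_right 0)"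
proof -
  have "((\<lambda>t. f (x + t *\<^sub>R y)) has_derivative (\<lambda>t. f' (t *\<^sub>R y))) (at 0)"
    by (rule has_derivative_compose[where f = "\<lambda>t. x + t *\<^sub>R y" and g = f])
      (use assms in \<open>auto intro!: derivative_eq_intros\<close>)
  moreover have "f' (t *\<^sub>R y) = f' y * t" for t
    using has_derivative_linear[OF assms] by (simp add: linear_cmul)
  ultimately have "((\<lambda>t. f (x + t *\<^sub>R y)) has_real_derivative f' y) (at 0)"
    by (simp add: has_field_derivative_def)
  then have "((\<lambda>t. (f (x + t *\<^sub>R y) - f x) / t) \<longlongrightarrow> f' y) (at_right 0)"
    by (auto simp: DERIV_def intro: filterlim_mono at_le)
  then have "((\<lambda>t. \<bar>(f (x + t *\<^sub>R y) - f x) / t\<bar> * inverse (norm y)) \<longlongrightarrow> \<bar>f' y\<bar> * inverse (norm y)) (at_right 0)"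
    by (intro tendsto_intros)
  moreover have "\<forall>\<^sub>F t in at_right 0. \<bar>(f (x + t *\<^sub>R y) - f x) / t\<bar> * inverse (norm y)
      = \<bar>f (x + t *\<^sub>R y) - f x\<bar> / (t * norm y)"
    by (rule eventually_mono[OF eventually_at_right_less]) (simp add: abs_mult divide_inverse)
  ultimately show ?thesis
    by (simp add: divide_inverse Lim_transform_eventually)
qed

lemma grad_norm_eq:
  assumes "(f has_derivative f') (at x)"
  shows "grad_norm f x = (SUP y. \<bar>f' y\<bar> / norm y)"
  unfolding grad_norm_def
  using tendsto_Lim[OF _ grad_norm_quotient_tendsto[OF assms]] by simp

lemma grad_norm_le:
  assumes "(f has_derivative f') (at x)" "\<And>v. \<bar>f' v\<bar> \<le> B * norm v" "B \<ge> 0"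
  shows "grad_norm f x \<le> B"
  unfolding grad_norm_eq[OF assms(1)]
  by (rule cSUP_least) (use assms(2,3) in \<open>auto simp: divide_le_eq\<close>)

lemma bdd_above_derivative_quotient:
  assumes "bounded_linear f'"
  shows "bdd_above (range (\<lambda>y. \<bar>f' y :: real\<bar> / norm y))"
proof -
  obtain K where "\<And>y. \<bar>f' y\<bar> \<le> norm y * K" "K \<ge> 0"
    using bounded_linear.nonneg_bounded[OF assms] by auto
  then show ?thesis
    by (intro bdd_aboveI[of _ K]) (auto simp: divide_le_eq mult.commute)
qed

lemma grad_norm_nonneg:
  assumes "(f has_derivative f') (at x)"
  shows "0 \<le> grad_norm f x"
  unfolding grad_norm_eq[OF assms]
  using cSUP_upper[OF UNIV_I bdd_above_derivative_quotient[OF has_derivative_bounded_linear[OF assms]], of 0]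
  by simp

text \<open>One half of the reverse triangle inequality for the dual norm. There are two base points
  because derivatives at nearby points are compared, in both directions.\<close>

lemma grad_norm_diff_le:
  assumes f: "(f has_derivative f') (at x)" and g: "(g has_derivative g') (at y)"
    and le: "\<And>v. \<bar>f' v - g' v\<bar> \<le> B * norm v" and B: "B \<ge> 0"
  shows "grad_norm f x \<le> grad_norm g y + B"
  unfolding grad_norm_eq[OF f]
proof (rule cSUP_least)
  fix v
  have "\<bar>f' v\<bar> / norm v \<le> (\<bar>g' v\<bar> + B * norm v) / norm v"
    using le[of v] by (intro divide_right_mono) auto
  also have "\<dots> \<le> \<bar>g' v\<bar> / norm v + B"
    using B by (cases "v = 0") (auto simp: add_divide_distrib)
  also have "\<bar>g' v\<bar> / norm v \<le> grad_norm g y"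
    unfolding grad_norm_eq[OF g]
    using cSUP_upper[OF UNIV_I bdd_above_derivative_quotient[OF has_derivative_bounded_linear[OF g]]] .
  finally show "\<bar>f' v\<bar> / norm v \<le> grad_norm g y + B" by simp
qed simp

text \<open>The local estimate comes from the second derivative: its bound \<open>K\<close>, plus
  the tolerance 1 in the remainder, makes the first derivative continuous in operator norm.\<close>

lemma smooth_derivative:
  fixes f :: "'a::real_normed_vector \<Rightarrow> real"
  assumes "smooth f"
  shows "\<exists>f'. \<forall>x. (f has_derivative f' x) (at x) \<and>
    (\<exists>K\<ge>0. \<forall>\<^sub>F y in nhds x. \<forall>v. \<bar>f' y v - f' x v\<bar> \<le> K * norm (y - x) * norm v)"
proof -
  obtain D :: "nat \<Rightarrow> 'a \<Rightarrow> 'a list \<Rightarrow> real" where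
    *: "(\<forall>x. D 0 x [] = f x) \<and> (\<forall>k x. bounded_multilinear_form k (D k x)) \<and>
        (\<forall>k x. \<forall>e>0. \<exists>d>0. \<forall>h vs. norm h < d \<longrightarrow> length vs = k \<longrightarrow>
           \<bar>D k (x + h) vs - D k x vs - D (Suc k) x (h # vs)\<bar>
             \<le> e * norm h * prod_list (map norm vs))"
    using assms unfolding smooth_def by (rule exE)
  have D0: "\<And>x. D 0 x [] = f x"
    and ml: "\<And>k x. bounded_multilinear_form k (D k x)"
    and D: "\<And>k x e. e > 0 \<Longrightarrow> \<exists>d>0. \<forall>h vs. norm h < d \<longrightarrow> length vs = k \<longrightarrow>
           \<bar>D k (x + h) vs - D k x vs - D (Suc k) x (h # vs)\<bar>
             \<le> e * norm h * prod_list (map norm vs)"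
    using * by blast+
  show ?thesis
  proof (intro exI[of _ "\<lambda>x v. D 1 x [v]"] allI conjI)
    fix x
    obtain K where "\<And>vs. length vs = 1 \<Longrightarrow> \<bar>D 1 x vs\<bar> \<le> K * prod_list (map norm vs)"
      using ml[of 1 x] unfolding bounded_multilinear_form_def by blast
    from this[of "[_]"] have K: "\<bar>D 1 x [v]\<bar> \<le> K * norm v" for v by simp
    have lin: "D 1 x ([] @ (v + w) # []) = D 1 x ([] @ v # []) + D 1 x ([] @ w # []) \<and>
        D 1 x ([] @ (c *\<^sub>R v) # []) = c * D 1 x ([] @ v # [])" for v w c
      using ml[of 1 x] unfolding bounded_multilinear_form_def
      by (elim conjE allE[of _ "[]"] allE[of _ v] allE[of _ w] allE[of _ c]) simp
    have "D 1 x [v + w] = D 1 x [v] + D 1 x [w]" "D 1 x [c *\<^sub>R v] = c * D 1 x [v]" for v w c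
      using lin[of v w c] by simp_all
    then have "bounded_linear (\<lambda>v. D 1 x [v])"
      using K by (intro bounded_linear_intro[of _ K]) (auto simp: mult.commute)
    moreover have "\<exists>d>0. \<forall>y. norm (y - x) < d \<longrightarrow> norm (f y - f x - D 1 x [y - x]) \<le> e * norm (y - x)"
      if e: "e > 0" for e
    proof -
      from D[OF e, where k = 0 and x = x] obtain d where "d > 0" and
        d: "\<And>h vs. norm h < d \<Longrightarrow> length vs = 0 \<Longrightarrow>
          \<bar>D 0 (x + h) vs - D 0 x vs - D (Suc 0) x (h # vs)\<bar> \<le> e * norm h * prod_list (map norm vs)"
        by blast
      show ?thesis
        using \<open>d > 0\<close> d[of "_ - x" "[]"] by (intro exI[of _ d]) (simp add: D0)
    qed
    ultimately show "(f has_derivative (\<lambda>v. D 1 x [v])) (at x)"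
      unfolding has_derivative_at_alt by blast
  next
    fix x
    obtain K where "\<And>vs. length vs = Suc 1 \<Longrightarrow> \<bar>D (Suc 1) x vs\<bar> \<le> K * prod_list (map norm vs)"
      using ml[of "Suc 1" x] unfolding bounded_multilinear_form_def by blast
    from this[of "[_, _]"] have K: "\<bar>D (Suc 1) x [h, v]\<bar> \<le> K * (norm h * norm v)" for h v by simp
    from D[OF zero_less_one, where k = 1 and x = x] obtain d where "d > 0" and
      "\<And>h vs. norm h < d \<Longrightarrow> length vs = 1 \<Longrightarrow>
        \<bar>D 1 (x + h) vs - D 1 x vs - D (Suc 1) x (h # vs)\<bar> \<le> 1 * norm h * prod_list (map norm vs)"
      by blast
    from this(2)[of _ "[_]"]
    have d: "\<bar>D 1 (x + h) [v] - D 1 x [v] - D (Suc 1) x [h, v]\<bar> \<le> norm h * norm v" if "norm h < d" for h v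
      using that by simp
    have "\<bar>D 1 y [v] - D 1 x [v]\<bar> \<le> (\<bar>K\<bar> + 1) * norm (y - x) * norm v" if "dist y x < d" for y v
    proof -
      have "K * (norm (y - x) * norm v) \<le> \<bar>K\<bar> * (norm (y - x) * norm v)"
        by (intro mult_right_mono) auto
      then show ?thesis
        using d[of "y - x" v] K[of "y - x" v] that
        by (simp add: dist_norm algebra_simps)
    qed
    then show "\<exists>K\<ge>0. \<forall>\<^sub>F y in nhds x. \<forall>v. \<bar>D 1 y [v] - D 1 x [v]\<bar> \<le> K * norm (y - x) * norm v"
      using \<open>d > 0\<close> by (intro exI[of _ "\<bar>K\<bar> + 1"]) (auto simp: eventually_nhds_metric)
  qed
qed

text \<open>Continuity provides Borel measurability, and with it the integrability of the squared
  gradient norm that \<open>log_sobolev\<close> asks for.\<close>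

lemma continuous_grad_norm:
  assumes "smooth f"
  shows "continuous_on UNIV (grad_norm f)"
proof -
  obtain f' where *: "\<forall>x. (f has_derivative f' x) (at x) \<and>
      (\<exists>K\<ge>0. \<forall>\<^sub>F y in nhds x. \<forall>v. \<bar>f' y v - f' x v\<bar> \<le> K * norm (y - x) * norm v)"
    using smooth_derivative[OF assms] by (rule exE)
  have f': "(f has_derivative f' x) (at x)"
    and lip: "\<exists>K\<ge>0. \<forall>\<^sub>F y in nhds x. \<forall>v. \<bar>f' y v - f' x v\<bar> \<le> K * norm (y - x) * norm v" for x
    by (rule *[rule_format, THEN conjunct1]) (rule *[rule_format, THEN conjunct2])
  have "isCont (grad_norm f) x" for x
  proof -
    obtain K where K: "K \<ge> 0" and ev: "\<forall>\<^sub>F y in nhds x. \<forall>v. \<bar>f' y v - f' x v\<bar> \<le> K * norm (y - x) * norm v"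
      using lip by blast
    have "\<forall>\<^sub>F y in at x. norm (grad_norm f y - grad_norm f x) \<le> K * norm (y - x)"
      using filter_leD[OF at_within_le_nhds ev]
    proof eventually_elim
      case (elim y)
      have "grad_norm f y \<le> grad_norm f x + K * norm (y - x)"
        using elim K by (intro grad_norm_diff_le[OF f' f']) auto
      moreover have "grad_norm f x \<le> grad_norm f y + K * norm (y - x)"
        using elim K by (intro grad_norm_diff_le[OF f' f']) (auto simp: abs_minus_commute)
      ultimately show ?case by simp
    qed
    moreover have "((\<lambda>y. K * norm (y - x)) \<longlongrightarrow> 0) (at x)"
      by (intro tendsto_mult_right_zero tendsto_norm_zero LIM_zero tendsto_ident_at)
    ultimately have "((\<lambda>y. grad_norm f y - grad_norm f x) \<longlongrightarrow> 0) (at x)"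
      by (rule Lim_null_comparison)
    then show ?thesis
      by (simp add: isCont_def LIM_zero_iff)
  qed
  then show ?thesis
    by (simp add: continuous_on_eq_continuous_at)
qed

subsection \<open>Tensorization of entropy\<close>

lemma (in prob_space) integrable_bounded:
  fixes f :: "'a \<Rightarrow> real"
  assumes "f \<in> borel_measurable M" "\<And>x. x \<in> space M \<Longrightarrow> \<bar>f x\<bar> \<le> c"
  shows "integrable M f"
  using assms by (intro integrable_const_bound[of _ c]) auto

lemma (in prob_space) integral_bounds:
  fixes f :: "'a \<Rightarrow> real"
  assumes "f \<in> borel_measurable M" "\<And>x. x \<in> space M \<Longrightarrow> a \<le> f x \<and> f x \<le> b"
  shows "a \<le> (\<integral>x. f x \<partial>M)" "(\<integral>x. f x \<partial>M) \<le> b"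
proof -
  have "integrable M f"
    by (rule integrable_bounded[where c = "max \<bar>a\<bar> \<bar>b\<bar>"]) (use assms in fastforce)+
  then show "a \<le> (\<integral>x. f x \<partial>M)" "(\<integral>x. f x \<partial>M) \<le> b"
    using assms by (auto intro!: integral_ge_const integral_le_const)
qed

lemma (in prob_space) integral_abs_bound:
  fixes f :: "'a \<Rightarrow> real"
  assumes "f \<in> borel_measurable M" "\<And>x. x \<in> space M \<Longrightarrow> \<bar>f x\<bar> \<le> c"
  shows "\<bar>\<integral>x. f x \<partial>M\<bar> \<le> c"
proof -
  have "\<And>x. x \<in> space M \<Longrightarrow> - c \<le> f x \<and> f x \<le> c"
    using assms(2) by (auto simp: abs_le_iff minus_le_iff)
  with integral_bounds[OF assms(1) this] show ?thesis by (simp add: abs_le_iff minus_le_iff)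
qed

definition entropy_functional :: "'a measure \<Rightarrow> ('a \<Rightarrow> real) \<Rightarrow> real" where
  "entropy_functional M h = (\<integral>x. h x * ln (h x) \<partial>M) - (\<integral>x. h x \<partial>M) * ln (\<integral>x. h x \<partial>M)"

lemma abs_ln_le:
  fixes a b h :: real
  assumes "0 < a" "a \<le> h" "h \<le> b"
  shows "\<bar>ln h\<bar> \<le> \<bar>ln a\<bar> + \<bar>ln b\<bar>"
proof -
  have "ln a \<le> ln h" "ln h \<le> ln b"
    using assms by (auto intro: ln_mono)
  then show ?thesis by linarith
qed

lemma abs_mult_ln_le:
  fixes a b h :: real
  assumes "0 < a" "a \<le> h" "h \<le> b"
  shows "\<bar>h * ln h\<bar> \<le> b * (\<bar>ln a\<bar> + \<bar>ln b\<bar>)"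
  unfolding abs_mult using assms by (intro mult_mono abs_ln_le) auto

text \<open>Half of the variational formula for entropy: take \<open>1 + u \<le> exp u\<close> at
  \<open>u = k x - ln (h x / m)\<close>, multiply by \<open>h x\<close> and integrate. The
  normalization of \<open>k\<close> makes \<open>m * exp (k x)\<close> integrate to
  \<open>m\<close>, which cancels the integral of \<open>h\<close>.\<close>

lemma (in prob_space) entropy_functional_variational:
  assumes h: "h \<in> borel_measurable M" "\<And>x. x \<in> space M \<Longrightarrow> a \<le> h x \<and> h x \<le> b" "0 < a"
    and k: "k \<in> borel_measurable M" "\<And>x. x \<in> space M \<Longrightarrow> \<bar>k x\<bar> \<le> c" "(\<integral>x. exp (k x) \<partial>M) = 1"
  shows "(\<integral>x. h x * k x \<partial>M) \<le> entropy_functional M h"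
proof -
  define m where "m = (\<integral>x. h x \<partial>M)"
  have m: "0 < m"
    unfolding m_def using integral_bounds(1)[OF h(1,2)] h(3) by linarith
  have ih: "integrable M h"
    by (rule integrable_bounded[of _ b]) (use h in fastforce)+
  have ihl: "integrable M (\<lambda>x. h x * ln (h x))"
    by (rule integrable_bounded[of _ "b * (\<bar>ln a\<bar> + \<bar>ln b\<bar>)"])
      (use h abs_mult_ln_le[of a _ b] in auto)
  have "exp (k x) \<le> exp c" if "x \<in> space M" for x
    using k(2)[OF that] by auto
  then have ie: "integrable M (\<lambda>x. exp (k x))"
    by (intro integrable_bounded[of _ "exp c"]) (use k in auto)
  have "\<bar>h x * k x\<bar> \<le> b * c" if "x \<in> space M" for x
    unfolding abs_mult using k(2)[OF that] h(2)[OF that] h(3) by (intro mult_mono) auto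
  then have ihk: "integrable M (\<lambda>x. h x * k x)"
    by (intro integrable_bounded[of _ "b * c"]) (use h k in auto)
  have "h x * k x \<le> h x * ln (h x) - ln m * h x - h x + m * exp (k x)" if "x \<in> space M" for x
  proof -
    have hx: "h x > 0" using h(2)[OF that] h(3) by linarith
    have "1 + (k x - ln (h x / m)) \<le> exp (k x - ln (h x / m))"
      by (rule exp_ge_add_one_self)
    also have "\<dots> = m * exp (k x) / h x"
      using hx m by (simp add: exp_diff)
    finally have "h x * (1 + (k x - ln (h x / m))) \<le> m * exp (k x)"
      using hx by (simp add: field_simps)
    then show ?thesis
      using hx m by (simp add: ln_div algebra_simps)
  qed
  then have "(\<integral>x. h x * k x \<partial>M) \<le> (\<integral>x. h x * ln (h x) - ln m * h x - h x + m * exp (k x) \<partial>M)"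
    using ihk ih ihl ie by (intro integral_mono) auto
  also have "\<dots> = entropy_functional M h"
    using ih ihl ie k(3) by (simp add: entropy_functional_def m_def[symmetric] mult.commute)
  finally show ?thesis .
qed

text \<open>The optimal test function is the logarithm of the normalized density, bounded because
  \<open>h\<close> stays between positive constants.\<close>

lemma (in prob_space) entropy_functional_attained:
  assumes h: "h \<in> borel_measurable M" "\<And>x. x \<in> space M \<Longrightarrow> a \<le> h x \<and> h x \<le> b" "0 < a"
  obtains k c where "k \<in> borel_measurable M" "\<And>x. x \<in> space M \<Longrightarrow> \<bar>k x\<bar> \<le> c"
    "(\<integral>x. exp (k x) \<partial>M) = 1" "(\<integral>x. h x * k x \<partial>M) = entropy_functional M h"
proof -
  define m where "m = (\<integral>x. h x \<partial>M)"
  have m: "0 < m"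
    unfolding m_def using integral_bounds(1)[OF h(1,2)] h(3) by linarith
  have hx: "h x > 0" if "x \<in> space M" for x using h(2)[OF that] h(3) by linarith
  have ih: "integrable M h"
    by (rule integrable_bounded[of _ b]) (use h in fastforce)+
  have ihl: "integrable M (\<lambda>x. h x * ln (h x))"
    by (rule integrable_bounded[of _ "b * (\<bar>ln a\<bar> + \<bar>ln b\<bar>)"])
      (use h abs_mult_ln_le[of a _ b] in auto)
  show ?thesis
  proof (rule that[of "\<lambda>x. ln (h x) - ln m" "\<bar>ln a\<bar> + \<bar>ln b\<bar> + \<bar>ln m\<bar>"])
    show "\<bar>ln (h x) - ln m\<bar> \<le> \<bar>ln a\<bar> + \<bar>ln b\<bar> + \<bar>ln m\<bar>" if "x \<in> space M" for x
      using abs_ln_le[of a "h x" b] h(2)[OF that] h(3) by linarith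
    have "(\<integral>x. exp (ln (h x) - ln m) \<partial>M) = (\<integral>x. h x / m \<partial>M)"
      using hx m by (intro Bochner_Integration.integral_cong) (auto simp: exp_diff)
    then show "(\<integral>x. exp (ln (h x) - ln m) \<partial>M) = 1"
      using m by (simp add: m_def)
    have "(\<integral>x. h x * (ln (h x) - ln m) \<partial>M) = (\<integral>x. h x * ln (h x) - ln m * h x \<partial>M)"
      by (simp add: algebra_simps)
    then show "(\<integral>x. h x * (ln (h x) - ln m) \<partial>M) = entropy_functional M h"
      using ih ihl by (simp add: entropy_functional_def m_def[symmetric] mult.commute)
  qed (use h in auto)
qed

lemma (in pair_prob_space) integral_swap_bounded:
  fixes f :: "'a \<Rightarrow> 'b \<Rightarrow> real"
  assumes [measurable]: "case_prod f \<in> borel_measurable (M1 \<Otimes>\<^sub>M M2)"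
    and "\<And>x y. x \<in> space M1 \<Longrightarrow> y \<in> space M2 \<Longrightarrow> \<bar>f x y\<bar> \<le> c"
  shows "(\<integral>y. (\<integral>x. f x y \<partial>M1) \<partial>M2) = (\<integral>x. (\<integral>y. f x y \<partial>M2) \<partial>M1)"
proof -
  have "integrable (M1 \<Otimes>\<^sub>M M2) (case_prod f)"
    using assms by (intro P.integrable_bounded[of _ c]) (auto simp: space_pair_measure)
  then show ?thesis by (rule Fubini_integral)
qed

text \<open>Convexity of entropy, as a supremum of linear functionals: the test function optimal for
  the average is admissible for every section, and Fubini exchanges the integrals.\<close>

lemma (in pair_prob_space) entropy_functional_integral_le:
  fixes h :: "'a \<Rightarrow> 'b \<Rightarrow> real"
  assumes [measurable]: "case_prod h \<in> borel_measurable (M1 \<Otimes>\<^sub>M M2)"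
    and h: "\<And>x y. x \<in> space M1 \<Longrightarrow> y \<in> space M2 \<Longrightarrow> a \<le> h x y \<and> h x y \<le> b" "0 < a"
  shows "entropy_functional M2 (\<lambda>y. \<integral>x. h x y \<partial>M1) \<le> (\<integral>x. entropy_functional M2 (h x) \<partial>M1)"
proof -
  have sec: "h x \<in> borel_measurable M2" if "x \<in> space M1" for x
    using measurable_Pair2[OF assms(1) that] by simp
  have sec': "(\<lambda>x. h x y) \<in> borel_measurable M1" if "y \<in> space M2" for y
    using measurable_Pair1[OF assms(1) that] by simp
  have H: "(\<lambda>y. \<integral>x. h x y \<partial>M1) \<in> borel_measurable M2"
    by (rule M1.borel_measurable_lebesgue_integral) measurable
  have Hb: "a \<le> (\<integral>x. h x y \<partial>M1) \<and> (\<integral>x. h x y \<partial>M1) \<le> b" if "y \<in> space M2" for y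
    using M1.integral_bounds[OF sec'[OF that], of a b] h(1) that by auto
  obtain k c where [measurable]: "k \<in> borel_measurable M2" and k: "\<And>x. x \<in> space M2 \<Longrightarrow> \<bar>k x\<bar> \<le> c"
    "(\<integral>x. exp (k x) \<partial>M2) = 1"
    "(\<integral>y. (\<integral>x. h x y \<partial>M1) * k y \<partial>M2) = entropy_functional M2 (\<lambda>y. \<integral>x. h x y \<partial>M1)"
    using M2.entropy_functional_attained[OF H Hb h(2)] by metis
  have hk: "\<bar>h x y * k y\<bar> \<le> b * c" if "x \<in> space M1" "y \<in> space M2" for x y
    unfolding abs_mult using h(1)[OF that] h(2) k(1)[OF that(2)] by (intro mult_mono) auto
  have hl: "\<bar>h x y * ln (h x y)\<bar> \<le> b * (\<bar>ln a\<bar> + \<bar>ln b\<bar>)" if "x \<in> space M1" "y \<in> space M2" for x y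
    using h(1)[OF that] h(2) by (intro abs_mult_ln_le) auto
  have "entropy_functional M2 (\<lambda>y. \<integral>x. h x y \<partial>M1) = (\<integral>y. (\<integral>x. h x y * k y \<partial>M1) \<partial>M2)"
    by (simp add: k(3)[symmetric])
  also have "\<dots> = (\<integral>x. (\<integral>y. h x y * k y \<partial>M2) \<partial>M1)"
    by (rule integral_swap_bounded[of _ "b * c"]) (use hk in auto)
  also have "\<dots> \<le> (\<integral>x. entropy_functional M2 (h x) \<partial>M1)"
  proof (rule integral_mono)
    show "integrable M1 (\<lambda>x. \<integral>y. h x y * k y \<partial>M2)"
      by (intro M1.integrable_bounded[of _ "b * c"] M2.integral_abs_bound
          M2.borel_measurable_lebesgue_integral) (use hk sec in auto)
    have 1: "integrable M1 (\<lambda>x. \<integral>y. h x y * ln (h x y) \<partial>M2)"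
      by (intro M1.integrable_bounded[of _ "b * (\<bar>ln a\<bar> + \<bar>ln b\<bar>)"] M2.integral_abs_bound
          M2.borel_measurable_lebesgue_integral) (use hl sec in auto)
    have [measurable]: "(\<lambda>x. \<integral>y. h x y \<partial>M2) \<in> borel_measurable M1"
      by (intro M2.borel_measurable_lebesgue_integral) measurable
    have "a \<le> (\<integral>y. h x y \<partial>M2) \<and> (\<integral>y. h x y \<partial>M2) \<le> b" if "x \<in> space M1" for x
      using M2.integral_bounds[OF sec[OF that], of a b] h(1) that by auto
    then have 2: "integrable M1 (\<lambda>x. (\<integral>y. h x y \<partial>M2) * ln (\<integral>y. h x y \<partial>M2))"
      by (intro M1.integrable_bounded[of _ "b * (\<bar>ln a\<bar> + \<bar>ln b\<bar>)"] abs_mult_ln_le h(2)) auto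
    show "integrable M1 (\<lambda>x. entropy_functional M2 (h x))"
      unfolding entropy_functional_def using 1 2 by simp
    show "(\<integral>y. h x y * k y \<partial>M2) \<le> entropy_functional M2 (h x)" if "x \<in> space M1" for x
      by (rule M2.entropy_functional_variational[of _ a b _ c]) (use sec h k that in auto)
  qed
  finally show ?thesis .
qed

lemma measurable_section:
  assumes x: "x \<in> space (Pi\<^sub>M I (\<lambda>_. N))" and j: "j \<in> I"
  shows "(\<lambda>z. x(j := z)) \<in> measurable N (Pi\<^sub>M I (\<lambda>_. N))"
proof (rule measurable_PiM_single')
  fix i assume "i \<in> I"
  then show "(\<lambda>z. (x(j := z)) i) \<in> measurable N N"
    using x by (cases "i = j") (auto simp: space_PiM intro!: measurable_const)
qed (use assms in \<open>auto simp: space_PiM PiE_iff extensional_def\<close>)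

text \<open>Entropy splits into the mean entropy in the new coordinate and the entropy of
  \<open>h\<close> with that coordinate integrated out. Convexity bounds the sections of the latter
  by averages of sections of \<open>h\<close>. The bounds are integrals of functions
  \<open>D j\<close> because integrating out a coordinate preserves this form.\<close>

theorem entropy_functional_tensorization:
  fixes \<mu> :: "'a measure"
  assumes \<mu>: "prob_space \<mu>" and I: "finite I"
    and "h \<in> borel_measurable (Pi\<^sub>M I (\<lambda>_. \<mu>))"
    and "\<And>x. x \<in> space (Pi\<^sub>M I (\<lambda>_. \<mu>)) \<Longrightarrow> a \<le> h x \<and> h x \<le> b" and a: "0 < a"
    and "\<And>j. j \<in> I \<Longrightarrow> D j \<in> borel_measurable (Pi\<^sub>M I (\<lambda>_. \<mu>))"
    and "\<And>j x. j \<in> I \<Longrightarrow> x \<in> space (Pi\<^sub>M I (\<lambda>_. \<mu>)) \<Longrightarrow> \<bar>D j x\<bar> \<le> c"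
    and "\<And>j x. j \<in> I \<Longrightarrow> x \<in> space (Pi\<^sub>M I (\<lambda>_. \<mu>)) \<Longrightarrow>
      entropy_functional \<mu> (\<lambda>z. h (x(j := z))) \<le> (\<integral>z. D j (x(j := z)) \<partial>\<mu>)"
  shows "entropy_functional (Pi\<^sub>M I (\<lambda>_. \<mu>)) h \<le> (\<Sum>j\<in>I. \<integral>x. D j x \<partial>Pi\<^sub>M I (\<lambda>_. \<mu>))"
  using I assms(3-)
proof (induction I arbitrary: h D rule: finite_induct)
  case empty
  then show ?case by (simp add: entropy_functional_def PiM_empty lebesgue_integral_count_space_finite)
next
  case (insert i I)
  interpret \<mu>: prob_space \<mu> by fact
  interpret product_sigma_finite "\<lambda>_. \<mu>" by unfold_locales
  let ?P = "Pi\<^sub>M (insert i I) (\<lambda>_. \<mu>)" and ?Q = "Pi\<^sub>M I (\<lambda>_. \<mu>)"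
  interpret P: prob_space ?P by (rule prob_space_PiM) (rule \<mu>)
  interpret Q: prob_space ?Q by (rule prob_space_PiM) (rule \<mu>)
  interpret Q\<mu>: pair_prob_space ?Q \<mu> ..
  interpret \<mu>\<mu>: pair_prob_space \<mu> \<mu> ..
  note [measurable] = insert.prems(1,4)
  have upd: "(\<lambda>(x, z). x(i := z)) \<in> measurable (?Q \<Otimes>\<^sub>M \<mu>) ?P"
    by (rule measurable_add_dim)
  have sp: "x(i := z) \<in> space ?P" if "x \<in> space ?Q" "z \<in> space \<mu>" for x z
    using measurable_space[OF upd, of "(x, z)"] that by (simp add: space_pair_measure)
  have spj: "x(j := z) \<in> space (Pi\<^sub>M J (\<lambda>_. \<mu>))"
    if "x \<in> space (Pi\<^sub>M J (\<lambda>_. \<mu>))" "z \<in> space \<mu>" "j \<in> J" for x z j J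
    using that by (auto simp: space_PiM PiE_iff extensional_def)
  have updj: "(\<lambda>p. x(j := snd p, i := fst p)) \<in> measurable (\<mu> \<Otimes>\<^sub>M \<mu>) ?P"
    if "x \<in> space ?Q" "j \<in> I" for x j
  proof -
    have "(\<lambda>p. (x(j := snd p), fst p)) \<in> measurable (\<mu> \<Otimes>\<^sub>M \<mu>) (?Q \<Otimes>\<^sub>M \<mu>)"
      using measurable_compose[OF measurable_snd measurable_section[OF that]]
      by (intro measurable_Pair measurable_fst)
    from measurable_compose[OF this upd] show ?thesis
      by (simp only: prod.case)
  qed
  have meas2: "(\<lambda>(z, w). f (x(j := w, i := z))) \<in> borel_measurable (\<mu> \<Otimes>\<^sub>M \<mu>)"
    if "f \<in> borel_measurable ?P" "x \<in> space ?Q" "j \<in> I" for f :: "_ \<Rightarrow> real" and x j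
    using measurable_compose[OF updj[OF that(2,3)] that(1)] unfolding case_prod_unfold .
  have sec2: "(\<lambda>w. f (x(j := w, i := z))) \<in> borel_measurable \<mu>"
    if "f \<in> borel_measurable ?P" "x \<in> space ?Q" "j \<in> I" "z \<in> space \<mu>" for f :: "_ \<Rightarrow> real" and x j z
    using measurable_Pair2[OF meas2[OF that(1-3)] that(4)] by simp
  have prod: "integral\<^sup>L ?P f = (\<integral>x. (\<integral>y. f (x(i := y)) \<partial>\<mu>) \<partial>?Q)"
    if "f \<in> borel_measurable ?P" "\<And>x. x \<in> space ?P \<Longrightarrow> \<bar>f x\<bar> \<le> d" for f :: "_ \<Rightarrow> real" and d
    using insert.hyps P.integrable_bounded[OF that] by (intro product_integral_insert) auto
  have meas: "(\<lambda>x. \<integral>z. f (x(i := z)) \<partial>\<mu>) \<in> borel_measurable ?Q" if "f \<in> borel_measurable ?P" for f :: "_ \<Rightarrow> real"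
    using measurable_compose[OF upd that]
    by (intro \<mu>.borel_measurable_lebesgue_integral) (simp add: case_prod_beta)
  have sec: "(\<lambda>z. f (x(i := z))) \<in> borel_measurable \<mu>" if "f \<in> borel_measurable ?P" "x \<in> space ?Q" for f :: "_ \<Rightarrow> real" and x
    using measurable_compose[OF measurable_Pair2[OF upd that(2)] that(1)] by simp
  define H where "H x = (\<integral>z. h (x(i := z)) \<partial>\<mu>)" for x
  define D' where "D' j x = (\<integral>z. D j (x(i := z)) \<partial>\<mu>)" for j x
  have Hm[measurable]: "H \<in> borel_measurable ?Q"
    unfolding H_def using insert.prems(1) by (rule meas)
  have Hb: "a \<le> H x \<and> H x \<le> b" if "x \<in> space ?Q" for x
    unfolding H_def
    by (intro conjI \<mu>.integral_bounds[where a = a and b = b] sec insert.prems(1,2) sp that)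
  have D'b: "\<bar>D' j x\<bar> \<le> c" if "j \<in> insert i I" "x \<in> space ?Q" for j x
    unfolding D'_def using that sp[OF that(2)] insert.prems(5)
    by (intro \<mu>.integral_abs_bound sec insert.prems(4)) auto
  have D'm: "D' j \<in> borel_measurable ?Q" if "j \<in> insert i I" for j
    unfolding D'_def using insert.prems(4)[OF that] by (rule meas)
  have hl: "\<bar>h x * ln (h x)\<bar> \<le> b * (\<bar>ln a\<bar> + \<bar>ln b\<bar>)" if "x \<in> space ?P" for x
    using insert.prems(2)[OF that] a by (intro abs_mult_ln_le) auto
  have Hl: "\<bar>H x * ln (H x)\<bar> \<le> b * (\<bar>ln a\<bar> + \<bar>ln b\<bar>)" if "x \<in> space ?Q" for x
    using Hb[OF that] a by (intro abs_mult_ln_le) auto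
  have IH: "entropy_functional ?Q H \<le> (\<Sum>j\<in>I. \<integral>x. D' j x \<partial>?Q)"
  proof (rule insert.IH)
    fix j x assume j: "j \<in> I" and x: "x \<in> space ?Q"
    then have ij: "i \<noteq> j" using insert.hyps by auto
    have sp2: "x(j := w, i := z) \<in> space ?P" if "w \<in> space \<mu>" "z \<in> space \<mu>" for w z
      using spj[OF x that(1) j] that by (intro sp)
    have "entropy_functional \<mu> (\<lambda>w. H (x(j := w)))
        \<le> (\<integral>z. entropy_functional \<mu> (\<lambda>w. h (x(j := w, i := z))) \<partial>\<mu>)"
      unfolding H_def
      by (intro \<mu>\<mu>.entropy_functional_integral_le[of _ a b] meas2 insert.prems(1,2) sp2 a x j)
    also have "\<dots> \<le> (\<integral>z. (\<integral>w. D j (x(j := w, i := z)) \<partial>\<mu>) \<partial>\<mu>)"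
    proof (rule integral_mono')
      have "(\<lambda>z. \<integral>w. D j (x(j := w, i := z)) \<partial>\<mu>) \<in> borel_measurable \<mu>"
        using j by (intro \<mu>.borel_measurable_lebesgue_integral meas2 insert.prems(4) x) auto
      moreover have "\<bar>\<integral>w. D j (x(j := w, i := z)) \<partial>\<mu>\<bar> \<le> c" if "z \<in> space \<mu>" for z
        using j that by (intro \<mu>.integral_abs_bound sec2 insert.prems(4,5) sp2 x) auto
      ultimately show "integrable \<mu> (\<lambda>z. \<integral>w. D j (x(j := w, i := z)) \<partial>\<mu>)"
        by (rule \<mu>.integrable_bounded)
      fix z assume z: "z \<in> space \<mu>"
      show le: "entropy_functional \<mu> (\<lambda>w. h (x(j := w, i := z))) \<le> (\<integral>w. D j (x(j := w, i := z)) \<partial>\<mu>)"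
        using insert.prems(6)[of j "x(i := z)"] sp[OF x z] j ij by (simp add: fun_upd_twist del: fun_upd_apply)
      \<comment> \<open>The test function 0 shows that entropy is nonnegative, so
        \<open>integral_mono'\<close> can compare the integrals from integrability of the upper
        function alone.\<close>
      have "0 \<le> entropy_functional \<mu> (\<lambda>w. h (x(j := w, i := z)))"
        using \<mu>.entropy_functional_variational[of "\<lambda>w. h (x(j := w, i := z))" a b "\<lambda>_. 0" 0,
            OF sec2[OF insert.prems(1) x j z] insert.prems(2)[OF sp2[OF _ z]] a]
        by (simp add: \<mu>.prob_space)
      with le show "0 \<le> (\<integral>w. D j (x(j := w, i := z)) \<partial>\<mu>)" by simp
    qed
    also have "\<dots> = (\<integral>w. D' j (x(j := w)) \<partial>\<mu>)"
      unfolding D'_def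
      using j by (intro \<mu>\<mu>.integral_swap_bounded[of _ c, symmetric] meas2 insert.prems(4,5) sp2 x) auto
    finally show "entropy_functional \<mu> (\<lambda>w. H (x(j := w))) \<le> (\<integral>w. D' j (x(j := w)) \<partial>\<mu>)" .
  qed (use Hm Hb a D'm D'b in auto)
  have Ei: "entropy_functional \<mu> (\<lambda>z. h (x(i := z))) = (\<integral>z. h (x(i := z)) * ln (h (x(i := z))) \<partial>\<mu>) - H x * ln (H x)" for x
    by (simp add: entropy_functional_def H_def)
  have Pm: "integral\<^sup>L ?P h = integral\<^sup>L ?Q H"
    unfolding H_def using insert.prems(2) a by (intro prod[of _ b]) fastforce+
  have Phl: "(\<integral>x. h x * ln (h x) \<partial>?P) = (\<integral>x. (\<integral>z. h (x(i := z)) * ln (h (x(i := z))) \<partial>\<mu>) \<partial>?Q)"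
    using hl by (intro prod) auto
  have i1: "integrable ?Q (\<lambda>x. \<integral>z. h (x(i := z)) * ln (h (x(i := z))) \<partial>\<mu>)"
    using hl sp sec[OF insert.prems(1)] by (intro Q.integrable_bounded meas \<mu>.integral_abs_bound) auto
  have i2: "integrable ?Q (\<lambda>x. H x * ln (H x))"
    using Hl by (intro Q.integrable_bounded) auto
  \<comment> \<open>Chain rule: \<open>H x * ln (H x)\<close> is subtracted in the sections and
    comes back in the entropy of \<open>H\<close>.\<close>
  have "entropy_functional ?P h = (\<integral>x. entropy_functional \<mu> (\<lambda>z. h (x(i := z))) \<partial>?Q) + entropy_functional ?Q H"
    using i1 i2 unfolding Ei by (simp add: entropy_functional_def Phl Pm)
  also have "(\<integral>x. entropy_functional \<mu> (\<lambda>z. h (x(i := z))) \<partial>?Q) \<le> (\<integral>x. D' i x \<partial>?Q)"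
  proof (rule integral_mono)
    show "integrable ?Q (\<lambda>x. entropy_functional \<mu> (\<lambda>z. h (x(i := z))))"
      unfolding Ei using i1 i2 by simp
    show "integrable ?Q (D' i)"
      using D'm D'b by (intro Q.integrable_bounded) auto
    fix x assume x: "x \<in> space ?Q"
    \<comment> \<open>The hypothesis speaks of points with all coordinates; any value at
      \<open>i\<close> will do, since the update overwrites it.\<close>
    obtain z0 where "z0 \<in> space \<mu>" using \<mu>.not_empty by blast
    from insert.prems(6)[OF insertI1 sp[OF x this]]
    show "entropy_functional \<mu> (\<lambda>z. h (x(i := z))) \<le> D' i x"
      by (simp add: D'_def del: fun_upd_apply)
  qed
  also have "(\<integral>x. D' i x \<partial>?Q) + entropy_functional ?Q H \<le> (\<integral>x. D' i x \<partial>?Q) + (\<Sum>j\<in>I. \<integral>x. D' j x \<partial>?Q)"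
    using IH by simp
  also have "\<dots> = (\<Sum>j\<in>insert i I. \<integral>x. D j x \<partial>?P)"
  proof -
    have "(\<integral>x. D' j x \<partial>?Q) = (\<integral>x. D j x \<partial>?P)" if "j \<in> insert i I" for j
      unfolding D'_def using insert.prems(4,5)[OF that] by (intro prod[symmetric])
    then show ?thesis using insert.hyps by simp
  qed
  finally show ?case by simp
qed

subsection \<open>Soft maxima of linear functionals\<close>

text \<open>An infinitesimal form of being \<open>L\<close>-Lipschitz for the \<open>l2\<close>
  product norm. Smoothness concerns one coordinate at a time, as tensorization does, and the
  explicit majorants \<open>G i\<close> of the partial gradient norms are measurable because they
  get integrated over the product.\<close>

definition tame :: "nat \<Rightarrow> real \<Rightarrow> ((nat \<Rightarrow> 'a::real_normed_vector) \<Rightarrow> real) \<Rightarrow> bool" where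
  "tame n L g \<longleftrightarrow> g \<in> borel_measurable (Pi\<^sub>M {..<n} (\<lambda>_. borel)) \<and>
     (\<forall>x. \<forall>i<n. elementary (\<lambda>z. g (x(i := z)))) \<and>
     (\<exists>G. (\<forall>i<n. G i \<in> borel_measurable (Pi\<^sub>M {..<n} (\<lambda>_. borel))) \<and>
        (\<forall>x. (\<Sum>i<n. (G i x)\<^sup>2) \<le> L\<^sup>2) \<and>
        (\<forall>x. \<forall>i<n. 0 \<le> G i x \<and>
           (\<exists>g'. ((\<lambda>z. g (x(i := z))) has_derivative g') (at (x i)) \<and> (\<forall>v. \<bar>g' v\<bar> \<le> G i x * norm v))))"

lemma tame_affine:
  fixes \<Phi> :: "nat \<Rightarrow> 'a::real_normed_vector \<Rightarrow> real"
  assumes \<Phi>: "\<And>k. k < n \<Longrightarrow> bounded_linear (\<Phi> k)" "\<And>k v. k < n \<Longrightarrow> \<bar>\<Phi> k v\<bar> \<le> a k * norm v"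
    and a: "\<And>k. k < n \<Longrightarrow> 0 \<le> a k" "(\<Sum>k<n. (a k)\<^sup>2) \<le> L\<^sup>2"
  shows "tame n L (\<lambda>x. c + (\<Sum>k<n. \<Phi> k (x k)))"
proof -
  have sec: "c + (\<Sum>k<n. \<Phi> k ((x(i := z)) k)) = (c + (\<Sum>k\<in>{..<n} - {i}. \<Phi> k (x k))) + \<Phi> i z"
    if "i < n" for x i z
    using that by (subst sum.remove[of _ i]) (auto intro!: sum.cong)
  show ?thesis
    unfolding tame_def
  proof (intro conjI allI impI exI[of _ "\<lambda>k _. a k"])
    have "\<Phi> k \<in> borel_measurable borel" if "k < n" for k
      using \<Phi>(1)[OF that] by (intro borel_measurable_continuous_onI linear_continuous_on)
    then show "(\<lambda>x. c + (\<Sum>k<n. \<Phi> k (x k))) \<in> borel_measurable (Pi\<^sub>M {..<n} (\<lambda>_. borel))"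
      by (intro borel_measurable_add borel_measurable_const borel_measurable_sum
          measurable_compose[OF measurable_component_singleton]) auto
  next
    fix x :: "nat \<Rightarrow> 'a" and i assume i: "i < n"
    show "elementary (\<lambda>z. c + (\<Sum>k<n. \<Phi> k ((x(i := z)) k)))"
      unfolding sec[OF i] using \<Phi>(1)[OF i] by (intro elementary.add elementary.const elementary.linear)
    show "\<exists>g'. ((\<lambda>z. c + (\<Sum>k<n. \<Phi> k ((x(i := z)) k))) has_derivative g') (at (x i)) \<and> (\<forall>v. \<bar>g' v\<bar> \<le> a i * norm v)"
      unfolding sec[OF i] using \<Phi>[OF i]
      by (intro exI[of _ "\<Phi> i"]) (auto intro!: derivative_eq_intros bounded_linear_imp_has_derivative)
  qed (use a in auto)
qed

lemma tame_const: "tame n L (\<lambda>_. c)"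
  using tame_affine[of n "\<lambda>_ _. 0" "\<lambda>_. 0" L c] by simp

lemma tame_uminus:
  assumes "tame n L g"
  shows "tame n L (\<lambda>x. - g x)"
proof -
  obtain G where g: "g \<in> borel_measurable (Pi\<^sub>M {..<n} (\<lambda>_. borel))"
    "\<forall>x. \<forall>i<n. elementary (\<lambda>z. g (x(i := z)))"
    and G: "\<forall>i<n. G i \<in> borel_measurable (Pi\<^sub>M {..<n} (\<lambda>_. borel))" "\<forall>x. (\<Sum>i<n. (G i x)\<^sup>2) \<le> L\<^sup>2"
    "\<forall>x. \<forall>i<n. 0 \<le> G i x \<and> (\<exists>g'. ((\<lambda>z. g (x(i := z))) has_derivative g') (at (x i)) \<and> (\<forall>v. \<bar>g' v\<bar> \<le> G i x * norm v))"
    using assms unfolding tame_def by blast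
  show ?thesis
    unfolding tame_def
  proof (intro conjI allI impI exI[of _ G])
    fix x i assume i: "i < n"
    have "elementary (\<lambda>z. (- 1) * g (x(i := z)))"
      using g(2) i by (intro elementary.mult elementary.const) auto
    then show "elementary (\<lambda>z. - g (x(i := z)))" by simp
    obtain g' where "((\<lambda>z. g (x(i := z))) has_derivative g') (at (x i))" "\<forall>v. \<bar>g' v\<bar> \<le> G i x * norm v"
      using G(3) i by blast
    then show "\<exists>g'. ((\<lambda>z. - g (x(i := z))) has_derivative g') (at (x i)) \<and> (\<forall>v. \<bar>g' v\<bar> \<le> G i x * norm v)"
      by (intro exI[of _ "\<lambda>v. - g' v"]) (auto intro!: has_derivative_minus)
  qed (use g G in auto)
qed

definition softmax :: "real \<Rightarrow> 'i set \<Rightarrow> ('i \<Rightarrow> real) \<Rightarrow> real" where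
  "softmax s I a = ln (\<Sum>i\<in>I. exp (s * a i)) / s"

text \<open>The difference of the two sides is the weighted variance of \<open>a\<close>.\<close>

lemma weighted_sum_square_le:
  fixes w a :: "'i \<Rightarrow> real"
  assumes "finite I" "\<And>i. i \<in> I \<Longrightarrow> 0 \<le> w i" "(\<Sum>i\<in>I. w i) = 1"
  shows "(\<Sum>i\<in>I. w i * a i)\<^sup>2 \<le> (\<Sum>i\<in>I. w i * (a i)\<^sup>2)"
proof -
  define m where "m = (\<Sum>i\<in>I. w i * a i)"
  have "0 \<le> (\<Sum>i\<in>I. w i * (a i - m)\<^sup>2)"
    using assms by (intro sum_nonneg) auto
  also have "\<dots> = (\<Sum>i\<in>I. w i * (a i)\<^sup>2) - 2 * m * (\<Sum>i\<in>I. w i * a i) + m\<^sup>2 * (\<Sum>i\<in>I. w i)"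
    by (simp add: power2_diff algebra_simps sum.distrib sum_subtractf sum_distrib_left flip: sum_distrib_right)
  also have "\<dots> = (\<Sum>i\<in>I. w i * (a i)\<^sup>2) - m\<^sup>2"
    using assms(3) by (simp add: m_def[symmetric] power2_eq_square)
  finally show ?thesis by (simp add: m_def)
qed

text \<open>The partial derivatives of a soft maximum are convex combinations of those of its arguments,
  with weights that do not depend on the coordinate; hence the bound on the gradient is inherited.\<close>

lemma tame_softmax:
  fixes f :: "'i \<Rightarrow> (nat \<Rightarrow> 'a::real_normed_vector) \<Rightarrow> real"
  assumes I: "finite I" "I \<noteq> {}" and s: "s > 0" and f: "\<And>j. j \<in> I \<Longrightarrow> tame n L (f j)"
  shows "tame n L (\<lambda>x. softmax s I (\<lambda>j. f j x))"
proof -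
  have fm: "f j \<in> borel_measurable (Pi\<^sub>M {..<n} (\<lambda>_. borel))" if "j \<in> I" for j
    using f[OF that] by (simp add: tame_def)
  have fe: "elementary (\<lambda>z. f j (x(i := z)))" if "j \<in> I" "i < n" for i j x
    using f[OF that(1)] that(2) by (simp add: tame_def)
  have "\<forall>j\<in>I. \<exists>G. (\<forall>i<n. G i \<in> borel_measurable (Pi\<^sub>M {..<n} (\<lambda>_. borel))) \<and>
        (\<forall>x. (\<Sum>i<n. (G i x)\<^sup>2) \<le> L\<^sup>2) \<and>
        (\<forall>x. \<forall>i<n. 0 \<le> G i x \<and>
           (\<exists>g'. ((\<lambda>z. f j (x(i := z))) has_derivative g') (at (x i)) \<and> (\<forall>v. \<bar>g' v\<bar> \<le> G i x * norm v)))"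
    using f unfolding tame_def by blast
  then obtain G where G': "\<forall>j\<in>I. (\<forall>i<n. G j i \<in> borel_measurable (Pi\<^sub>M {..<n} (\<lambda>_. borel))) \<and>
        (\<forall>x. (\<Sum>i<n. (G j i x)\<^sup>2) \<le> L\<^sup>2) \<and>
        (\<forall>x. \<forall>i<n. 0 \<le> G j i x \<and>
           (\<exists>g'. ((\<lambda>z. f j (x(i := z))) has_derivative g') (at (x i)) \<and> (\<forall>v. \<bar>g' v\<bar> \<le> G j i x * norm v)))"
    by (rule bchoice[THEN exE])
  have G: "G j i \<in> borel_measurable (Pi\<^sub>M {..<n} (\<lambda>_. borel))" "0 \<le> G j i x"
    "\<exists>g'. ((\<lambda>z. f j (x(i := z))) has_derivative g') (at (x i)) \<and> (\<forall>v. \<bar>g' v\<bar> \<le> G j i x * norm v)"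
    if "j \<in> I" "i < n" for i j x
    using G' that by blast+
  have GL: "(\<Sum>i<n. (G j i x)\<^sup>2) \<le> L\<^sup>2" if "j \<in> I" for j x
    using G' that by blast
  define S where "S x = (\<Sum>j\<in>I. exp (s * f j x))" for x
  have S: "S x > 0" for x
    unfolding S_def using I by (intro sum_pos) auto
  define w where "w j x = exp (s * f j x) / S x" for j x
  have w: "0 \<le> w j x" "(\<Sum>j\<in>I. w j x) = 1" for j x
    using S[of x] by (auto simp: w_def S_def simp flip: sum_divide_distrib)
  have Sm: "S \<in> borel_measurable (Pi\<^sub>M {..<n} (\<lambda>_. borel))"
    unfolding S_def using fm by measurable
  show ?thesis
    unfolding tame_def
  proof (intro conjI allI impI exI[of _ "\<lambda>i x. \<Sum>j\<in>I. w j x * G j i x"])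
    show "(\<lambda>x. softmax s I (\<lambda>j. f j x)) \<in> borel_measurable (Pi\<^sub>M {..<n} (\<lambda>_. borel))"
      unfolding softmax_def S_def[symmetric] using Sm by measurable
    show "(\<lambda>x. \<Sum>j\<in>I. w j x * G j i x) \<in> borel_measurable (Pi\<^sub>M {..<n} (\<lambda>_. borel))" if "i < n" for i
      unfolding w_def using Sm fm G(1)[OF _ that] by measurable
  next
    fix x
    have "(\<Sum>i<n. (\<Sum>j\<in>I. w j x * G j i x)\<^sup>2) \<le> (\<Sum>i<n. \<Sum>j\<in>I. w j x * (G j i x)\<^sup>2)"
      using w I by (intro sum_mono weighted_sum_square_le)
    also have "\<dots> = (\<Sum>j\<in>I. w j x * (\<Sum>i<n. (G j i x)\<^sup>2))"
      by (subst sum.swap) (simp add: sum_distrib_left)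
    also have "\<dots> \<le> (\<Sum>j\<in>I. w j x * L\<^sup>2)"
      using w GL by (intro sum_mono mult_left_mono)
    also have "\<dots> = L\<^sup>2"
      using w(2) by (simp flip: sum_distrib_right)
    finally show "(\<Sum>i<n. (\<Sum>j\<in>I. w j x * G j i x)\<^sup>2) \<le> L\<^sup>2" .
  next
    fix x i assume i: "i < n"
    have "elementary (\<lambda>z. inverse s * ln (S (x(i := z))))"
      using S fe i I unfolding S_def
      by (intro elementary.mult elementary.const elementary.ln elementary_sum elementary.exp) auto
    then show "elementary (\<lambda>z. softmax s I (\<lambda>j. f j (x(i := z))))"
      by (simp add: softmax_def S_def divide_inverse mult.commute)
    show "0 \<le> (\<Sum>j\<in>I. w j x * G j i x)"
      using w G(2) i by (intro sum_nonneg) auto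
    have "\<forall>j\<in>I. \<exists>g'. ((\<lambda>z. f j (x(i := z))) has_derivative g') (at (x i)) \<and> (\<forall>v. \<bar>g' v\<bar> \<le> G j i x * norm v)"
      using G(3) i by blast
    then obtain g' where g: "\<forall>j\<in>I. ((\<lambda>z. f j (x(i := z))) has_derivative g' j) (at (x i)) \<and>
        (\<forall>v. \<bar>g' j v\<bar> \<le> G j i x * norm v)"
      by (rule bchoice[THEN exE])
    have "((\<lambda>z. S (x(i := z))) has_derivative (\<lambda>h. \<Sum>j\<in>I. (s * g' j h) * exp (s * f j x))) (at (x i))"
      unfolding S_def
    proof (rule has_derivative_sum)
      fix j assume "j \<in> I"
      with g have "((\<lambda>z. f j (x(i := z))) has_derivative g' j) (at (x i))" by blast
      then have "((\<lambda>z. exp (s * f j (x(i := z)))) has_derivative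
          (\<lambda>h. exp (s * f j (x(i := x i))) * (s * g' j h))) (at (x i))"
        by (auto intro!: derivative_eq_intros)
      then show "((\<lambda>z. exp (s * f j (x(i := z)))) has_derivative (\<lambda>h. (s * g' j h) * exp (s * f j x))) (at (x i))"
        by (simp add: mult.commute)
    qed
    then have "((\<lambda>z. ln (S (x(i := z)))) has_derivative
        (\<lambda>h. (\<Sum>j\<in>I. (s * g' j h) * exp (s * f j x)) * inverse (S x))) (at (x i))"
      using has_derivative_ln[of "\<lambda>z. S (x(i := z))" "x i"] S by simp
    then have "((\<lambda>z. ln (S (x(i := z))) / s) has_derivative
        (\<lambda>h. (\<Sum>j\<in>I. (s * g' j h) * exp (s * f j x)) * inverse (S x) / s)) (at (x i))"
      by (rule bounded_linear.has_derivative[OF bounded_linear_divide])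
    moreover have "(\<Sum>j\<in>I. (s * g' j h) * exp (s * f j x)) * inverse (S x) / s = (\<Sum>j\<in>I. w j x * g' j h)" for h
      using s unfolding sum_distrib_right sum_divide_distrib
      by (intro sum.cong refl) (simp add: w_def divide_inverse)
    ultimately have "((\<lambda>z. softmax s I (\<lambda>j. f j (x(i := z)))) has_derivative (\<lambda>h. \<Sum>j\<in>I. w j x * g' j h)) (at (x i))"
      by (simp add: softmax_def S_def)
    moreover have "\<bar>\<Sum>j\<in>I. w j x * g' j v\<bar> \<le> (\<Sum>j\<in>I. w j x * G j i x) * norm v" for v
    proof -
      have "\<bar>\<Sum>j\<in>I. w j x * g' j v\<bar> \<le> (\<Sum>j\<in>I. w j x * (G j i x * norm v))"
        using g w by (intro order_trans[OF sum_abs] sum_mono) (auto simp: abs_mult intro!: mult_left_mono)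
      then show ?thesis by (simp add: sum_distrib_right mult.assoc)
    qed
    ultimately show "\<exists>g'. ((\<lambda>z. softmax s I (\<lambda>j. f j (x(i := z)))) has_derivative g') (at (x i)) \<and>
        (\<forall>v. \<bar>g' v\<bar> \<le> (\<Sum>j\<in>I. w j x * G j i x) * norm v)"
      by blast
  qed
qed

subsection \<open>Herbst's argument\<close>

text \<open>An error quadratic in \<open>y - x\<close> gives the difference quotients of a Laplace
  transform an explicit rate, uniformly in the integration variable.\<close>

lemma exp_taylor_bound:
  fixes x y :: real
  assumes "x \<le> c" "y \<le> c"
  shows "\<bar>exp y - exp x - (y - x) * exp x\<bar> \<le> (y - x)\<^sup>2 * exp c"
proof -
  have 1: "(y - x) * exp x \<le> exp y - exp x" for x y :: real
  proof -
    have "(1 + (y - x)) * exp x \<le> exp (y - x) * exp x"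
      by (intro mult_right_mono exp_ge_add_one_self) auto
    then show ?thesis by (simp add: algebra_simps flip: exp_add)
  qed
  have "\<bar>exp y - exp x\<bar> \<le> \<bar>y - x\<bar> * exp c" if "x \<le> c" "y \<le> c" for x y
  proof -
    have *: "exp y - exp x \<le> (y - x) * exp c" if "x \<le> y" "y \<le> c" for x y :: real
    proof -
      have "exp y - exp x \<le> (y - x) * exp y"
        using 1[of x y] by (simp add: algebra_simps)
      also have "\<dots> \<le> (y - x) * exp c"
        using that by (intro mult_left_mono) auto
      finally show ?thesis .
    qed
    show ?thesis
      using *[of x y] *[of y x] that by (cases "x \<le> y") auto
  qed
  note lip = this[OF assms]
  \<comment> \<open>The tangent inequalities at both points place the error between 0 and
    \<open>(y - x) * (exp y - exp x)\<close>.\<close>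
  have "\<bar>exp y - exp x - (y - x) * exp x\<bar> \<le> \<bar>(y - x) * (exp y - exp x)\<bar>"
    using 1[of y x] 1[of x y] by (auto simp: algebra_simps abs_if)
  also have "\<dots> \<le> \<bar>y - x\<bar> * (\<bar>y - x\<bar> * exp c)"
    unfolding abs_mult using lip by (intro mult_left_mono) auto
  also have "\<dots> = (y - x)\<^sup>2 * exp c"
    by (simp add: power2_eq_square flip: mult.assoc abs_mult)
  finally show ?thesis .
qed

lemma (in prob_space) laplace_has_derivative:
  fixes g :: "'a \<Rightarrow> real"
  assumes [measurable]: "g \<in> borel_measurable M" and B: "\<And>x. x \<in> space M \<Longrightarrow> \<bar>g x\<bar> \<le> B"
  shows "((\<lambda>l. \<integral>x. exp (l * g x) \<partial>M) has_real_derivative (\<integral>x. g x * exp (l * g x) \<partial>M)) (at l)"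
proof -
  have B0: "0 \<le> B" using B not_empty by fastforce
  \<comment> \<open>This bounds the exponent \<open>k * g x\<close> for all \<open>k\<close> within
    distance 1 of \<open>l\<close>, hence for every increment considered below.\<close>
  define c where "c = (\<bar>l\<bar> + 1) * B"
  have le: "k * g x \<le> c" if "x \<in> space M" "\<bar>k\<bar> \<le> \<bar>l\<bar> + 1" for k x
  proof -
    have "\<bar>k * g x\<bar> \<le> c"
      unfolding abs_mult c_def using B[OF that(1)] that(2) by (intro mult_mono) auto
    then show ?thesis by simp
  qed
  have i1: "integrable M (\<lambda>x. exp (k * g x))" if "\<bar>k\<bar> \<le> \<bar>l\<bar> + 1" for k
    using le that by (intro integrable_bounded[of _ "exp c"]) auto
  have i2: "integrable M (\<lambda>x. g x * exp (l * g x))"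
    using le B B0 by (intro integrable_bounded[of _ "B * exp c"]) (auto simp: abs_mult intro!: mult_mono)
  have "\<bar>((\<integral>x. exp ((l + h) * g x) \<partial>M) - (\<integral>x. exp (l * g x) \<partial>M)) / h - (\<integral>x. g x * exp (l * g x) \<partial>M)\<bar>
      \<le> \<bar>h\<bar> * (B\<^sup>2 * exp c)" if h: "h \<noteq> 0" "\<bar>h\<bar> < 1" for h
  proof -
    have "\<bar>exp ((l + h) * g x) - exp (l * g x) - h * (g x * exp (l * g x))\<bar> \<le> h\<^sup>2 * (B\<^sup>2 * exp c)"
      if "x \<in> space M" for x
    proof -
      have "\<bar>exp ((l + h) * g x) - exp (l * g x) - ((l + h) * g x - l * g x) * exp (l * g x)\<bar>
          \<le> ((l + h) * g x - l * g x)\<^sup>2 * exp c"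
        using h by (intro exp_taylor_bound le that) auto
      also have "((l + h) * g x - l * g x)\<^sup>2 = h\<^sup>2 * (g x)\<^sup>2"
        by (simp add: algebra_simps power_mult_distrib)
      also have "h\<^sup>2 * (g x)\<^sup>2 * exp c \<le> h\<^sup>2 * (B\<^sup>2 * exp c)"
        using abs_le_square_iff[of "g x" B] B[OF that] B0
        by (auto simp: mult.assoc intro!: mult_left_mono mult_right_mono)
      finally show ?thesis by (simp add: algebra_simps)
    qed
    then have "\<bar>\<integral>x. exp ((l + h) * g x) - exp (l * g x) - h * (g x * exp (l * g x)) \<partial>M\<bar> \<le> h\<^sup>2 * (B\<^sup>2 * exp c)"
      by (intro integral_abs_bound) auto
    then have "\<bar>(\<integral>x. exp ((l + h) * g x) \<partial>M) - (\<integral>x. exp (l * g x) \<partial>M) - h * (\<integral>x. g x * exp (l * g x) \<partial>M)\<bar>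
        \<le> \<bar>h\<bar> * (\<bar>h\<bar> * (B\<^sup>2 * exp c))" (is "?d \<le> _")
    proof -
      have "\<bar>l + h\<bar> \<le> \<bar>l\<bar> + 1" using h by linarith
      then have "?d = \<bar>\<integral>x. exp ((l + h) * g x) - exp (l * g x) - h * (g x * exp (l * g x)) \<partial>M\<bar>"
        using i1[of "l + h"] i1[of l] i2 by (simp del: mult_exp_exp)
      also have "\<dots> \<le> h\<^sup>2 * (B\<^sup>2 * exp c)" by fact
      also have "h\<^sup>2 = \<bar>h\<bar> * \<bar>h\<bar>" by (simp add: power2_eq_square)
      finally show ?thesis by (simp only: mult.assoc)
    qed
    moreover have "(\<integral>x. exp ((l + h) * g x) \<partial>M) - (\<integral>x. exp (l * g x) \<partial>M) - h * (\<integral>x. g x * exp (l * g x) \<partial>M)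
       = h * (((\<integral>x. exp ((l + h) * g x) \<partial>M) - (\<integral>x. exp (l * g x) \<partial>M)) / h - (\<integral>x. g x * exp (l * g x) \<partial>M))"
      using h by (simp add: field_simps)
    ultimately show ?thesis
      using h by (simp add: abs_mult)
  qed
  then have "\<forall>\<^sub>F h in at 0. norm (((\<integral>x. exp ((l + h) * g x) \<partial>M) - (\<integral>x. exp (l * g x) \<partial>M)) / h
      - (\<integral>x. g x * exp (l * g x) \<partial>M)) \<le> \<bar>h\<bar> * (B\<^sup>2 * exp c)"
    unfolding eventually_at by (intro exI[of _ 1]) auto
  moreover have "((\<lambda>h. \<bar>h\<bar> * (B\<^sup>2 * exp c)) \<longlongrightarrow> 0) (at 0)"
    by (intro tendsto_mult_left_zero tendsto_rabs_zero tendsto_ident_at)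
  ultimately show ?thesis
    unfolding DERIV_def by (rule LIM_zero_cancel[OF Lim_null_comparison])
qed

text \<open>Herbst's argument: the entropy bound says that \<open>l \<mapsto> ln Z(l) / l - c * l\<close> is nonincreasing for
  \<open>l > 0\<close>, where \<open>Z\<close> is the Laplace transform; its limit at \<open>0\<close> is the mean.\<close>

lemma (in prob_space) herbst:
  fixes g :: "'a \<Rightarrow> real"
  assumes [measurable]: "g \<in> borel_measurable M" and B: "\<And>x. x \<in> space M \<Longrightarrow> \<bar>g x\<bar> \<le> B"
    and ent: "\<And>l. l > 0 \<Longrightarrow> entropy_functional M (\<lambda>x. exp (l * g x)) \<le> c * l\<^sup>2 * (\<integral>x. exp (l * g x) \<partial>M)"
    and l: "l > 0"
  shows "(\<integral>x. exp (l * g x) \<partial>M) \<le> exp (l * (\<integral>x. g x \<partial>M) + c * l\<^sup>2)"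
proof -
  define Z where "Z l = (\<integral>x. exp (l * g x) \<partial>M)" for l
  define Z' where "Z' l = (\<integral>x. g x * exp (l * g x) \<partial>M)" for l
  have dZ: "(Z has_real_derivative Z' l) (at l)" for l
    unfolding Z_def[abs_def] Z'_def by (rule laplace_has_derivative[OF assms(1,2)])
  have B0: "0 \<le> B" using B not_empty by fastforce
  have le: "\<bar>l * g x\<bar> \<le> \<bar>l\<bar> * B" if "x \<in> space M" for x l
    unfolding abs_mult using B[OF that] by (intro mult_left_mono) auto
  have Z: "Z l > 0" for l
  proof -
    have "exp (- \<bar>l\<bar> * B) \<le> Z l"
      unfolding Z_def using le[of _ l]
      by (intro integral_bounds(1)[where b = "exp (\<bar>l\<bar> * B)"]) (auto simp: abs_le_iff minus_le_iff)
    then show ?thesis by (meson exp_gt_zero less_le_trans)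
  qed
  \<comment> \<open>Since \<open>ln (exp (l * g x)) = l * g x\<close>, the left side is the entropy
    of \<open>exp (l * g)\<close>. Divided by \<open>Z l * l\<^sup>2\<close> it is the derivative of
    \<open>ln (Z l) / l\<close>.\<close>
  have ent': "l * Z' l - Z l * ln (Z l) \<le> c * l\<^sup>2 * Z l" if "l > 0" for l
    using ent[OF that] by (simp add: entropy_functional_def Z_def Z'_def mult.left_commute mult.assoc)
      (simp add: mult.commute)
  define f where "f l = ln (Z l) / l - c * l" for l
  have df: "\<exists>y. (f has_real_derivative y) (at l) \<and> y \<le> 0" if "l > 0" for l
  proof (intro exI conjI)
    show "(f has_real_derivative ((Z' l / Z l) * l - ln (Z l) * 1) / (l * l) - c) (at l)"
      unfolding f_def[abs_def] using that Z[of l] dZ[of l]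
      by (auto intro!: derivative_eq_intros simp: field_simps)
    have "l * Z' l / Z l - ln (Z l) \<le> c * l\<^sup>2"
      using ent'[OF that] Z[of l] by (simp add: field_simps)
    then show "((Z' l / Z l) * l - ln (Z l) * 1) / (l * l) - c \<le> 0"
      using that by (simp add: field_simps power2_eq_square)
  qed
  have mono: "f l \<le> f e" if "0 < e" "e \<le> l" for e
    using that df by (intro DERIV_nonpos_imp_nonincreasing[of e l f]) force+
  have Z0: "Z 0 = 1" "Z' 0 = (\<integral>x. g x \<partial>M)"
    by (simp_all add: Z_def Z'_def prob_space)
  have "((\<lambda>l. ln (Z l)) has_real_derivative Z' 0) (at 0)"
    using dZ[of 0] Z[of 0] by (auto intro!: derivative_eq_intros simp: Z0)
  then have "((\<lambda>e. ln (Z e) / e) \<longlongrightarrow> Z' 0) (at_right 0)"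
    by (auto simp: DERIV_def Z0 intro: filterlim_mono at_le)
  then have "(f \<longlongrightarrow> Z' 0 - c * 0) (at_right 0)"
    unfolding f_def[abs_def] by (intro tendsto_intros)
  moreover have "\<forall>\<^sub>F e in at_right 0. f l \<le> f e"
    using eventually_at_right_less[of 0] eventually_at_rightI[of 0 l "\<lambda>e. e \<le> l"] l mono
    by (auto elim: eventually_elim2)
  ultimately have "f l \<le> Z' 0"
    by (intro tendsto_lowerbound[of f "Z' 0" "at_right 0"]) auto
  then have "ln (Z l) \<le> l * (\<integral>x. g x \<partial>M) + c * l\<^sup>2"
    using l by (simp add: f_def Z0 field_simps power2_eq_square)
  then have "exp (ln (Z l)) \<le> exp (l * (\<integral>x. g x \<partial>M) + c * l\<^sup>2)" by simp
  then have "Z l \<le> exp (l * (\<integral>x. g x \<partial>M) + c * l\<^sup>2)" by (simp only: exp_ln[OF Z])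
  then show ?thesis by (simp only: Z_def)
qed

text \<open>Boundedness of \<open>g\<close> makes all integrability conditions automatic. The
  one-coordinate inequalities add up by tensorization, and the pointwise bound on the sum of
  \<open>(G i x)\<^sup>2\<close> replaces that sum by \<open>L\<^sup>2\<close>.\<close>

lemma log_sobolev_tame:
  fixes \<mu> :: "'a::real_normed_vector measure" and g :: "(nat \<Rightarrow> 'a) \<Rightarrow> real"
  assumes \<mu>: "prob_space \<mu>" "sets \<mu> = sets borel" "log_sobolev \<mu> C" and C: "C \<ge> 0"
    and g: "tame n L g" "\<And>x. \<bar>g x\<bar> \<le> B"
  shows "entropy_functional (Pi\<^sub>M {..<n} (\<lambda>_. \<mu>)) (\<lambda>x. exp (l * g x))
      \<le> (C * L\<^sup>2 / 2) * l\<^sup>2 * (\<integral>x. exp (l * g x) \<partial>Pi\<^sub>M {..<n} (\<lambda>_. \<mu>))"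
proof -
  interpret \<mu>: prob_space \<mu> by fact
  let ?P = "Pi\<^sub>M {..<n} (\<lambda>_. \<mu>)"
  interpret P: prob_space ?P by (rule prob_space_PiM) (rule \<mu>(1))
  have sP: "sets ?P = sets (Pi\<^sub>M {..<n} (\<lambda>_. borel))"
    using \<mu>(2) by (intro sets_PiM_cong) auto
  obtain G where gm: "g \<in> borel_measurable ?P"
    and gel: "\<And>x i. i < n \<Longrightarrow> elementary (\<lambda>z. g (x(i := z)))"
    and Gm: "\<And>i. i < n \<Longrightarrow> G i \<in> borel_measurable ?P"
    and GL: "\<And>x. (\<Sum>i<n. (G i x)\<^sup>2) \<le> L\<^sup>2"
    and G: "\<And>x i. i < n \<Longrightarrow> 0 \<le> G i x \<and>
       (\<exists>g'. ((\<lambda>z. g (x(i := z))) has_derivative g') (at (x i)) \<and> (\<forall>v. \<bar>g' v\<bar> \<le> G i x * norm v))"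
    using g(1) unfolding tame_def measurable_cong_sets[OF sP refl] by blast
  have GiL: "(G i x)\<^sup>2 \<le> L\<^sup>2" if "i < n" for i x
    using member_le_sum[of i "{..<n}" "\<lambda>i. (G i x)\<^sup>2"] GL[of x] that by auto
  have B0: "0 \<le> B" using g(2)[of undefined] by linarith
  have lb: "\<bar>k * g x\<bar> \<le> \<bar>k\<bar> * B" for k x
    unfolding abs_mult using g(2) by (intro mult_left_mono) auto
  define b where "b = \<bar>l\<bar> * B"
  have hb: "exp (- b) \<le> exp (l * g x) \<and> exp (l * g x) \<le> exp b" for x
    using lb[of l x] by (auto simp: b_def abs_le_iff minus_le_iff)
  \<comment> \<open>The factor \<open>C * l\<^sup>2 / 2\<close> is \<open>2 * C\<close> times
    \<open>(l / 2)\<^sup>2\<close>: the test function carries half the exponent, because the log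
    Sobolev inequality concerns its square.\<close>
  define D where "D i x = (C * l\<^sup>2 / 2) * (exp (l * g x) * (G i x)\<^sup>2)" for i x
  have Db: "0 \<le> D i x \<and> D i x \<le> (C * l\<^sup>2 / 2) * (exp b * L\<^sup>2)" if "i < n" for i x
    unfolding D_def using hb[of x] GiL[OF that] C
    by (intro conjI mult_left_mono mult_mono mult_nonneg_nonneg) auto
  have Dm: "D i \<in> borel_measurable ?P" if "i < n" for i
    unfolding D_def using gm Gm[OF that] by measurable
  have ls: "entropy_functional \<mu> (\<lambda>z. exp (l * g (x(i := z)))) \<le> (\<integral>z. D i (x(i := z)) \<partial>\<mu>)"
    if i: "i < n" and x: "x \<in> space ?P" for i x
  proof -
    define f where "f z = exp ((l / 2) * g (x(i := z)))" for z
    have fel: "elementary f"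
      unfolding f_def[abs_def] using gel[OF i] by (intro elementary.exp elementary.mult elementary.const)
    have sm: "smooth f" by (rule elementary_smooth[OF fel])
    have f2: "(f z)\<^sup>2 = exp (l * g (x(i := z)))" for z
      by (simp add: f_def power2_eq_square flip: exp_add)
    have sec: "(\<lambda>z. h (x(i := z))) \<in> borel_measurable \<mu>" if "h \<in> borel_measurable ?P" for h :: "_ \<Rightarrow> real"
      using measurable_compose[OF measurable_section[OF x] that] i by simp
    have f2m: "(\<lambda>z. (f z)\<^sup>2) \<in> borel_measurable \<mu>"
      unfolding f2 using gm by (intro sec) measurable
    have grad: "0 \<le> grad_norm f z \<and> (grad_norm f z)\<^sup>2 \<le> (l\<^sup>2 / 4) * (exp (l * g (x(i := z))) * (G i (x(i := z)))\<^sup>2)" for z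
    proof -
      \<comment> \<open>In \<open>tame\<close> the derivative is taken at the point's own
        coordinate, which for the updated point is \<open>z\<close>.\<close>
      obtain g' where g': "((\<lambda>w. g (x(i := w))) has_derivative g') (at z)" "\<And>v. \<bar>g' v\<bar> \<le> G i (x(i := z)) * norm v"
        using G[OF i, of "x(i := z)"] by auto
      have df: "(f has_derivative (\<lambda>h. f z * ((l / 2) * g' h))) (at z)"
        unfolding f_def[abs_def] using g'(1) by (auto intro!: derivative_eq_intros)
      have G0: "0 \<le> G i (x(i := z))" using G[OF i] by blast
      have "grad_norm f z \<le> f z * (\<bar>l\<bar> / 2) * G i (x(i := z))"
      proof (rule grad_norm_le[OF df])
        fix v
        have "\<bar>f z * (l / 2 * g' v)\<bar> = (f z * (\<bar>l\<bar> / 2)) * \<bar>g' v\<bar>"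
          by (simp add: abs_mult f_def)
        also have "\<dots> \<le> (f z * (\<bar>l\<bar> / 2)) * (G i (x(i := z)) * norm v)"
          using g'(2) by (intro mult_left_mono) (auto simp: f_def)
        finally show "\<bar>f z * (l / 2 * g' v)\<bar> \<le> f z * (\<bar>l\<bar> / 2) * G i (x(i := z)) * norm v"
          by (simp add: mult.assoc)
      qed (use G0 in \<open>auto simp: f_def\<close>)
      moreover have n: "0 \<le> grad_norm f z" by (rule grad_norm_nonneg[OF df])
      ultimately have "(grad_norm f z)\<^sup>2 \<le> (f z * (\<bar>l\<bar> / 2) * G i (x(i := z)))\<^sup>2"
        by (intro power_mono)
      also have "\<dots> = (l\<^sup>2 / 4) * ((f z)\<^sup>2 * (G i (x(i := z)))\<^sup>2)"
        by (simp add: power_mult_distrib power_divide)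
      finally show ?thesis using n by (simp add: f2)
    qed
    have gradm: "grad_norm f \<in> borel_measurable \<mu>"
      using borel_measurable_continuous_onI[OF continuous_grad_norm[OF sm]]
      unfolding measurable_cong_sets[OF \<mu>(2) refl] .
    have grb: "(grad_norm f z)\<^sup>2 \<le> (l\<^sup>2 / 4) * (exp b * L\<^sup>2)" for z
      using grad[of z] hb GiL[OF i]
      by (elim conjE order_trans) (intro mult_left_mono mult_mono; auto)
    have ig: "integrable \<mu> (\<lambda>z. (grad_norm f z)\<^sup>2)"
      using grb gradm by (intro \<mu>.integrable_bounded[of _ "(l\<^sup>2 / 4) * (exp b * L\<^sup>2)"]) auto
    have "entropy_functional \<mu> (\<lambda>z. (f z)\<^sup>2) \<le> 2 * C * (\<integral>z. (grad_norm f z)\<^sup>2 \<partial>\<mu>)"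
      unfolding entropy_functional_def
    proof (rule \<mu>(3)[unfolded log_sobolev_def, rule_format])
      show "integrable \<mu> (\<lambda>z. (f z)\<^sup>2)"
        using hb f2m by (intro \<mu>.integrable_bounded[of _ "exp b"]) (auto simp: f2)
      show "integrable \<mu> (\<lambda>z. (f z)\<^sup>2 * ln ((f z)\<^sup>2))"
      proof (rule \<mu>.integrable_bounded)
        show "(\<lambda>z. (f z)\<^sup>2 * ln ((f z)\<^sup>2)) \<in> borel_measurable \<mu>"
          using f2m by (intro borel_measurable_times borel_measurable_ln)
        show "\<bar>(f z)\<^sup>2 * ln ((f z)\<^sup>2)\<bar> \<le> exp b * (\<bar>ln (exp (- b))\<bar> + \<bar>ln (exp b)\<bar>)" for z
          unfolding f2 using hb by (intro abs_mult_ln_le) auto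
      qed
    qed (use sm ig in auto)
    also have "\<dots> = (\<integral>z. 2 * C * (grad_norm f z)\<^sup>2 \<partial>\<mu>)"
      by simp
    also have "\<dots> \<le> (\<integral>z. D i (x(i := z)) \<partial>\<mu>)"
    proof (rule integral_mono)
      show "integrable \<mu> (\<lambda>z. D i (x(i := z)))"
        using Db[OF i] by (intro \<mu>.integrable_bounded[where c = "(C * l\<^sup>2 / 2) * (exp b * L\<^sup>2)"] sec Dm i) (auto simp: abs_of_nonneg)
      show "2 * C * (grad_norm f z)\<^sup>2 \<le> D i (x(i := z))" for z
        using mult_left_mono[OF grad[THEN conjunct2, of z], of "2 * C"] C by (simp add: D_def)
    qed (use ig in simp)
    finally show ?thesis by (simp add: f2)
  qed
  have "entropy_functional ?P (\<lambda>x. exp (l * g x)) \<le> (\<Sum>i<n. \<integral>x. D i x \<partial>?P)"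
  proof (rule entropy_functional_tensorization[OF \<mu>(1), where a = "exp (- b)" and b = "exp b"
        and c = "(C * l\<^sup>2 / 2) * (exp b * L\<^sup>2)"])
    show "(\<lambda>x. exp (l * g x)) \<in> borel_measurable ?P" using gm by measurable
  qed (use hb Db Dm ls in \<open>auto simp: abs_of_nonneg\<close>)
  also have "\<dots> = (\<integral>x. (\<Sum>i<n. D i x) \<partial>?P)"
    using Db Dm by (intro Bochner_Integration.integral_sum[symmetric] 
        P.integrable_bounded[where c = "(C * l\<^sup>2 / 2) * (exp b * L\<^sup>2)"]) (auto simp: abs_of_nonneg)
  also have "\<dots> \<le> (\<integral>x. (C * L\<^sup>2 / 2) * l\<^sup>2 * exp (l * g x) \<partial>?P)"
  proof (rule integral_mono)
    show "integrable ?P (\<lambda>x. \<Sum>i<n. D i x)"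
      using Db Dm by (intro Bochner_Integration.integrable_sum 
        P.integrable_bounded[where c = "(C * l\<^sup>2 / 2) * (exp b * L\<^sup>2)"]) (auto simp: abs_of_nonneg)
    have "integrable ?P (\<lambda>x. exp (l * g x))"
      using hb gm by (intro P.integrable_bounded[of _ "exp b"]) auto
    then show "integrable ?P (\<lambda>x. (C * L\<^sup>2 / 2) * l\<^sup>2 * exp (l * g x))" by simp
    fix x
    have "(\<Sum>i<n. D i x) = (C * l\<^sup>2 / 2) * exp (l * g x) * (\<Sum>i<n. (G i x)\<^sup>2)"
      by (simp add: D_def sum_distrib_left mult.assoc)
    also have "\<dots> \<le> (C * l\<^sup>2 / 2) * exp (l * g x) * L\<^sup>2"
      using GL C by (intro mult_left_mono) auto
    finally show "(\<Sum>i<n. D i x) \<le> (C * L\<^sup>2 / 2) * l\<^sup>2 * exp (l * g x)"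
      by (simp add: mult_ac)
  qed
  finally show ?thesis by simp
qed

text \<open>Herbst's argument covers positive \<open>l\<close>; negative \<open>l\<close> are
  reached through \<open>- g\<close>. The value \<open>l = - 1\<close> later controls the means of
  truncations.\<close>

lemma laplace_bound_tame:
  fixes \<mu> :: "'a::real_normed_vector measure" and g :: "(nat \<Rightarrow> 'a) \<Rightarrow> real"
  assumes \<mu>: "prob_space \<mu>" "sets \<mu> = sets borel" "log_sobolev \<mu> C" and C: "C \<ge> 0"
    and g: "tame n L g" "\<And>x. \<bar>g x\<bar> \<le> B"
  shows "(\<integral>x. exp (l * g x) \<partial>Pi\<^sub>M {..<n} (\<lambda>_. \<mu>))
      \<le> exp (l * (\<integral>x. g x \<partial>Pi\<^sub>M {..<n} (\<lambda>_. \<mu>)) + C * L\<^sup>2 / 2 * l\<^sup>2)"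
proof -
  let ?P = "Pi\<^sub>M {..<n} (\<lambda>_. \<mu>)"
  interpret P: prob_space ?P by (rule prob_space_PiM) (rule \<mu>(1))
  have sP: "sets ?P = sets (Pi\<^sub>M {..<n} (\<lambda>_. borel))"
    using \<mu>(2) by (intro sets_PiM_cong) auto
  have pos: "(\<integral>x. exp (l * h x) \<partial>?P) \<le> exp (l * (\<integral>x. h x \<partial>?P) + C * L\<^sup>2 / 2 * l\<^sup>2)"
    if h: "tame n L h" "\<And>x. \<bar>h x\<bar> \<le> B" and l: "l > 0" for h l
    using h log_sobolev_tame[OF \<mu> C h] l
    by (intro P.herbst[of _ B]) (auto simp: tame_def measurable_cong_sets[OF sP refl])
  consider "l > 0" | "l = 0" | "l < 0" by linarith
  then show ?thesis
  proof cases
    case 1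
    then show ?thesis using pos g by blast
  next
    case 2
    then show ?thesis by (simp add: P.prob_space)
  next
    case 3
    then show ?thesis using pos[OF tame_uminus[OF g(1)], of "- l"] g(2) by simp
  qed
qed

subsection \<open>Lipschitz functions on the product\<close>

definition l2_dist :: "nat \<Rightarrow> (nat \<Rightarrow> 'a::real_normed_vector) \<Rightarrow> (nat \<Rightarrow> 'a) \<Rightarrow> real" where
  "l2_dist n x y = L2_set (\<lambda>k. norm (x k - y k)) {..<n}"

lemma l2_dist_nonneg: "0 \<le> l2_dist n x y"
  by (simp add: l2_dist_def L2_set_nonneg)

lemma l2_dist_commute: "l2_dist n x y = l2_dist n y x"
  by (simp add: l2_dist_def norm_minus_commute)

lemma l2_dist_triangle: "l2_dist n x z \<le> l2_dist n x y + l2_dist n y z"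
proof -
  have "l2_dist n x z \<le> L2_set (\<lambda>k. norm (x k - y k) + norm (y k - z k)) {..<n}"
    unfolding l2_dist_def by (intro L2_set_mono) (auto intro: norm_diff_triangle_le)
  also have "\<dots> \<le> l2_dist n x y + l2_dist n y z"
    unfolding l2_dist_def by (rule L2_set_triangle_ineq)
  finally show ?thesis .
qed

text \<open>Coordinatewise norming functionals are weighted by the proportions
  \<open>norm (v k - w k) / N\<close>; Cauchy-Schwarz gives the Lipschitz bound. For
  \<open>v = w\<close> division by zero makes all weights 0, so \<open>\<psi>\<close>
  vanishes.\<close>

lemma l2_norming_functional:
  fixes v w :: "nat \<Rightarrow> 'a::real_normed_vector"
  shows "\<exists>\<psi>. (\<forall>c L. 0 \<le> L \<longrightarrow> tame n L (\<lambda>x. c + L * \<psi> x)) \<and>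
    (\<forall>x y. \<bar>\<psi> x - \<psi> y\<bar> \<le> l2_dist n x y) \<and> \<psi> v - \<psi> w = l2_dist n v w \<and> (v = w \<longrightarrow> \<psi> = (\<lambda>_. 0))"
proof -
  define N where "N = l2_dist n v w"
  define a where "a k = norm (v k - w k) / N" for k
  have N0: "0 \<le> N" by (simp add: N_def l2_dist_nonneg)
  have N2: "N\<^sup>2 = (\<Sum>k<n. (norm (v k - w k))\<^sup>2)"
    by (simp add: N_def l2_dist_def L2_set_def sum_nonneg)
  have a0: "0 \<le> a k" for k using N0 by (simp add: a_def)
  \<comment> \<open>The quotient is 1, or 0 when \<open>N = 0\<close>; the bound by 1 covers both
    cases.\<close>
  have "(\<Sum>k<n. (a k)\<^sup>2) = N\<^sup>2 / N\<^sup>2"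
    by (simp add: a_def N2 power_divide flip: sum_divide_distrib)
  then have a1: "(\<Sum>k<n. (a k)\<^sup>2) \<le> 1" by (simp add: divide_le_eq_1)
  have "\<forall>k. \<exists>\<phi>. bounded_linear \<phi> \<and> (\<forall>x. \<bar>\<phi> x\<bar> \<le> norm x) \<and> \<phi> (v k - w k) = norm (v k - w k)"
    using norming_functional by metis
  then obtain \<phi> where \<phi>': "\<forall>k. bounded_linear (\<phi> k) \<and> (\<forall>x. \<bar>\<phi> k x\<bar> \<le> norm x) \<and> \<phi> k (v k - w k) = norm (v k - w k)"
    by (rule choice[THEN exE])
  have \<phi>: "bounded_linear (\<phi> k)" "\<bar>\<phi> k x\<bar> \<le> norm x" "\<phi> k (v k - w k) = norm (v k - w k)" for k x
    using \<phi>' by blast+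
  define \<psi> where "\<psi> x = (\<Sum>k<n. a k * \<phi> k (x k))" for x
  have diff: "\<psi> x - \<psi> y = (\<Sum>k<n. a k * \<phi> k (x k - y k))" for x y
    using \<phi>(1) by (simp add: \<psi>_def linear_simps right_diff_distrib flip: sum_subtractf)
  show ?thesis
  proof (intro exI[of _ \<psi>] conjI allI impI)
    fix c L :: real assume L: "0 \<le> L"
    have "tame n L (\<lambda>x. c + (\<Sum>k<n. L * (a k * \<phi> k (x k))))"
    proof (rule tame_affine[where a = "\<lambda>k. L * a k"])
      show "bounded_linear (\<lambda>u. L * (a k * \<phi> k u))" for k
        using \<phi>(1) by (intro bounded_linear_const_mult)
      show "\<bar>L * (a k * \<phi> k u)\<bar> \<le> L * a k * norm u" for k u
        using a0 L \<phi>(2) by (auto simp: abs_mult mult.assoc intro!: mult_left_mono)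
      have "L\<^sup>2 * (\<Sum>k<n. (a k)\<^sup>2) \<le> L\<^sup>2 * 1"
        using a1 by (intro mult_left_mono) auto
      then show "(\<Sum>k<n. (L * a k)\<^sup>2) \<le> L\<^sup>2"
        by (simp add: power_mult_distrib sum_distrib_left)
    qed (use a0 L in auto)
    then show "tame n L (\<lambda>x. c + L * \<psi> x)"
      by (simp add: \<psi>_def sum_distrib_left)
  next
    fix x y
    have "\<bar>\<psi> x - \<psi> y\<bar> \<le> (\<Sum>k<n. \<bar>a k\<bar> * \<bar>norm (x k - y k)\<bar>)"
      unfolding diff using \<phi>(2) by (intro order_trans[OF sum_abs] sum_mono) (auto simp: abs_mult intro!: mult_left_mono)
    also have "\<dots> \<le> L2_set a {..<n} * l2_dist n x y"
      unfolding l2_dist_def by (rule L2_set_mult_ineq)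
    also have "\<dots> \<le> 1 * l2_dist n x y"
      using a1 by (intro mult_right_mono l2_dist_nonneg) (simp add: L2_set_def)
    finally show "\<bar>\<psi> x - \<psi> y\<bar> \<le> l2_dist n x y" by simp
  next
    have "\<psi> v - \<psi> w = N\<^sup>2 / N"
      unfolding diff \<phi>(3) N2 by (simp add: a_def power2_eq_square flip: sum_divide_distrib)
    then show "\<psi> v - \<psi> w = l2_dist n v w"
      by (simp add: N_def[symmetric] power2_eq_square)
  next
    assume "v = w"
    then show "\<psi> = (\<lambda>_. 0)" by (simp add: \<psi>_def a_def fun_eq_iff)
  qed
qed

section \<open>Smooth approximation of bounded Lipschitz functions\<close>

lemma softmax_ge:
  assumes "finite I" "s > 0" "j \<in> I"
  shows "a j \<le> softmax s I a"
proof -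
  have "exp (s * a j) \<le> (\<Sum>i\<in>I. exp (s * a i))"
    using assms by (intro member_le_sum) auto
  then have "ln (exp (s * a j)) \<le> ln (\<Sum>i\<in>I. exp (s * a i))"
    by (intro ln_mono) auto
  then show ?thesis using assms(2) by (simp add: softmax_def field_simps)
qed

lemma softmax_le:
  assumes "finite I" "I \<noteq> {}" "s > 0" "\<And>j. j \<in> I \<Longrightarrow> a j \<le> m"
  shows "softmax s I a \<le> m + ln (card I) / s"
proof -
  have "(\<Sum>i\<in>I. exp (s * a i)) \<le> (\<Sum>i\<in>I. exp (s * m))"
    using assms by (intro sum_mono) auto
  also have "\<dots> = card I * exp (s * m)" by simp
  finally have "ln (\<Sum>i\<in>I. exp (s * a i)) \<le> ln (card I * exp (s * m))"
    using assms by (intro ln_mono sum_pos) auto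
  also have "\<dots> = ln (card I) + s * m"
    using assms by (simp add: ln_mult card_gt_0_iff)
  finally show ?thesis using assms(3) by (simp add: softmax_def field_simps)
qed

text \<open>With \<open>y\<^sub>0, y\<^sub>1, \<dots>\<close> dense and \<open>\<psi> j i\<close> norming \<open>y\<^sub>i - y\<^sub>j\<close>, the function
  \<open>min R (min\<^sub>j (F y\<^sub>j + L * max\<^sub>i (\<psi> j i (x - y\<^sub>j))))\<close> with \<open>i, j \<le> m\<close> converges to \<open>F x\<close>;
  the extrema are replaced by soft ones.\<close>

lemma tame_approximation:
  fixes F :: "(nat \<Rightarrow> 'a::real_normed_vector) \<Rightarrow> real" and y :: "nat \<Rightarrow> nat \<Rightarrow> 'a"
  assumes F: "\<And>x. 0 \<le> F x \<and> F x \<le> R" and L: "0 \<le> L"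
    and lip: "\<And>x y. F x \<le> F y + L * l2_dist n x y"
  obtains f where "\<And>m. tame n L (f m)" "\<And>m x. \<bar>f m x\<bar> \<le> R + 1"
    "\<And>x. (\<And>e. e > 0 \<Longrightarrow> \<exists>j. l2_dist n x (y j) < e) \<Longrightarrow> (\<lambda>m. f m x) \<longlonglongrightarrow> F x"
proof -
  have R: "0 \<le> R" using F[of undefined] by linarith
  have "\<forall>p. \<exists>\<psi>. (\<forall>c L. 0 \<le> L \<longrightarrow> tame n L (\<lambda>x. c + L * \<psi> x)) \<and>
    (\<forall>x x'. \<bar>\<psi> x - \<psi> x'\<bar> \<le> l2_dist n x x') \<and> \<psi> (y (snd p)) - \<psi> (y (fst p)) = l2_dist n (y (snd p)) (y (fst p)) \<and>
    (y (snd p) = y (fst p) \<longrightarrow> \<psi> = (\<lambda>_. 0))"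
    by (intro allI l2_norming_functional)
  then obtain \<Psi> where \<Psi>: "\<forall>p. (\<forall>c L. 0 \<le> L \<longrightarrow> tame n L (\<lambda>x. c + L * \<Psi> p x)) \<and>
    (\<forall>x x'. \<bar>\<Psi> p x - \<Psi> p x'\<bar> \<le> l2_dist n x x') \<and>
    \<Psi> p (y (snd p)) - \<Psi> p (y (fst p)) = l2_dist n (y (snd p)) (y (fst p)) \<and>
    (y (snd p) = y (fst p) \<longrightarrow> \<Psi> p = (\<lambda>_. 0))"
    by (rule choice[THEN exE])
  define \<psi> where "\<psi> j i = \<Psi> (j, i)" for j i :: nat
  have \<psi>: "tame n L (\<lambda>x. c + L * \<psi> j i x)" "\<bar>\<psi> j i x - \<psi> j i x'\<bar> \<le> l2_dist n x x'"
    "\<psi> j i (y i) - \<psi> j i (y j) = l2_dist n (y i) (y j)" "\<psi> j j x = 0" for c j i x x'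
    using \<Psi>[rule_format, of "(j, i)"] \<Psi>[rule_format, of "(j, j)"] L by (simp_all add: \<psi>_def)
  \<comment> \<open>A soft extremum here has at most \<open>m + 2\<close> arguments, and
    \<open>ln k \<le> k - 1\<close>; with this sharpness its error is at most
    \<open>1 / (m + 1)\<close>.\<close>
  define s where "s m = (real m + 1)\<^sup>2" for m :: nat
  define t where "t j x i = F (y j) + L * (\<psi> j i x - \<psi> j i (y j))" for j x and i :: nat
  define M where "M m j x = softmax (s m) {..m} (t j x)" for m j x
  \<comment> \<open>The index \<open>None\<close> carries the cap \<open>R\<close>. A soft minimum
    is the negated soft maximum of the negated arguments, whence the signs in \<open>u\<close> and
    \<open>f\<close>.\<close>
  define I where "I m = insert None (Some ` {..m})" for m :: nat
  define u where "u m x i = (case i of None \<Rightarrow> - R | Some j \<Rightarrow> - M m j x)" for m x i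
  define f where "f m x = - softmax (s m) (I m) (u m x)" for m x
  have s: "s m > 0" for m by (simp add: s_def)
  have ln_s: "ln (real k) / s m \<le> 1 / (real m + 1)" if "1 \<le> k" "k \<le> m + 2" for k m
  proof -
    have "ln (real k) \<le> real k - 1" using that by (intro ln_le_minus_one) auto
    also have "\<dots> \<le> real m + 1" using that by simp
    finally have "ln (real k) / s m \<le> (real m + 1) / s m"
      using s[of m] by (intro divide_right_mono) auto
    then show ?thesis by (simp add: s_def power2_eq_square)
  qed
  have e1: "1 / (real m + 1) \<le> 1" for m by (simp add: field_simps)
  have I: "finite (I m)" "I m \<noteq> {}" "card (I m) = m + 2" for m
  proof -
    show "card (I m) = m + 2"
      unfolding I_def by (subst card_insert_disjoint) (auto simp: card_image)
  qed (auto simp: I_def)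
  have M_le: "M m j x \<le> F (y j) + L * l2_dist n x (y j) + 1 / (real m + 1)" for m j x
  proof -
    have "M m j x \<le> (F (y j) + L * l2_dist n x (y j)) + ln (card {..m}) / s m"
      unfolding M_def
    proof (rule softmax_le)
      show "t j x i \<le> F (y j) + L * l2_dist n x (y j)" for i
        unfolding t_def using \<psi>(2)[of j i x "y j"] L by (auto intro!: mult_left_mono)
    qed (use s in auto)
    then show ?thesis using ln_s[of "card {..m}" m] by simp
  qed
  have M_ge: "t j x i \<le> M m j x" if "i \<le> m" for m j x i
    unfolding M_def using s that by (intro softmax_ge) auto
  \<comment> \<open>The index \<open>i = j\<close> contributes \<open>F (y j)\<close>, because
    \<open>\<psi> j j\<close> vanishes; this bounds the approximants from below.\<close>
  have M0: "0 \<le> M m j x" if "j \<le> m" for m j x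
    using M_ge[OF that, of j x] F[of "y j"] by (simp add: t_def \<psi>(4))
  have f_le: "f m x \<le> - u m x i" if "i \<in> I m" for m x i
    unfolding f_def using softmax_ge[OF I(1) s that, of "u m x"] by simp
  have f_ge: "- b - 1 / (real m + 1) \<le> f m x" if "\<And>i. i \<in> I m \<Longrightarrow> u m x i \<le> b" for m x b
    unfolding f_def using softmax_le[OF I(1)[of m] I(2)[of m] s[of m], where a = "u m x" and m = b, OF that] ln_s[of "m + 2" m] by (simp add: I(3))
  show ?thesis
  proof (rule that)
    fix m
    have "tame n L (\<lambda>x. F (y j) - L * \<psi> j i (y j) + L * \<psi> j i x)" for i j
      by (rule \<psi>(1))
    then have "tame n L (\<lambda>x. t j x i)" for i j
      by (simp add: t_def algebra_simps)
    then have "tame n L (\<lambda>x. M m j x)" for j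
      unfolding M_def using s by (intro tame_softmax) auto
    then have "tame n L (\<lambda>x. u m x i)" for i
      unfolding u_def by (cases i) (auto intro: tame_const tame_uminus)
    then show "tame n L (f m)"
      unfolding f_def[abs_def] using s I by (intro tame_uminus tame_softmax)
    fix x
    have "u m x i \<le> 0" if "i \<in> I m" for i
      using that M0 R by (auto simp: u_def I_def)
    from f_ge[OF this] have "- 1 \<le> f m x" using e1[of m] by linarith
    moreover have "f m x \<le> R"
      using f_le[of None m x] by (simp add: I_def u_def)
    ultimately show "\<bar>f m x\<bar> \<le> R + 1" using R by simp
  next
    fix x assume dense: "\<And>e. e > 0 \<Longrightarrow> \<exists>j. l2_dist n x (y j) < e"
    show "(\<lambda>m. f m x) \<longlonglongrightarrow> F x"
    proof (rule LIMSEQ_I)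
      fix r :: real assume r: "r > 0"
      \<comment> \<open>The error \<open>2 * L * d\<close> gets one half of \<open>r\<close> and the
        softness \<open>1 / (m + 1)\<close> the other; \<open>L + 1\<close> in the denominator
        covers \<open>L = 0\<close>.\<close>
      define d where "d = r / (4 * (L + 1))"
      have d: "d > 0" "2 * L * d \<le> r / 2"
        using r L by (auto simp: d_def field_simps)
      obtain i where i: "l2_dist n x (y i) < d" using dense[OF d(1)] by blast
      obtain k :: nat where k: "1 / (real k + 1) < r / 2"
        using r nat_approx_posE[of "r / 2"] by (auto simp: add.commute)
      have "norm (f m x - F x) < r" if m: "max i k \<le> m" for m
      proof -
        have em: "1 / (real m + 1) < r / 2"
          using m by (intro le_less_trans[OF _ k] divide_left_mono) auto
        have Li: "L * l2_dist n x (y i) \<le> L * d" using i L by (intro mult_left_mono) auto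
        have "f m x \<le> M m i x"
          using f_le[of "Some i" m x] m by (simp add: I_def u_def)
        also have "\<dots> \<le> F (y i) + L * d + 1 / (real m + 1)"
          using M_le[of m i x] Li by linarith
        also have "F (y i) \<le> F x + L * d"
          using lip[of "y i" x] Li by (simp add: l2_dist_commute)
        finally have up: "f m x \<le> F x + 2 * L * d + 1 / (real m + 1)" by simp
        \<comment> \<open>As \<open>y i\<close> is near \<open>x\<close>, the functional norming
          \<open>y i - y j\<close> almost norms \<open>x - y j\<close>. One \<open>d\<close> is lost
          in replacing \<open>x\<close> by \<open>y i\<close> inside \<open>\<psi> j i\<close>,
          another in the triangle inequality.\<close>
        have "F x - 2 * L * d \<le> M m j x" for j
        proof -
          have "l2_dist n x (y j) - 2 * d \<le> \<psi> j i x - \<psi> j i (y j)"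
            using \<psi>(2)[of j i x "y i"] \<psi>(3)[of j i] l2_dist_triangle[of n x "y j" "y i"] i by linarith
          then have "L * (l2_dist n x (y j) - 2 * d) \<le> L * (\<psi> j i x - \<psi> j i (y j))"
            using L by (intro mult_left_mono)
          then have "F x - 2 * L * d \<le> t j x i"
            using lip[of x "y j"] by (simp add: t_def algebra_simps)
          also have "\<dots> \<le> M m j x" using m by (intro M_ge) auto
          finally show ?thesis .
        qed
        moreover have "0 \<le> 2 * L * d" using L d by simp
        ultimately have "u m x i' \<le> - (F x - 2 * L * d)" if "i' \<in> I m" for i'
          using F[of x] that by (auto simp: u_def I_def simp del: minus_diff_eq)
        from f_ge[OF this] have "F x - 2 * L * d - 1 / (real m + 1) \<le> f m x" by linarith
        then show ?thesis using up em d(2) unfolding real_norm_def abs_less_iff by linarith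
      qed
      then show "\<exists>no. \<forall>m\<ge>no. norm (f m x - F x) < r" by blast
    qed
  qed
qed

text \<open>Almost every point of the product has all its coordinates in the closure of one
  countable set \<open>D\<close>, and the functions from \<open>{..<n}\<close> to \<open>D\<close>
  are countably many.\<close>

lemma countable_approx_product:
  fixes \<mu> :: "'a::real_normed_vector measure"
  assumes \<mu>: "prob_space \<mu>" and D: "separably_supported \<mu>"
  obtains y :: "nat \<Rightarrow> nat \<Rightarrow> 'a" where
    "AE x in Pi\<^sub>M {..<n} (\<lambda>_. \<mu>). \<forall>e>0. \<exists>j. l2_dist n x (y j) < e"
proof -
  interpret \<mu>: prob_space \<mu> by fact
  obtain D where D: "countable D" "AE x in \<mu>. x \<in> closure D"
    using D unfolding separably_supported_def by blast
  have "D \<noteq> {}"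
    using D(2) \<mu>.AE_False by auto
  define Y where "Y = PiE {..<n} (\<lambda>_. D)"
  have Y: "countable Y" "Y \<noteq> {}"
    using D(1) \<open>D \<noteq> {}\<close> by (auto simp: Y_def PiE_eq_empty_iff intro: countable_PiE)
  have "AE x in Pi\<^sub>M {..<n} (\<lambda>_. \<mu>). \<forall>i\<in>{..<n}. x i \<in> closure D"
    using D(2) \<mu> by (intro AE_finite_allI AE_PiM_component) auto
  then have "AE x in Pi\<^sub>M {..<n} (\<lambda>_. \<mu>). \<forall>e>0. \<exists>j. l2_dist n x (from_nat_into Y j) < e"
  proof eventually_elim
    case (elim x)
    show ?case
    proof (intro allI impI)
      fix e :: real assume e: "e > 0"
      \<comment> \<open>With \<open>real n + 1\<close> in the denominator, the \<open>n\<close>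
        errors sum to strictly less than \<open>e\<close>, also for \<open>n = 0\<close>.\<close>
      then have "\<forall>i\<in>{..<n}. \<exists>d\<in>D. dist d (x i) < e / (real n + 1)"
        using elim by (auto simp: closure_approachable)
      then obtain d where d: "\<And>i. i < n \<Longrightarrow> d i \<in> D \<and> dist (d i) (x i) < e / (real n + 1)"
        by (metis lessThan_iff)
      define y where "y = restrict d {..<n}"
      have "y \<in> Y" using d by (auto simp: y_def Y_def)
      then obtain j where j: "from_nat_into Y j = y"
        using Y from_nat_into_surj by metis
      have "l2_dist n x y \<le> (\<Sum>k<n. norm (x k - y k))"
        unfolding l2_dist_def by (rule L2_set_le_sum) auto
      also have "\<dots> \<le> (\<Sum>k<n. e / (real n + 1))"
        using d by (intro sum_mono less_imp_le) (simp add: y_def dist_norm norm_minus_commute)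
      also have "\<dots> < e"
        using e by (simp add: field_simps)
      finally show "\<exists>j. l2_dist n x (from_nat_into Y j) < e"
        using j by blast
    qed
  qed
  then show ?thesis by (rule that)
qed

section \<open>Laplace transforms and tails of Lipschitz functions\<close>

lemma integrable_LIMSEQ_le:
  fixes f :: "nat \<Rightarrow> 'a \<Rightarrow> real"
  assumes f: "\<And>k. integrable M (f k)" "\<And>k x. 0 \<le> f k x" "\<And>x. x \<in> space M \<Longrightarrow> (\<lambda>k. f k x) \<longlonglongrightarrow> g x"
    and le: "\<And>k. (\<integral>x. f k x \<partial>M) \<le> m"
  shows "integrable M g" "(\<integral>x. g x \<partial>M) \<le> m"
proof -
  have [measurable]: "f k \<in> borel_measurable M" for k using f(1) by simp
  have g: "g \<in> borel_measurable M"
    by (rule borel_measurable_LIMSEQ_real[OF f(3)]) auto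
  have g0: "0 \<le> g x" if "x \<in> space M" for x
    using LIMSEQ_le_const[OF f(3)[OF that]] f(2) by blast
  have "0 \<le> (\<integral>x. f 0 x \<partial>M)" using f(2) by simp
  then have m: "0 \<le> m" using le[of 0] by linarith
  \<comment> \<open>Fatou's lemma turns the uniform bound on the approximants into integrability of
    the limit, which is not known beforehand.\<close>
  have "(\<integral>\<^sup>+ x. g x \<partial>M) = (\<integral>\<^sup>+ x. liminf (\<lambda>k. ennreal (f k x)) \<partial>M)"
    using f(3) by (intro nn_integral_cong lim_imp_Liminf[symmetric] tendsto_ennrealI) auto
  also have "\<dots> \<le> liminf (\<lambda>k. \<integral>\<^sup>+ x. ennreal (f k x) \<partial>M)"
    by (intro nn_integral_liminf) measurable
  also have "\<dots> = liminf (\<lambda>k. ennreal (\<integral>x. f k x \<partial>M))"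
    using f by (simp add: nn_integral_eq_integral)
  also have "\<dots> \<le> liminf (\<lambda>k::nat. ennreal m)"
    using le by (intro Liminf_mono) (auto intro!: always_eventually ennreal_leI)
  also have "\<dots> = ennreal m" by (simp add: Liminf_const)
  finally have *: "(\<integral>\<^sup>+ x. g x \<partial>M) \<le> ennreal m" .
  show i: "integrable M g"
    using g g0 * by (intro integrableI_nonneg) (auto intro: le_less_trans)
  show "(\<integral>x. g x \<partial>M) \<le> m"
    using * nn_integral_eq_integral[OF i] g0 m by (simp add: ennreal_le_iff)
qed

text \<open>The approximants share the constant \<open>L\<close> and the bound \<open>R + 1\<close>
  and converge almost everywhere, so dominated convergence passes to the limit on both sides without
  loss in the exponent.\<close>

lemma laplace_bound_bounded_lipschitz:
  fixes \<mu> :: "'a::real_normed_vector measure" and F :: "(nat \<Rightarrow> 'a) \<Rightarrow> real"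
  assumes \<mu>: "prob_space \<mu>" "sets \<mu> = sets borel" "log_sobolev \<mu> C" and D: "separably_supported \<mu>"
    and C: "C \<ge> 0" and L: "L \<ge> 0"
    and F: "\<And>x. 0 \<le> F x \<and> F x \<le> R" "\<And>x y. F x \<le> F y + L * l2_dist n x y"
    and Fm: "F \<in> borel_measurable (Pi\<^sub>M {..<n} (\<lambda>_. \<mu>))"
  shows "(\<integral>x. exp (l * F x) \<partial>Pi\<^sub>M {..<n} (\<lambda>_. \<mu>))
      \<le> exp (l * (\<integral>x. F x \<partial>Pi\<^sub>M {..<n} (\<lambda>_. \<mu>)) + C * L\<^sup>2 / 2 * l\<^sup>2)"
proof -
  let ?P = "Pi\<^sub>M {..<n} (\<lambda>_. \<mu>)"
  interpret P: prob_space ?P by (rule prob_space_PiM) (rule \<mu>(1))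
  have sP: "sets ?P = sets (Pi\<^sub>M {..<n} (\<lambda>_. borel))"
    using \<mu>(2) by (intro sets_PiM_cong) auto
  obtain y :: "nat \<Rightarrow> nat \<Rightarrow> 'a" where y: "AE x in ?P. \<forall>e>0. \<exists>j. l2_dist n x (y j) < e"
    by (rule countable_approx_product[OF \<mu>(1) D])
  obtain f where f: "\<And>m. tame n L (f m)" "\<And>m x. \<bar>f m x\<bar> \<le> R + 1"
    "\<And>x. (\<And>e. e > 0 \<Longrightarrow> \<exists>j. l2_dist n x (y j) < e) \<Longrightarrow> (\<lambda>m. f m x) \<longlonglongrightarrow> F x"
    by (rule tame_approximation[where y = y, OF F(1) L F(2)]) blast
  have fm: "f m \<in> borel_measurable ?P" for m
    using f(1)[of m] by (simp add: tame_def measurable_cong_sets[OF sP refl])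
  have lim: "AE x in ?P. (\<lambda>m. f m x) \<longlonglongrightarrow> F x"
    using y f(3) by auto
  have b: "norm (exp (l * f m x)) \<le> exp (\<bar>l\<bar> * (R + 1))" for m x
  proof -
    have "\<bar>l * f m x\<bar> \<le> \<bar>l\<bar> * (R + 1)"
      unfolding abs_mult using f(2) by (intro mult_left_mono) auto
    then show ?thesis by simp
  qed
  have "(\<lambda>m. \<integral>x. exp (l * f m x) \<partial>?P) \<longlonglongrightarrow> (\<integral>x. exp (l * F x) \<partial>?P)"
  proof (rule integral_dominated_convergence[where w = "\<lambda>_. exp (\<bar>l\<bar> * (R + 1))"])
    show "AE x in ?P. (\<lambda>m. exp (l * f m x)) \<longlonglongrightarrow> exp (l * F x)"
      using lim by eventually_elim (intro tendsto_intros)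
  qed (use b fm Fm in auto)
  moreover have "(\<lambda>m. \<integral>x. f m x \<partial>?P) \<longlonglongrightarrow> (\<integral>x. F x \<partial>?P)"
    by (rule integral_dominated_convergence[where w = "\<lambda>_. R + 1"]) (use lim f(2) fm Fm in auto)
  then have "(\<lambda>m. exp (l * (\<integral>x. f m x \<partial>?P) + C * L\<^sup>2 / 2 * l\<^sup>2))
      \<longlonglongrightarrow> exp (l * (\<integral>x. F x \<partial>?P) + C * L\<^sup>2 / 2 * l\<^sup>2)"
    by (intro tendsto_intros)
  ultimately show ?thesis
    using laplace_bound_tame[OF \<mu> C f(1,2)] by (intro LIMSEQ_le) auto
qed

text \<open>The truncations of \<open>F\<close> have uniformly bounded means: the bound on their Laplace transform at \<open>-1\<close>
  controls the mean by any level that \<open>F\<close> does not exceed with probability \<open>1/2\<close>.\<close>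

lemma laplace_bound_lipschitz:
  fixes \<mu> :: "'a::real_normed_vector measure" and F :: "(nat \<Rightarrow> 'a) \<Rightarrow> real"
  assumes \<mu>: "prob_space \<mu>" "sets \<mu> = sets borel" "log_sobolev \<mu> C" and D: "separably_supported \<mu>"
    and C: "C \<ge> 0" and L: "L \<ge> 0"
    and F: "\<And>x. 0 \<le> F x" "\<And>x y. F x \<le> F y + L * l2_dist n x y"
    and Fm[measurable]: "F \<in> borel_measurable (Pi\<^sub>M {..<n} (\<lambda>_. \<mu>))"
  shows "integrable (Pi\<^sub>M {..<n} (\<lambda>_. \<mu>)) F"
    and "0 \<le> l \<Longrightarrow> integrable (Pi\<^sub>M {..<n} (\<lambda>_. \<mu>)) (\<lambda>x. exp (l * F x))"
    and "0 \<le> l \<Longrightarrow> (\<integral>x. exp (l * F x) \<partial>Pi\<^sub>M {..<n} (\<lambda>_. \<mu>))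
      \<le> exp (l * (\<integral>x. F x \<partial>Pi\<^sub>M {..<n} (\<lambda>_. \<mu>)) + C * L\<^sup>2 / 2 * l\<^sup>2)"
proof -
  let ?P = "Pi\<^sub>M {..<n} (\<lambda>_. \<mu>)"
  interpret P: prob_space ?P by (rule prob_space_PiM) (rule \<mu>(1))
  define T where "T k x = min (F x) (real k)" for k x
  have T: "0 \<le> T k x \<and> T k x \<le> real k" "T k x \<le> F x" for k x
    using F(1)[of x] by (auto simp: T_def)
  have Tlip: "T k x \<le> T k y + L * l2_dist n x y" for k x y
    using F(2)[of x y] mult_nonneg_nonneg[OF L l2_dist_nonneg[of n x y]] by (auto simp: T_def min_def)
  have Tm[measurable]: "T k \<in> borel_measurable ?P" for k
    unfolding T_def by measurable
  have Tlim: "(\<lambda>k. T k x) \<longlonglongrightarrow> F x" for x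
  proof (rule tendsto_eventually)
    obtain k where "F x \<le> real k" using real_arch_simple by blast
    then show "\<forall>\<^sub>F k in sequentially. T k x = F x"
      unfolding eventually_sequentially T_def by (intro exI[of _ k]) auto
  qed
  have Ti: "integrable ?P (T k)" for k
    using T(1) by (intro P.integrable_bounded[of _ "real k"]) auto
  note lap = laplace_bound_bounded_lipschitz[OF \<mu> D C L T(1) Tlip Tm]
  have inc: "incseq (\<lambda>k. {x \<in> space ?P. F x \<le> real k})"
    by (auto simp: incseq_def)
  have U: "(\<Union>k. {x \<in> space ?P. F x \<le> real k}) = space ?P"
    using real_arch_simple by auto
  have "{x \<in> space ?P. F x \<le> real k} \<in> sets ?P" for k by measurable
  then have "range (\<lambda>k. {x \<in> space ?P. F x \<le> real k}) \<subseteq> sets ?P" by (rule image_subsetI)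
  from P.finite_Lim_measure_incseq[OF this inc]
  have "(\<lambda>k. measure ?P {x \<in> space ?P. F x \<le> real k}) \<longlonglongrightarrow> 1"
    unfolding U P.prob_space .
  then have "\<forall>\<^sub>F k in sequentially. 1 / 2 < measure ?P {x \<in> space ?P. F x \<le> real k}"
    by (rule order_tendstoD) simp
  then obtain r :: nat where r: "1 / 2 < measure ?P {x \<in> space ?P. F x \<le> real r}"
    by (auto simp: eventually_sequentially)
  have "(\<integral>x. T k x \<partial>?P) \<le> real r + ln 2 + C * L\<^sup>2 / 2" for k
  proof -
    let ?A = "{x \<in> space ?P. F x \<le> real r}"
    have A: "?A \<in> sets ?P" by measurable
    have "exp (- real r) * (1 / 2) \<le> exp (- real r) * measure ?P ?A"
      using r by (intro mult_left_mono) auto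
    also have "\<dots> = (\<integral>x. exp (- real r) * indicator ?A x \<partial>?P)"
      using A by simp
    also have "\<dots> \<le> (\<integral>x. exp ((- 1) * T k x) \<partial>?P)"
    proof (rule integral_mono)
      show "integrable ?P (\<lambda>x. exp (- real r) * indicator ?A x)"
        using A by (intro P.integrable_bounded[of _ 1]) (auto split: split_indicator)
      show "integrable ?P (\<lambda>x. exp ((- 1) * T k x))"
        using T(1) by (intro P.integrable_bounded[of _ 1]) auto
      show "exp (- real r) * indicator ?A x \<le> exp ((- 1) * T k x)" for x
        using T(2)[of k x] by (auto split: split_indicator)
    qed
    also have "\<dots> \<le> exp ((- 1) * (\<integral>x. T k x \<partial>?P) + C * L\<^sup>2 / 2 * (- 1)\<^sup>2)"
      by (rule lap)
    finally have "ln (exp (- real r) * (1 / 2)) \<le> ln (exp ((- 1) * (\<integral>x. T k x \<partial>?P) + C * L\<^sup>2 / 2 * (- 1)\<^sup>2))"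
      by (intro ln_mono) auto
    then show ?thesis by (simp add: ln_mult ln_div)
  qed
  then show iF: "integrable ?P F"
    using Ti T Tlim by (intro integrable_LIMSEQ_le(1)[of ?P T F]) auto
  assume l: "0 \<le> l"
  have m: "(\<integral>x. exp (l * T k x) \<partial>?P) \<le> exp (l * (\<integral>x. F x \<partial>?P) + C * L\<^sup>2 / 2 * l\<^sup>2)" for k
  proof -
    have "(\<integral>x. T k x \<partial>?P) \<le> (\<integral>x. F x \<partial>?P)"
      using Ti iF T(2) by (intro integral_mono)
    then have "l * (\<integral>x. T k x \<partial>?P) \<le> l * (\<integral>x. F x \<partial>?P)" using l by (intro mult_left_mono)
    then have "exp (l * (\<integral>x. T k x \<partial>?P) + C * L\<^sup>2 / 2 * l\<^sup>2) \<le> exp (l * (\<integral>x. F x \<partial>?P) + C * L\<^sup>2 / 2 * l\<^sup>2)" by simp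
    then show ?thesis using lap[of l k] by (rule order_trans[rotated])
  qed
  have "integrable ?P (\<lambda>x. exp (l * T k x))" for k
    using T(1) l by (intro P.integrable_bounded[of _ "exp (l * real k)"]) (auto intro!: mult_left_mono)
  moreover have "(\<lambda>k. exp (l * T k x)) \<longlonglongrightarrow> exp (l * F x)" for x
    using Tlim by (intro tendsto_intros)
  ultimately show "integrable ?P (\<lambda>x. exp (l * F x))"
    and "(\<integral>x. exp (l * F x) \<partial>?P) \<le> exp (l * (\<integral>x. F x \<partial>?P) + C * L\<^sup>2 / 2 * l\<^sup>2)"
    using integrable_LIMSEQ_le[of ?P "\<lambda>k x. exp (l * T k x)" "\<lambda>x. exp (l * F x)", OF _ _ _ m] by auto
qed

lemma chernoff_lipschitz:
  fixes \<mu> :: "'a::real_normed_vector measure" and F :: "(nat \<Rightarrow> 'a) \<Rightarrow> real"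
  assumes \<mu>: "prob_space \<mu>" "sets \<mu> = sets borel" "log_sobolev \<mu> C" and D: "separably_supported \<mu>"
    and C: "C > 0" and L: "L > 0"
    and F: "\<And>x. 0 \<le> F x" "\<And>x y. F x \<le> F y + L * l2_dist n x y"
    and Fm[measurable]: "F \<in> borel_measurable (Pi\<^sub>M {..<n} (\<lambda>_. \<mu>))"
    and t: "t > 0"
  shows "measure (Pi\<^sub>M {..<n} (\<lambda>_. \<mu>))
      {x \<in> space (Pi\<^sub>M {..<n} (\<lambda>_. \<mu>)). (\<integral>x. F x \<partial>Pi\<^sub>M {..<n} (\<lambda>_. \<mu>)) + t \<le> F x}
      \<le> exp (- (t\<^sup>2 / (2 * C * L\<^sup>2)))"
proof -
  let ?P = "Pi\<^sub>M {..<n} (\<lambda>_. \<mu>)"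
  interpret P: prob_space ?P by (rule prob_space_PiM) (rule \<mu>(1))
  define E where "E = (\<integral>x. F x \<partial>?P)"
  \<comment> \<open>The minimizer of the Chernoff exponent
    \<open>C * L\<^sup>2 / 2 * l\<^sup>2 - l * t\<close>.\<close>
  define l where "l = t / (C * L\<^sup>2)"
  let ?A = "{x \<in> space ?P. E + t \<le> F x}"
  have l: "l > 0" using t C L by (simp add: l_def)
  note lap = laplace_bound_lipschitz(2,3)[OF \<mu> D less_imp_le[OF C] less_imp_le[OF L] F Fm less_imp_le[OF l]]
  have A: "?A \<in> sets ?P" by measurable
  have "exp (l * (E + t)) * measure ?P ?A = (\<integral>x. exp (l * (E + t)) * indicator ?A x \<partial>?P)"
    using A by simp
  also have "\<dots> \<le> (\<integral>x. exp (l * F x) \<partial>?P)"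
  proof (rule integral_mono)
    show "integrable ?P (\<lambda>x. exp (l * (E + t)) * indicator ?A x)"
      using A by (intro P.integrable_bounded[of _ "exp (l * (E + t))"]) (auto split: split_indicator)
    show "exp (l * (E + t)) * indicator ?A x \<le> exp (l * F x)" for x
      using l by (auto split: split_indicator)
  qed (rule lap(1))
  also have "\<dots> \<le> exp (l * E + C * L\<^sup>2 / 2 * l\<^sup>2)"
    unfolding E_def by (rule lap(2))
  also have "\<dots> = exp (l * (E + t)) * exp (- (t\<^sup>2 / (2 * C * L\<^sup>2)))"
  proof -
    have "l * E + C * L\<^sup>2 / 2 * l\<^sup>2 = l * (E + t) + - (t\<^sup>2 / (2 * C * L\<^sup>2))"
      using C L by (simp add: l_def field_simps power2_eq_square)
    then show ?thesis by (simp only: exp_add)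
  qed
  finally show ?thesis by (simp add: E_def)
qed

subsection \<open>The Wasserstein distance to an empirical measure\<close>

text \<open>Convexity of the power on the closed half line; if \<open>s\<close> or \<open>t\<close>
  is 0, it reduces to \<open>\<theta> powr p \<le> \<theta>\<close> on the unit interval.\<close>

lemma powr_convex_combination:
  fixes s t \<theta> p :: real
  assumes "1 \<le> p" "0 \<le> s" "0 \<le> t" "0 \<le> \<theta>" "\<theta> \<le> 1"
  shows "(\<theta> * s + (1 - \<theta>) * t) powr p \<le> \<theta> * s powr p + (1 - \<theta>) * t powr p"
proof -
  have le: "\<theta> powr p \<le> \<theta>" if "0 \<le> \<theta>" "\<theta> \<le> 1" for \<theta> :: real
    using powr_mono'[of 1 p \<theta>] that assms(1) by (cases "\<theta> = 0") auto
  consider "s = 0" | "t = 0" | "s > 0" "t > 0" using assms by fastforce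
  then show ?thesis
  proof cases
    case 1
    then show ?thesis
      using le[of "1 - \<theta>"] assms by (simp add: powr_mult mult_right_mono)
  next
    case 2
    then show ?thesis
      using le[of \<theta>] assms by (simp add: powr_mult mult_right_mono)
  next
    case 3
    then show ?thesis
      using convex_onD[OF powr_convex[OF assms(1)], of "1 - \<theta>" s t] assms by simp
  qed
qed

text \<open>With \<open>\<theta> = A / (A + B)\<close> the sum \<open>a x + b x\<close> is a convex
  combination of \<open>a x\<close> and \<open>b x\<close> rescaled to the common bound
  \<open>A + B\<close>; convexity of the power is then integrated. Positive upper bounds
  \<open>A\<close> and \<open>B\<close> in place of the norms keep the rescaling meaningful.\<close>

lemma minkowski_nn_integral:
  fixes a b :: "'a \<Rightarrow> real"
  assumes [measurable]: "a \<in> borel_measurable M" "b \<in> borel_measurable M"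
    and nn: "\<And>x. 0 \<le> a x" "\<And>x. 0 \<le> b x" and p: "1 \<le> p" and AB: "0 < A" "0 < B"
    and A: "(\<integral>\<^sup>+ x. ennreal (a x powr p) \<partial>M) \<le> ennreal (A powr p)"
    and B: "(\<integral>\<^sup>+ x. ennreal (b x powr p) \<partial>M) \<le> ennreal (B powr p)"
  shows "(\<integral>\<^sup>+ x. ennreal ((a x + b x) powr p) \<partial>M) \<le> ennreal ((A + B) powr p)"
proof -
  define \<theta> where "\<theta> = A / (A + B)"
  have \<theta>: "0 \<le> \<theta>" "\<theta> \<le> 1" "1 - \<theta> = B / (A + B)"
    using AB by (auto simp: \<theta>_def field_simps)
  define c where "c = \<theta> * ((A + B) powr p / A powr p)"
  define d where "d = (1 - \<theta>) * ((A + B) powr p / B powr p)"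
  have cd: "0 \<le> c" "0 \<le> d" "c * A powr p + d * B powr p = (A + B) powr p"
  proof -
    have "c * A powr p = \<theta> * (A + B) powr p" "d * B powr p = (1 - \<theta>) * (A + B) powr p"
      using AB by (simp_all add: c_def d_def)
    then show "c * A powr p + d * B powr p = (A + B) powr p" by (simp add: algebra_simps)
    show "0 \<le> c" "0 \<le> d"
      unfolding c_def d_def using \<theta>(1,2) by (intro mult_nonneg_nonneg divide_nonneg_nonneg; simp)+
  qed
  have le: "(a x + b x) powr p \<le> c * a x powr p + d * b x powr p" for x
  proof -
    have e: "\<theta> * (a x / A * (A + B)) + (1 - \<theta>) * (b x / B * (A + B)) = a x + b x"
      unfolding \<theta>(3) using AB by (simp add: \<theta>_def)
    have "(\<theta> * (a x / A * (A + B)) + (1 - \<theta>) * (b x / B * (A + B))) powr p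
        \<le> \<theta> * (a x / A * (A + B)) powr p + (1 - \<theta>) * (b x / B * (A + B)) powr p"
      using nn AB \<theta> p by (intro powr_convex_combination) auto
    also have "(a x / A * (A + B)) powr p = a x powr p * ((A + B) powr p / A powr p)"
      using nn AB by (simp add: powr_mult powr_divide)
    also have "(b x / B * (A + B)) powr p = b x powr p * ((A + B) powr p / B powr p)"
      using nn AB by (simp add: powr_mult powr_divide)
    finally show ?thesis unfolding e by (simp add: c_def d_def mult_ac)
  qed
  have "(\<integral>\<^sup>+ x. ennreal ((a x + b x) powr p) \<partial>M)
      \<le> (\<integral>\<^sup>+ x. ennreal c * ennreal (a x powr p) + ennreal d * ennreal (b x powr p) \<partial>M)"
    using le cd by (intro nn_integral_mono) (auto simp flip: ennreal_mult ennreal_plus intro!: ennreal_leI)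
  also have "\<dots> = ennreal c * (\<integral>\<^sup>+ x. ennreal (a x powr p) \<partial>M) + ennreal d * (\<integral>\<^sup>+ x. ennreal (b x powr p) \<partial>M)"
    by (subst nn_integral_add) (auto simp: nn_integral_cmult)
  also have "\<dots> \<le> ennreal c * ennreal (A powr p) + ennreal d * ennreal (B powr p)"
    using A B by (intro add_mono mult_left_mono) auto
  also have "\<dots> = ennreal ((A + B) powr p)"
    using cd by (simp flip: ennreal_mult ennreal_plus)
  finally show ?thesis .
qed

lemma ennpowr_le:
  assumes p: "1 \<le> p" and "a \<le> ennreal (A powr p)" "0 \<le> A"
  shows "ennpowr a (1 / p) \<le> ennreal A"
proof -
  have "a \<noteq> \<top>" using assms(2) by (auto simp: top_unique)
  moreover have "enn2real a \<le> A powr p"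
    using enn2real_mono[OF assms(2)] by simp
  then have "enn2real a powr (1 / p) \<le> (A powr p) powr (1 / p)"
    using p by (intro powr_mono2) auto
  then have "enn2real a powr (1 / p) \<le> A"
    using p assms(3) by (simp add: powr_powr)
  ultimately show ?thesis by (auto simp: ennpowr_def intro: ennreal_leI)
qed

lemma le_ennpowr:
  assumes p: "1 \<le> p" and "a \<noteq> \<top>"
  shows "a = ennreal (enn2real (ennpowr a (1 / p)) powr p)" "ennpowr a (1 / p) \<noteq> \<top>"
  using assms by (auto simp: ennpowr_def powr_powr ennreal_enn2real_if)

text \<open>The origin of \<open>max 2 p\<close>. For \<open>p \<ge> 2\<close> every
  \<open>d k\<close> is at most the \<open>l2\<close> norm, and averaging contributes
  \<open>n powr (- 1 / p)\<close>. For \<open>p < 2\<close> the power mean inequality contributes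
  \<open>n powr (- 1 / 2)\<close>.\<close>

lemma lp_le_l2:
  fixes d :: "nat \<Rightarrow> real"
  assumes d: "\<And>k. 0 \<le> d k" and p: "1 \<le> p" and n: "1 \<le> n"
  shows "(\<Sum>k<n. d k powr p) / n \<le> (n powr (- 1 / max 2 p) * L2_set d {..<n}) powr p"
proof -
  define S where "S = L2_set d {..<n}"
  have S0: "0 \<le> S" by (simp add: S_def L2_set_nonneg)
  have S2: "S\<^sup>2 = (\<Sum>k<n. (d k)\<^sup>2)" by (simp add: S_def L2_set_def sum_nonneg)
  have n0: "real n > 0" using n by simp
  show ?thesis
  proof (cases "S = 0")
    case True
    then have "d k = 0" if "k < n" for k
      using member_le_L2_set[of "{..<n}" k d] d[of k] that by (simp add: S_def)
    then show ?thesis by simp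
  next
    case False
    with S0 have S: "S > 0" by simp
    show ?thesis
    proof (cases "2 \<le> p")
      case True
      have "d k powr p \<le> (d k)\<^sup>2 * S powr (p - 2)" if "k < n" for k
      proof (cases "d k = 0")
        case False
        with d[of k] have dk: "d k > 0" by simp
        have "d k \<le> S" using member_le_L2_set[of "{..<n}" k d] that by (simp add: S_def)
        then have "d k powr (p - 2) \<le> S powr (p - 2)"
          using True dk by (intro powr_mono2) auto
        then have "d k powr 2 * d k powr (p - 2) \<le> d k powr 2 * S powr (p - 2)"
          by (intro mult_left_mono) auto
        also have "d k powr 2 * d k powr (p - 2) = d k powr p" by (simp flip: powr_add)
        also have "d k powr 2 = (d k)\<^sup>2" using dk by simp
        finally show ?thesis .
      qed auto
      then have "(\<Sum>k<n. d k powr p) \<le> (\<Sum>k<n. (d k)\<^sup>2 * S powr (p - 2))"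
        by (intro sum_mono) auto
      also have "\<dots> = S\<^sup>2 * S powr (p - 2)"
        by (simp add: S2 sum_distrib_right)
      also have "\<dots> = S powr p"
        using S by (simp flip: powr_add powr_numeral)
      finally have "(\<Sum>k<n. d k powr p) / n \<le> S powr p / n"
        using n0 by (intro divide_right_mono) auto
      also have "\<dots> = (n powr (- 1 / max 2 p) * S) powr p"
      proof -
        have "(n powr (- 1 / max 2 p)) powr p = n powr (- 1)"
          unfolding powr_powr using True by (simp add: max_def)
        also have "\<dots> = 1 / n" using n0 by (simp add: powr_minus_divide)
        finally show ?thesis using S by (simp add: powr_mult)
      qed
      finally show ?thesis by (simp add: S_def)
    next
      case False
      \<comment> \<open>Young's inequality is applied to \<open>(d k)\<^sup>2\<close> and this mean
        square with weights \<open>p / 2\<close> and \<open>1 - p / 2\<close>; summed over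
        \<open>k\<close>, its right side is exactly \<open>n * m2\<close>.\<close>
      define m2 where "m2 = S\<^sup>2 / n"
      have m2: "m2 > 0" using S n0 by (simp add: m2_def)
      have "d k powr p * m2 powr (1 - p / 2) \<le> p / 2 * (d k)\<^sup>2 + (1 - p / 2) * m2" for k
      proof (cases "d k = 0")
        case True
        then show ?thesis using m2 \<open>\<not> 2 \<le> p\<close> by simp
      next
        case dk: False
        with d[of k] have "d k > 0" by simp
        then have "((d k)\<^sup>2) powr (p / 2) = d k powr p"
          by (simp add: powr_powr flip: powr_numeral)
        then show ?thesis
          using Youngs_inequality_0[of "p / 2" "1 - p / 2" "(d k)\<^sup>2" m2] p False \<open>d k > 0\<close> m2 by simp
      qed
      then have "(\<Sum>k<n. d k powr p * m2 powr (1 - p / 2)) \<le> (\<Sum>k<n. p / 2 * (d k)\<^sup>2 + (1 - p / 2) * m2)"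
        by (intro sum_mono)
      also have "\<dots> = p / 2 * S\<^sup>2 + (1 - p / 2) * (n * m2)"
        by (simp add: S2 sum.distrib sum_distrib_left)
      also have "\<dots> = n * m2" using n0 by (simp add: m2_def algebra_simps)
      finally have "(\<Sum>k<n. d k powr p) * m2 powr (1 - p / 2) \<le> n * m2"
        by (simp add: sum_distrib_right)
      also have "n * m2 = n * m2 powr (p / 2) * m2 powr (1 - p / 2)"
        using m2 by (simp add: mult.assoc flip: powr_add)
      finally have "(\<Sum>k<n. d k powr p) \<le> n * m2 powr (p / 2)"
        by (rule mult_right_le_imp_le) (use m2 in simp)
      then have "(\<Sum>k<n. d k powr p) / n \<le> m2 powr (p / 2)"
        using n0 by (simp add: field_simps)
      also have "m2 = (n powr (- 1 / 2) * S) powr 2"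
        using n0 S by (simp add: m2_def power_mult_distrib powr_minus_divide powr_half_sqrt power_divide)
      also have "(\<dots>) powr (p / 2) = (n powr (- 1 / max 2 p) * S) powr p"
        using False by (simp add: powr_powr)
      finally show ?thesis by (simp add: S_def)
    qed
  qed
qed

lemma measurable_dist_powr:
  "(\<lambda>(x, y). ennreal (norm (x - y :: 'a::real_normed_vector) powr p)) \<in> borel_measurable borel"
proof -
  have [measurable]: "(\<lambda>w :: 'a \<times> 'a. norm (fst w - snd w)) \<in> borel_measurable borel"
    by (intro borel_measurable_continuous_onI continuous_intros)
  show ?thesis unfolding case_prod_beta by measurable
qed

lemma measurable_fst_snd_borel:
  "fst \<in> borel_measurable (borel :: ('a::real_normed_vector \<times> 'a) measure)"
  "snd \<in> borel_measurable (borel :: ('a::real_normed_vector \<times> 'a) measure)"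
  by (auto intro!: borel_measurable_continuous_onI continuous_intros)

lemma emeasure_distr_nn_integral:
  assumes "f \<in> measurable M N" "E \<in> sets N"
  shows "emeasure (distr M N f) E = (\<integral>\<^sup>+ v. indicator E (f v) \<partial>M)"
proof -
  have "emeasure (distr M N f) E = (\<integral>\<^sup>+ u. indicator E u \<partial>distr M N f)"
    using assms(2) by simp
  also have "\<dots> = (\<integral>\<^sup>+ v. indicator E (f v) \<partial>M)"
    using assms by (intro nn_integral_distr) auto
  finally show ?thesis .
qed

text \<open>Given a coupling \<open>\<xi>\<close> of the empirical measure of \<open>y\<close> with \<open>\<mu>\<close>, the fibre over an atom of
  multiplicity \<open>c\<close> is divided equally among the \<open>c\<close> indices of that atom. This yields a joint law of
  an index \<open>i\<close> and a pair \<open>w\<close> with \<open>fst w = y i\<close>, and replacing \<open>y i\<close> by \<open>x i\<close> gives a coupling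
  for \<open>x\<close>.\<close>

lemma coupling_transfer:
  fixes \<mu> :: "'a::real_normed_vector measure" and x y :: "nat \<Rightarrow> 'a"
  assumes \<xi>: "\<xi> \<in> couplings (empirical_measure n y) \<mu>" and n: "1 \<le> n" and p: "1 \<le> p" and AB: "0 < A" "0 < B"
    and A: "(\<Sum>i<n. norm (x i - y i) powr p) / n \<le> A powr p"
    and B: "(\<integral>\<^sup>+ (u, z). ennreal (norm (u - z) powr p) \<partial>\<xi>) \<le> ennreal (B powr p)"
  shows "\<exists>\<xi>'\<in>couplings (empirical_measure n x) \<mu>.
    (\<integral>\<^sup>+ (u, z). ennreal (norm (u - z) powr p) \<partial>\<xi>') \<le> ennreal ((A + B) powr p)"
proof -
  have \<xi>': "prob_space \<xi>" "sets \<xi> = sets borel" "distr \<xi> borel fst = empirical_measure n y" "distr \<xi> borel snd = \<mu>"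
    using \<xi> by (auto simp: couplings_def)
  interpret \<xi>: prob_space \<xi> by fact
  have fs[measurable]: "fst \<in> borel_measurable \<xi>" "snd \<in> borel_measurable \<xi>"
    using measurable_fst_snd_borel unfolding measurable_cong_sets[OF \<xi>'(2) refl] .
  have n0: "real n > 0" using n by simp
  define c where "c i = card {j. j < n \<and> y j = y i}" for i
  have c: "0 < c i" if "i < n" for i
    unfolding c_def using that by (subst card_gt_0_iff) auto
  define g :: "nat \<Rightarrow> 'a \<times> 'a \<Rightarrow> ennreal" where "g i w = ennreal (1 / c i) * indicator {y i} (fst w)" for i w
  have gm[measurable]: "g i \<in> borel_measurable \<xi>" for i
    unfolding g_def using fs(1) by (intro borel_measurable_times_ennreal measurable_compose[OF fs(1)]) auto
  let ?K = "count_space {..<n} \<Otimes>\<^sub>M \<xi>"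
  \<comment> \<open>The index set is countable, so measurability on the product can be checked index
    by index.\<close>
  have pm: "f \<in> measurable ?K N" if "\<And>i. i < n \<Longrightarrow> (\<lambda>w. f (i, w)) \<in> measurable \<xi> N" for f and N :: "'b measure"
    using that by (intro measurable_pair_measure_countable1) auto
  have Gm: "(\<lambda>(i, w). g i w) \<in> borel_measurable ?K"
    by (rule pm) simp
  define N where "N = density ?K (\<lambda>(i, w). g i w)"
  have NI: "(\<integral>\<^sup>+ v. h v \<partial>N) = (\<Sum>i<n. \<integral>\<^sup>+ w. g i w * h (i, w) \<partial>\<xi>)" if "h \<in> borel_measurable ?K" for h
  proof -
    have "(\<integral>\<^sup>+ v. h v \<partial>N) = (\<integral>\<^sup>+ v. (case v of (i, w) \<Rightarrow> g i w) * h v \<partial>?K)"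
      unfolding N_def using Gm that by (rule nn_integral_density)
    also have "\<dots> = (\<integral>\<^sup>+ i. \<integral>\<^sup>+ w. g i w * h (i, w) \<partial>\<xi> \<partial>count_space {..<n})"
      using Gm that by (subst \<xi>.nn_integral_fst[symmetric]) auto
    also have "\<dots> = (\<Sum>i<n. \<integral>\<^sup>+ w. g i w * h (i, w) \<partial>\<xi>)"
      by (simp add: nn_integral_count_space_finite)
    finally show ?thesis .
  qed
  have gsum: "(\<Sum>i<n. g i w) = 1" if "fst w \<in> y ` {..<n}" for w
  proof -
    from that obtain k where "fst w = y k" "k \<in> {..<n}" by (rule imageE)
    then have k: "k < n" "fst w = y k" by simp_all
    have "(\<Sum>i<n. g i w) = (\<Sum>i\<in>{j. j < n \<and> y j = y k}. ennreal (1 / c k))"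
    proof (rule sum.mono_neutral_cong_right)
      show "g i w = ennreal (1 / c k)" if "i \<in> {j. j < n \<and> y j = y k}" for i
        using that k by (auto simp: g_def c_def)
      show "\<forall>i\<in>{..<n} - {j. j < n \<and> y j = y k}. g i w = 0"
        using k by (auto simp: g_def split: split_indicator)
    qed auto
    also have "\<dots> = of_nat (c k) * ennreal (1 / c k)" by (simp add: c_def)
    also have "\<dots> = 1"
      using c[OF k(1)] by (simp add: ennreal_of_nat_eq_real_of_nat flip: ennreal_mult)
    finally show ?thesis .
  qed
  have gint: "(\<integral>\<^sup>+ w. g i w \<partial>\<xi>) = ennreal (1 / n)" if "i < n" for i
  proof -
    have "(\<integral>\<^sup>+ w. g i w \<partial>\<xi>) = ennreal (1 / c i) * (\<integral>\<^sup>+ u. indicator {y i} u \<partial>distr \<xi> borel fst)"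
      unfolding g_def by (subst nn_integral_distr) (auto simp: nn_integral_cmult)
    also have "\<dots> = ennreal (1 / c i) * ennreal (c i / n)"
    proof -
      have "{y i} \<in> sets (empirical_measure n y)" by (simp add: empirical_measure_def)
      then show ?thesis
        unfolding \<xi>'(3) by (simp add: emeasure_empirical_measure c_def)
    qed
    also have "\<dots> = ennreal (1 / n)"
      using c[OF that] by (simp flip: ennreal_mult)
    finally show ?thesis .
  qed
  \<comment> \<open>The weights \<open>g i w\<close> sum to 1 only where \<open>fst w\<close> is an
    atom; the first marginal gives the atoms full mass.\<close>
  have "emeasure (distr \<xi> borel fst) (y ` {..<n}) = 1"
  proof -
    have "y ` {..<n} \<in> sets borel" by (intro borel_closed finite_imp_closed) auto
    moreover have "{i. i < n \<and> y i \<in> y ` {..<n}} = {..<n}" by auto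
    ultimately show ?thesis
      unfolding \<xi>'(3) using n by (simp add: emeasure_empirical_measure)
  qed
  then have "AE u in distr \<xi> borel fst. u \<in> y ` {..<n}"
    using prob_space.AE_in_set_eq_1[OF \<xi>.prob_space_distr[OF fs(1)], of "y ` {..<n}"]
    by (auto simp: measure_def intro!: borel_closed finite_imp_closed)
  from AE_distrD[OF fs(1) this] have AE1: "AE w in \<xi>. (\<Sum>i<n. g i w) = 1"
    by eventually_elim (rule gsum)
  have total: "(\<Sum>i<n. \<integral>\<^sup>+ w. g i w * h w \<partial>\<xi>) = (\<integral>\<^sup>+ w. h w \<partial>\<xi>)" if [measurable]: "h \<in> borel_measurable \<xi>" for h
  proof -
    have "(\<Sum>i<n. \<integral>\<^sup>+ w. g i w * h w \<partial>\<xi>) = (\<integral>\<^sup>+ w. (\<Sum>i<n. g i w) * h w \<partial>\<xi>)"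
      by (subst nn_integral_sum[symmetric]) (auto simp: sum_distrib_right)
    also have "\<dots> = (\<integral>\<^sup>+ w. h w \<partial>\<xi>)"
      using AE1 by (intro nn_integral_cong_AE) auto
    finally show ?thesis .
  qed
  define T where "T = (\<lambda>(i, w :: 'a \<times> 'a). (x i, snd w))"
  have Tm: "T \<in> measurable ?K borel"
  proof (rule pm)
    fix i
    have "(\<lambda>z. (x i, z)) \<in> borel_measurable borel"
      by (intro borel_measurable_continuous_onI continuous_intros)
    then show "(\<lambda>w. T (i, w)) \<in> borel_measurable \<xi>"
      unfolding T_def using measurable_compose[OF fs(2)] by simp
  qed
  then have TN: "T \<in> measurable N borel"
    by (simp add: N_def)
  define \<xi>2 where "\<xi>2 = distr N borel T"
  have I2: "(\<integral>\<^sup>+ v. h v \<partial>\<xi>2) = (\<Sum>i<n. \<integral>\<^sup>+ w. g i w * h (x i, snd w) \<partial>\<xi>)" if "h \<in> borel_measurable borel" for h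
    unfolding \<xi>2_def using NI[OF measurable_compose[OF Tm that]]
    by (simp add: nn_integral_distr[OF TN] that) (simp add: T_def)
  have s2: "sets \<xi>2 = sets borel" "space \<xi>2 = UNIV"
    by (simp_all add: \<xi>2_def)
  have fs2: "fst \<in> borel_measurable \<xi>2" "snd \<in> borel_measurable \<xi>2"
    using measurable_fst_snd_borel unfolding measurable_cong_sets[OF s2(1) refl] .
  have e1: "emeasure (distr \<xi>2 borel fst) E = emeasure (empirical_measure n x) E" if E: "E \<in> sets borel" for E
  proof -
    have "emeasure (distr \<xi>2 borel fst) E = (\<integral>\<^sup>+ v. indicator E (fst v) \<partial>\<xi>2)"
      using E fs2 by (intro emeasure_distr_nn_integral)
    also have "\<dots> = (\<Sum>i<n. \<integral>\<^sup>+ w. g i w * indicator E (x i) \<partial>\<xi>)"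
      using I2[OF measurable_compose[OF measurable_fst_snd_borel(1) borel_measurable_indicator[OF E]]] by simp
    also have "\<dots> = (\<Sum>i<n. ennreal (indicator E (x i) / n))"
      by (intro sum.cong refl) (simp add: nn_integral_multc gint split: split_indicator)
    also have "\<dots> = ennreal (\<Sum>i<n. indicator E (x i) / n)"
      by (rule sum_ennreal) auto
    also have "(\<Sum>i<n. indicator E (x i) / n) = card {i. i < n \<and> x i \<in> E} / n"
    proof -
      have "(\<Sum>i<n. indicator E (x i) :: real) = (\<Sum>i\<in>{i. i < n \<and> x i \<in> E}. 1)"
        by (rule sum.mono_neutral_cong_right) (auto split: split_indicator)
      also have "\<dots> = card {i. i < n \<and> x i \<in> E}" by simp
      finally show ?thesis by (simp flip: sum_divide_distrib)
    qed
    finally show ?thesis using E by (simp add: emeasure_empirical_measure)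
  qed
  have m1: "distr \<xi>2 borel fst = empirical_measure n x"
    using e1 by (intro measure_eqI) (auto simp: empirical_measure_def)
  have e2: "emeasure (distr \<xi>2 borel snd) E = emeasure (distr \<xi> borel snd) E" if E: "E \<in> sets borel" for E
  proof -
    have Em: "(\<lambda>w. indicator E (snd w) :: ennreal) \<in> borel_measurable \<xi>"
      using measurable_compose[OF fs(2) borel_measurable_indicator[OF E]] .
    have "emeasure (distr \<xi>2 borel snd) E = (\<integral>\<^sup>+ v. indicator E (snd v) \<partial>\<xi>2)"
      using E fs2 by (intro emeasure_distr_nn_integral)
    also have "\<dots> = (\<Sum>i<n. \<integral>\<^sup>+ w. g i w * indicator E (snd w) \<partial>\<xi>)"
      using I2[OF measurable_compose[OF measurable_fst_snd_borel(2) borel_measurable_indicator[OF E]]] by simp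
    also have "\<dots> = (\<integral>\<^sup>+ w. indicator E (snd w) \<partial>\<xi>)"
      using Em by (rule total)
    also have "\<dots> = emeasure (distr \<xi> borel snd) E"
      using E fs by (intro emeasure_distr_nn_integral[symmetric])
    finally show ?thesis .
  qed
  have m2: "distr \<xi>2 borel snd = \<mu>"
    unfolding \<xi>'(4)[symmetric] using e2 by (intro measure_eqI) auto
  have "emeasure \<xi>2 (space \<xi>2) = emeasure (distr \<xi>2 borel fst) UNIV"
    using fs2(1) by (simp add: emeasure_distr s2)
  also have "\<dots> = 1" using e1[of UNIV] n by (simp add: emeasure_empirical_measure)
  finally have "prob_space \<xi>2" by (rule prob_spaceI)
  then have C: "\<xi>2 \<in> couplings (empirical_measure n x) \<mu>"
    unfolding couplings_def using s2 m1 m2 by blast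
  \<comment> \<open>On the joint law of index and pair, the new transport distance is at most
    \<open>a + b\<close>: the displacement of the atom plus the old transport distance.\<close>
  define a where "a v = norm (x (fst v) - y (fst v))" for v :: "nat \<times> 'a \<times> 'a"
  define b where "b v = norm (y (fst v) - snd (snd v))" for v :: "nat \<times> 'a \<times> 'a"
  have am: "a \<in> borel_measurable ?K"
    by (rule pm) (simp add: a_def)
  have norm_m: "(\<lambda>w. norm (u - snd w)) \<in> borel_measurable \<xi>" for u
    by (rule measurable_compose[OF fs(2), where g = "\<lambda>z. norm (u - z)"])
      (intro borel_measurable_continuous_onI continuous_intros)
  have bm: "b \<in> borel_measurable ?K"
    by (rule pm) (simp add: b_def norm_m)
  have KN: "f \<in> borel_measurable N" if "f \<in> borel_measurable ?K" for f :: "_ \<Rightarrow> real"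
    using that by (simp add: N_def)
  have Ia: "(\<integral>\<^sup>+ v. ennreal (a v powr p) \<partial>N) \<le> ennreal (A powr p)"
  proof -
    have "(\<integral>\<^sup>+ v. ennreal (a v powr p) \<partial>N) = (\<Sum>i<n. \<integral>\<^sup>+ w. g i w * ennreal (norm (x i - y i) powr p) \<partial>\<xi>)"
      using am by (subst NI) (auto simp: a_def)
    also have "\<dots> = (\<Sum>i<n. ennreal (norm (x i - y i) powr p / n))"
      by (intro sum.cong refl) (simp add: nn_integral_multc gint flip: ennreal_mult)
    also have "\<dots> = ennreal (\<Sum>i<n. norm (x i - y i) powr p / n)"
      by (rule sum_ennreal) auto
    also have "\<dots> \<le> ennreal (A powr p)"
      using A by (intro ennreal_leI) (simp add: sum_divide_distrib)
    finally show ?thesis .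
  qed
  have Ib: "(\<integral>\<^sup>+ v. ennreal (b v powr p) \<partial>N) \<le> ennreal (B powr p)"
  proof -
    have hm: "(\<lambda>w. ennreal (norm (fst w - snd w) powr p)) \<in> borel_measurable \<xi>"
      using measurable_dist_powr[of p] unfolding case_prod_beta measurable_cong_sets[OF \<xi>'(2) refl] .
    have "(\<integral>\<^sup>+ v. ennreal (b v powr p) \<partial>N) = (\<Sum>i<n. \<integral>\<^sup>+ w. g i w * ennreal (norm (y i - snd w) powr p) \<partial>\<xi>)"
    proof -
      have "(\<lambda>v. ennreal (b v powr p)) \<in> borel_measurable ?K" using bm by measurable
      from NI[OF this] show ?thesis by (simp add: b_def)
    qed
    \<comment> \<open>Wherever \<open>g i w\<close> is nonzero, \<open>fst w = y i\<close>.\<close>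
    also have "\<dots> = (\<Sum>i<n. \<integral>\<^sup>+ w. g i w * ennreal (norm (fst w - snd w) powr p) \<partial>\<xi>)"
      by (intro sum.cong refl nn_integral_cong) (auto simp: g_def split: split_indicator)
    also have "\<dots> = (\<integral>\<^sup>+ w. ennreal (norm (fst w - snd w) powr p) \<partial>\<xi>)"
      using hm by (rule total)
    finally show ?thesis using B by (simp add: case_prod_unfold)
  qed
  have "(\<integral>\<^sup>+ (u, z). ennreal (norm (u - z) powr p) \<partial>\<xi>2) = (\<integral>\<^sup>+ v. ennreal (norm (x (fst v) - snd (snd v)) powr p) \<partial>N)"
    unfolding \<xi>2_def using nn_integral_distr[OF TN, of "\<lambda>(u, z). ennreal (norm (u - z) powr p)"]
      measurable_dist_powr[where 'a = 'a and p = p]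
    by (simp add: T_def case_prod_unfold)
  also have "\<dots> \<le> (\<integral>\<^sup>+ v. ennreal ((a v + b v) powr p) \<partial>N)"
    using p unfolding a_def b_def
    by (intro nn_integral_mono ennreal_leI powr_mono2) (auto intro: norm_diff_triangle_le)
  also have "\<dots> \<le> ennreal ((A + B) powr p)"
    by (rule minkowski_nn_integral[OF KN[OF am] KN[OF bm] _ _ p AB Ia Ib]) (simp_all add: a_def b_def)
  finally show ?thesis using C by blast
qed

text \<open>The values are extended reals, so that finiteness at one configuration can afterwards be
  carried to all others by this very estimate.\<close>

theorem wasserstein_empirical_lipschitz:
  fixes \<mu> :: "'a::real_normed_vector measure" and x y :: "nat \<Rightarrow> 'a"
  assumes n: "1 \<le> n" and p: "1 \<le> p"
  shows "wasserstein p (empirical_measure n x) \<mu>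
    \<le> wasserstein p (empirical_measure n y) \<mu> + ennreal (n powr (- 1 / max 2 p) * l2_dist n x y)"
proof -
  define \<delta> where "\<delta> = n powr (- 1 / max 2 p) * l2_dist n x y"
  have \<delta>: "0 \<le> \<delta>" by (simp add: \<delta>_def l2_dist_nonneg)
  have le: "wasserstein p (empirical_measure n x) \<mu>
      \<le> ennpowr (\<integral>\<^sup>+ (u, z). ennreal (norm (u - z) powr p) \<partial>\<xi>) (1 / p) + ennreal \<delta>"
    if \<xi>: "\<xi> \<in> couplings (empirical_measure n y) \<mu>" for \<xi>
  proof (cases "(\<integral>\<^sup>+ (u, z). ennreal (norm (u - z) powr p) \<partial>\<xi>) = \<top>")
    case True
    then show ?thesis by (simp add: ennpowr_def)
  next
    case False
    define b where "b = enn2real (ennpowr (\<integral>\<^sup>+ (u, z). ennreal (norm (u - z) powr p) \<partial>\<xi>) (1 / p))"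
    have b0: "0 \<le> b" by (simp add: b_def)
    note * = le_ennpowr[OF p False, folded b_def]
    \<comment> \<open>The transfer of couplings wants positive bounds, while \<open>\<delta>\<close>
      and \<open>b\<close> may vanish; each is enlarged by \<open>e / 2\<close>.\<close>
    have "wasserstein p (empirical_measure n x) \<mu> \<le> ennreal (\<delta> + b) + ennreal e" if e: "e > 0" for e
    proof -
      have "(\<Sum>i<n. norm (x i - y i) powr p) / n \<le> \<delta> powr p"
        unfolding \<delta>_def l2_dist_def by (rule lp_le_l2[OF _ p n]) simp
      also have "\<dots> \<le> (\<delta> + e / 2) powr p"
        using \<delta> e p by (intro powr_mono2) auto
      finally have 1: "(\<Sum>i<n. norm (x i - y i) powr p) / n \<le> (\<delta> + e / 2) powr p" .
      have "b powr p \<le> (b + e / 2) powr p"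
        using b0 e p by (intro powr_mono2) auto
      then have "(\<integral>\<^sup>+ (u, z). ennreal (norm (u - z) powr p) \<partial>\<xi>) \<le> ennreal ((b + e / 2) powr p)"
        by (subst *(1)) (rule ennreal_leI)
      from coupling_transfer[OF \<xi> n p _ _ 1 this] obtain \<xi>' where
        \<xi>': "\<xi>' \<in> couplings (empirical_measure n x) \<mu>"
          "(\<integral>\<^sup>+ (u, z). ennreal (norm (u - z) powr p) \<partial>\<xi>') \<le> ennreal ((\<delta> + e / 2 + (b + e / 2)) powr p)"
        using \<delta> b0 e by auto
      have "wasserstein p (empirical_measure n x) \<mu> \<le> ennpowr (\<integral>\<^sup>+ (u, z). ennreal (norm (u - z) powr p) \<partial>\<xi>') (1 / p)"
        unfolding wasserstein_def by (rule INF_lower[OF \<xi>'(1)])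
      also have "\<dots> \<le> ennreal (\<delta> + e / 2 + (b + e / 2))"
        using \<delta> b0 e by (intro ennpowr_le[OF p \<xi>'(2)]) auto
      also have "\<dots> = ennreal (\<delta> + b) + ennreal e"
        using \<delta> b0 e by (simp flip: ennreal_plus)
      finally show ?thesis .
    qed
    then have "wasserstein p (empirical_measure n x) \<mu> \<le> ennreal (\<delta> + b)"
      by (rule ennreal_le_epsilon)
    also have "\<dots> = ennreal b + ennreal \<delta>"
      using \<delta> b0 by (simp add: add.commute)
    also have "ennreal b = ennpowr (\<integral>\<^sup>+ (u, z). ennreal (norm (u - z) powr p) \<partial>\<xi>) (1 / p)"
      unfolding b_def using *(2) by (simp add: ennreal_enn2real_if)
    finally show ?thesis .
  qed
  have "wasserstein p (empirical_measure n x) \<mu> - ennreal \<delta> \<le> wasserstein p (empirical_measure n y) \<mu>"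
    unfolding wasserstein_def[of p "empirical_measure n y"]
    using le by (intro INF_greatest) (simp add: ennreal_minus_le_iff add.commute)
  then show ?thesis
    unfolding \<delta>_def[symmetric] by (simp add: ennreal_minus_le_iff add.commute)
qed

section \<open>Exponential moments and finiteness of the distance\<close>

lemma integrable_exp_norm:
  fixes \<mu> :: "'a::real_normed_vector measure"
  assumes \<mu>: "prob_space \<mu>" "sets \<mu> = sets borel" "log_sobolev \<mu> C" and D: "separably_supported \<mu>"
    and C: "C \<ge> 0"
  shows "integrable \<mu> (\<lambda>z. exp (norm z))"
proof -
  let ?P = "Pi\<^sub>M {..<1::nat} (\<lambda>_. \<mu>)"
  have nm: "norm \<in> borel_measurable \<mu>"
    unfolding measurable_cong_sets[OF \<mu>(2) refl] by (rule borel_measurable_norm)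
  have comp: "(\<lambda>x. x 0) \<in> measurable ?P \<mu>" by (rule measurable_component_singleton) simp
  \<comment> \<open>On a product with a single factor the norm of the coordinate is 1-Lipschitz, so
    the Laplace bound at \<open>l = 1\<close> applies.\<close>
  have "integrable ?P (\<lambda>x. exp (1 * norm (x 0)))"
  proof (rule laplace_bound_lipschitz(2)[OF \<mu> D C, where L = 1])
    fix x y :: "nat \<Rightarrow> 'a"
    have "norm (x 0 - y 0) \<le> l2_dist 1 x y"
      unfolding l2_dist_def by (rule member_le_L2_set) auto
    then show "norm (x 0) \<le> norm (y 0) + 1 * l2_dist 1 x y"
      using norm_triangle_sub[of "x 0" "y 0"] by simp
  qed (use measurable_compose[OF comp nm] in auto)
  then have "integrable (distr ?P \<mu> (\<lambda>x. x 0)) (\<lambda>z. exp (norm z))"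
    using nm by (subst integrable_distr_eq[OF comp]) auto
  also have "distr ?P \<mu> (\<lambda>x. x 0) = \<mu>"
    using distr_PiM_component[of "{..<1::nat}" "\<lambda>_. \<mu>" 0] \<mu>(1) by simp
  finally show ?thesis .
qed

lemma powr_le_exp:
  fixes u p :: real
  assumes "0 \<le> u" "1 \<le> p"
  shows "u powr p \<le> p powr p * exp u"
proof -
  have "u / p \<le> exp (u / p)" using exp_ge_add_one_self[of "u / p"] by linarith
  then have "(u / p) powr p \<le> exp (u / p) powr p"
    using assms by (intro powr_mono2) auto
  also have "\<dots> = exp u" using assms by (simp add: powr_def)
  finally show ?thesis using assms by (simp add: powr_divide field_simps)
qed

text \<open>When all samples are 0, the empirical measure is the point mass at 0, and its coupling
  with \<open>\<mu>\<close> costs the \<open>p\<close>-th moment, which the exponential moment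
  dominates. The Lipschitz estimate carries finiteness to every sample.\<close>

lemma wasserstein_empirical_finite:
  fixes \<mu> :: "'a::real_normed_vector measure"
  assumes \<mu>: "prob_space \<mu>" "sets \<mu> = sets borel" and e: "integrable \<mu> (\<lambda>z. exp (norm z))"
    and n: "1 \<le> n" and p: "1 \<le> p"
  shows "wasserstein p (empirical_measure n x) \<mu> \<noteq> \<top>"
proof -
  interpret \<mu>: prob_space \<mu> by fact
  define T where "T z = (0 :: 'a, z)" for z :: 'a
  have T: "T \<in> borel_measurable \<mu>"
    unfolding measurable_cong_sets[OF \<mu>(2) refl] T_def[abs_def]
    by (intro borel_measurable_continuous_onI continuous_intros)
  define \<xi> where "\<xi> = distr \<mu> borel T"
  note fs = measurable_fst_snd_borel[where 'a = 'a]
  have "distr \<xi> borel fst = distr \<mu> borel (fst \<circ> T)"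
    unfolding \<xi>_def by (rule distr_distr[OF fs(1) T])
  also have "\<dots> = return borel 0"
    by (simp add: T_def comp_def)
  also have "\<dots> = empirical_measure n (\<lambda>_. 0)"
    unfolding empirical_measure_def using n
    by (intro prob_space.distr_const[symmetric] prob_space_uniform_count_measure) (auto simp: lessThan_empty_iff)
  finally have 1: "distr \<xi> borel fst = empirical_measure n (\<lambda>_. 0)" .
  have "distr \<xi> borel snd = distr \<mu> borel (snd \<circ> T)"
    unfolding \<xi>_def by (rule distr_distr[OF fs(2) T])
  also have "\<dots> = \<mu>"
    using \<mu>(2) by (simp add: T_def comp_def distr_id2)
  finally have "\<xi> \<in> couplings (empirical_measure n (\<lambda>_. 0)) \<mu>"
    using 1 \<mu>.prob_space_distr[OF T] by (simp add: couplings_def \<xi>_def)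
  then have "wasserstein p (empirical_measure n (\<lambda>_. 0)) \<mu>
      \<le> ennpowr (\<integral>\<^sup>+ (u, z). ennreal (norm (u - z) powr p) \<partial>\<xi>) (1 / p)"
    unfolding wasserstein_def by (rule INF_lower)
  also have "\<dots> < \<top>"
  proof -
    have "(\<integral>\<^sup>+ (u, z). ennreal (norm (u - z) powr p) \<partial>\<xi>) = (\<integral>\<^sup>+ z. ennreal (norm z powr p) \<partial>\<mu>)"
      using nn_integral_distr[OF T, of "\<lambda>(u, z). ennreal (norm (u - z) powr p)"]
        measurable_dist_powr[where 'a = 'a and p = p]
      by (simp add: \<xi>_def) (simp add: T_def)
    also have "\<dots> \<le> (\<integral>\<^sup>+ z. ennreal (p powr p * exp (norm z)) \<partial>\<mu>)"
      using p by (intro nn_integral_mono ennreal_leI powr_le_exp) auto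
    also have "\<dots> = ennreal (\<integral>z. p powr p * exp (norm z) \<partial>\<mu>)"
      using e by (intro nn_integral_eq_integral) auto
    also have "\<dots> < \<top>" by simp
    finally show ?thesis by (auto simp: ennpowr_def)
  qed
  finally have "wasserstein p (empirical_measure n (\<lambda>_. 0)) \<mu>
      + ennreal (n powr (- 1 / max 2 p) * l2_dist n x (\<lambda>_. 0)) < \<top>"
    by simp
  with wasserstein_empirical_lipschitz[OF n p, of x \<mu> "\<lambda>_. 0"] show ?thesis
    by (auto simp: top_unique)
qed

text \<open>A Lipschitz function need not be measurable for the product of the Borel algebras when the space
  is not separable, but it agrees with a measurable Lipschitz function on the closure of a sequence.\<close>

lemma measurable_lipschitz_modification:
  fixes F :: "(nat \<Rightarrow> 'a::real_normed_vector) \<Rightarrow> real" and y :: "nat \<Rightarrow> nat \<Rightarrow> 'a"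
  assumes F: "\<And>x. 0 \<le> F x" and lip: "\<And>x z. F x \<le> F z + L * l2_dist n x z" and L: "0 \<le> L"
  obtains G where "\<And>x. 0 \<le> G x" "\<And>x z. G x \<le> G z + L * l2_dist n x z"
    "G \<in> borel_measurable (Pi\<^sub>M {..<n} (\<lambda>_. borel))"
    "\<And>x. (\<And>e. e > 0 \<Longrightarrow> \<exists>j. l2_dist n x (y j) < e) \<Longrightarrow> G x = F x"
proof -
  \<comment> \<open>McShane's extension of \<open>F\<close> from the sequence \<open>y\<close>: the
    largest such Lipschitz function, and measurable as a countable infimum.\<close>
  define G where "G x = (INF j. F (y j) + L * l2_dist n x (y j))" for x
  have nn: "0 \<le> F (y j) + L * l2_dist n x (y j)" for x j
    using F L by (intro add_nonneg_nonneg mult_nonneg_nonneg l2_dist_nonneg)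
  have le: "G x \<le> F (y j) + L * l2_dist n x (y j)" for x j
    unfolding G_def using nn by (intro cINF_lower bdd_belowI[of _ 0]) auto
  have ge: "m \<le> G x" if "\<And>j. m \<le> F (y j) + L * l2_dist n x (y j)" for m x
    unfolding G_def using that by (intro cINF_greatest) auto
  show ?thesis
  proof (rule that)
    show "0 \<le> G x" for x using nn by (rule ge)
    fix x z
    have "G x - L * l2_dist n x z \<le> G z"
    proof (rule ge)
      fix j
      have "L * l2_dist n x (y j) \<le> L * (l2_dist n x z + l2_dist n z (y j))"
        using L by (intro mult_left_mono l2_dist_triangle)
      then show "G x - L * l2_dist n x z \<le> F (y j) + L * l2_dist n z (y j)"
        using le[of x j] by (simp add: algebra_simps)
    qed
    then show "G x \<le> G z + L * l2_dist n x z" by simp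
  next
    have nm: "(\<lambda>x. norm (x k - w)) \<in> borel_measurable (Pi\<^sub>M {..<n} (\<lambda>_. borel))" if "k < n" for k and w :: 'a
      using that
      by (intro measurable_compose[OF measurable_component_singleton]
          borel_measurable_continuous_onI continuous_intros) auto
    then have "(\<lambda>x. \<Sum>k<n. (norm (x k - y j k))\<^sup>2) \<in> borel_measurable (Pi\<^sub>M {..<n} (\<lambda>_. borel))" for j
      by (intro borel_measurable_sum borel_measurable_power) auto
    then have "(\<lambda>x. l2_dist n x (y j)) \<in> borel_measurable (Pi\<^sub>M {..<n} (\<lambda>_. borel))" for j
      unfolding l2_dist_def L2_set_def by measurable
    then show "G \<in> borel_measurable (Pi\<^sub>M {..<n} (\<lambda>_. borel))"
      unfolding G_def[abs_def]
      by (intro borel_measurable_cINF_real borel_measurable_add borel_measurable_times borel_measurable_const) auto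
  next
    fix x assume dense: "\<And>e. e > 0 \<Longrightarrow> \<exists>j. l2_dist n x (y j) < e"
    have "G x \<le> F x + e" if e: "e > 0" for e
    proof -
      obtain j where j: "l2_dist n x (y j) < e / (2 * (L + 1))"
        using dense[of "e / (2 * (L + 1))"] e L by auto
      have "2 * L * l2_dist n x (y j) \<le> 2 * L * (e / (2 * (L + 1)))"
        using j L by (intro mult_left_mono) auto
      also have "\<dots> \<le> e" using e L by (simp add: field_simps)
      finally show ?thesis
        using le[of x j] lip[of "y j" x] by (simp add: l2_dist_commute)
    qed
    then have "G x \<le> F x" by (rule field_le_epsilon)
    moreover have "F x \<le> G x" using lip by (rule ge)
    ultimately show "G x = F x" by simp
  qed
qed

section \<open>Concentration of the Wasserstein distance\<close>

theorem theorem5p4: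
  fixes \<mu> :: "'a::banach measure"
    and M :: "'w measure"
    and X :: "nat \<Rightarrow> 'w \<Rightarrow> 'a"
    and n :: nat
    and p C t :: real
  assumes "1 \<le> p"
    and "prob_space \<mu>"
    and "sets \<mu> = sets borel"
    and "separably_supported \<mu>"
    and "log_sobolev \<mu> C"
    and "1 \<le> n"
    and "prob_space M"
    and "prob_space.indep_vars M (\<lambda>_. borel) X {..<n}"
    and "\<And>i. i < n \<Longrightarrow> distr M borel (X i) = \<mu>"
    and "0 < t"
  shows "measure M
           {\<omega> \<in> space M.
              wasserstein p (empirical_measure n (\<lambda>i. X i \<omega>)) \<mu>
                \<ge> (\<integral>\<^sup>+ \<omega>'. wasserstein p (empirical_measure n (\<lambda>i. X i \<omega>')) \<mu> \<partial>M) + ennreal t}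
           \<le> exp (- (real n powr (2 / max 2 p) * t\<^sup>2 / (2 * C)))"
    (is "measure M ?A \<le> _")
proof -
  interpret M: prob_space M by fact
  show ?thesis
  proof (cases "0 < C")
    case False
    \<comment> \<open>For \<open>C = 0\<close> the quotient is 0 by division by zero, so the bound
      is 1; for \<open>C < 0\<close> the exponent is nonnegative.\<close>
    then have "0 \<le> - (real n powr (2 / max 2 p) * t\<^sup>2 / (2 * C))"
      by (simp add: divide_nonneg_nonpos)
    then have "1 \<le> exp (- (real n powr (2 / max 2 p) * t\<^sup>2 / (2 * C)))" by simp
    then show ?thesis using M.prob_le_1 order_trans by blast
  next
    case C: True
    note \<mu> = \<open>prob_space \<mu>\<close> \<open>sets \<mu> = sets borel\<close> \<open>log_sobolev \<mu> C\<close>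
    note p = \<open>1 \<le> p\<close> and n = \<open>1 \<le> n\<close> and D = \<open>separably_supported \<mu>\<close>
    let ?P = "Pi\<^sub>M {..<n} (\<lambda>_. \<mu>)" and ?B = "Pi\<^sub>M {..<n} (\<lambda>_. borel :: 'a measure)"
    interpret P: prob_space ?P by (rule prob_space_PiM) (rule \<mu>(1))
    have sP: "sets ?P = sets ?B" using \<mu>(2) by (intro sets_PiM_cong) auto
    define L where "L = n powr (- 1 / max 2 p)"
    have L: "0 < L" using n by (simp add: L_def)
    define F where "F x = enn2real (wasserstein p (empirical_measure n x) \<mu>)" for x :: "nat \<Rightarrow> 'a"
    have WF: "wasserstein p (empirical_measure n x) \<mu> = ennreal (F x)" for x
      using wasserstein_empirical_finite[OF \<mu>(1,2) integrable_exp_norm[OF \<mu> D less_imp_le[OF C]] n p]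
      by (simp add: F_def ennreal_enn2real_if)
    have F0: "0 \<le> F x" for x by (simp add: F_def)
    have lip: "F x \<le> F y + L * l2_dist n x y" for x y
      using wasserstein_empirical_lipschitz[OF n p, of x \<mu> y] F0 L l2_dist_nonneg[of n x y]
      unfolding WF L_def[symmetric] by (simp add: ennreal_le_iff flip: ennreal_plus)
    obtain y :: "nat \<Rightarrow> nat \<Rightarrow> 'a" where y: "AE x in ?P. \<forall>e>0. \<exists>j. l2_dist n x (y j) < e"
      by (rule countable_approx_product[OF \<mu>(1) D])
    obtain G where G0: "\<And>x. 0 \<le> G x" and Glip: "\<And>x z. G x \<le> G z + L * l2_dist n x z"
      and Gm: "G \<in> borel_measurable ?B"
      and GF: "\<And>x. (\<And>e. e > 0 \<Longrightarrow> \<exists>j. l2_dist n x (y j) < e) \<Longrightarrow> G x = F x"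
      by (rule measurable_lipschitz_modification[where y = y, OF F0 lip less_imp_le[OF L]]) blast
    have GmP: "G \<in> borel_measurable ?P" using Gm by (simp add: measurable_cong_sets[OF sP refl])
    \<comment> \<open>Restriction makes the sample a point of the product space; the empirical
      measure reads the indices below \<open>n\<close> only.\<close>
    define S where "S \<omega> = (\<lambda>i\<in>{..<n}. X i \<omega>)" for \<omega>
    have Xm: "X i \<in> borel_measurable M" if "i < n" for i
      using assms(8) that unfolding M.indep_vars_def2 by simp
    have Sm: "S \<in> measurable M ?B"
      unfolding S_def[abs_def] using Xm by (intro measurable_restrict) auto
    have "distr M ?B S = Pi\<^sub>M {..<n} (\<lambda>i. distr M borel (X i))"
      using M.indep_vars_iff_distr_eq_PiM'[of "{..<n}" X "\<lambda>_. borel"] assms(8) Xm n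
      unfolding S_def[abs_def] by (auto simp: lessThan_empty_iff)
    also have "\<dots> = ?P" using assms(9) by (intro PiM_cong) auto
    finally have dS: "distr M ?B S = ?P" .
    have WS: "wasserstein p (empirical_measure n (\<lambda>i. X i \<omega>)) \<mu> = ennreal (F (S \<omega>))" for \<omega>
    proof -
      have "empirical_measure n (\<lambda>i. X i \<omega>) = empirical_measure n (S \<omega>)"
        unfolding empirical_measure_def
        by (intro distr_cong) (auto simp: S_def space_uniform_count_measure)
      then show ?thesis by (simp add: WF)
    qed
    have "AE x in distr M ?B S. F x = G x"
      using y GF unfolding dS by auto
    from AE_distrD[OF Sm this] have AE: "AE \<omega> in M. F (S \<omega>) = G (S \<omega>)" .
    define E where "E = (\<integral>x. G x \<partial>?P)"
    have E0: "0 \<le> E" using G0 by (simp add: E_def)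
    \<comment> \<open>Almost sure equality replaces \<open>F\<close> by the measurable
      \<open>G\<close> before the integral is transported to the product.\<close>
    have "(\<integral>\<^sup>+ \<omega>. ennreal (F (S \<omega>)) \<partial>M) = (\<integral>\<^sup>+ \<omega>. ennreal (G (S \<omega>)) \<partial>M)"
      using AE by (intro nn_integral_cong_AE) auto
    also have "\<dots> = (\<integral>\<^sup>+ x. ennreal (G x) \<partial>distr M ?B S)"
      using Gm by (subst nn_integral_distr[OF Sm]) auto
    also have "\<dots> = ennreal E"
      unfolding dS E_def using G0
      by (intro nn_integral_eq_integral laplace_bound_lipschitz(1)[OF \<mu> D less_imp_le[OF C] less_imp_le[OF L] G0 Glip GmP])
        auto
    finally have EW: "(\<integral>\<^sup>+ \<omega>. ennreal (F (S \<omega>)) \<partial>M) = ennreal E" .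
    define A' where "A' = {\<omega> \<in> space M. E + t \<le> G (S \<omega>)}"
    have A: "?A = {\<omega> \<in> space M. E + t \<le> F (S \<omega>)}"
      unfolding WS EW using E0 F0 \<open>0 < t\<close> by (simp flip: ennreal_plus)
    have A'm: "A' \<in> sets M"
      unfolding A'_def using measurable_compose[OF Sm Gm] by measurable
    have "measure M ?A \<le> measure M A'"
    \<comment> \<open>For a set outside the sigma-algebra \<open>measure\<close> returns 0, and the
      comparison is trivial.\<close>
    proof (cases "?A \<in> sets M")
      case True
      have "AE \<omega> in M. \<omega> \<in> ?A \<longrightarrow> \<omega> \<in> A'"
        using AE unfolding A A'_def by eventually_elim auto
      then show ?thesis using A'm by (rule M.finite_measure_mono_AE)
    next
      case False
      then show ?thesis by (simp add: measure_notin_sets)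
    qed
    also have "measure M A' = measure ?P {x \<in> space ?P. E + t \<le> G x}"
    proof -
      have "{x \<in> space ?B. E + t \<le> G x} \<in> sets ?B" using Gm by measurable
      then have "measure (distr M ?B S) {x \<in> space ?B. E + t \<le> G x} = measure M (S -` {x \<in> space ?B. E + t \<le> G x} \<inter> space M)"
        by (rule measure_distr[OF Sm])
      also have "S -` {x \<in> space ?B. E + t \<le> G x} \<inter> space M = A'"
        using measurable_space[OF Sm] by (auto simp: A'_def)
      finally show ?thesis
        unfolding dS using sets_eq_imp_space_eq[OF sP] by simp
    qed
    also have "\<dots> \<le> exp (- (t\<^sup>2 / (2 * C * L\<^sup>2)))"
      unfolding E_def by (rule chernoff_lipschitz[OF \<mu> D C L G0 Glip GmP \<open>0 < t\<close>])
    also have "t\<^sup>2 / (2 * C * L\<^sup>2) = real n powr (2 / max 2 p) * t\<^sup>2 / (2 * C)"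
    proof -
      have "L\<^sup>2 = n powr (- (2 / max 2 p))"
        using n by (simp add: L_def powr_powr flip: powr_numeral)
      then have "1 / L\<^sup>2 = n powr (2 / max 2 p)"
        by (simp only: powr_minus_divide div_by_1 divide_divide_eq_right mult_1)
      moreover have "t\<^sup>2 / (2 * C * L\<^sup>2) = 1 / L\<^sup>2 * t\<^sup>2 / (2 * C)" by simp
      ultimately show ?thesis by (simp only:)
    qed
    finally show ?thesis .
  qed
qed

end
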